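(* Let $\theta=(\theta(n))_{n\in\mathbb N}\in\{-1,1\}^{\mathbb N}$ and let $u=(u_n)_{n\in\mathbb N}$ be a strictly increasing sequence of integers such that for some $\delta<1$ and some constant $C$, for all $N\ge1$, $$\sup_{\alpha'\in\mathbb R}\left|\sum_{k=0}^{N-1}\theta(k)e^{2i\pi\alpha' u_k}\right|\le C N^{\delta}.$$ Define $\theta^{+},\theta^{-}\in\{0,1\}^{\mathbb N}$ by $\theta^{+}(k)=(\theta(k)+1)/2$ and $\theta^{-}(k)=(1-\theta(k))/2$. Let $\alpha$ be an irrational number and $(\mathbb T,\mathcal B,\mu,R_\alpha)$ the corresponding rotation dynamical system. Let $\beta\in(\delta,1)$, and suppose that there exist $\sigma>1-\beta$ and $\zeta\in(0,1]$ such that $\left|\frac{u_N}{N}-\zeta\right|=O(N^{-\sigma})$. Then there exists a continuous function $\tilde f:\mathbb T\to\mathbb R$ such that $$\frac1{N^{\beta}}\sum_{k=0}^{N-1}\theta^{+}(k)\,\tilde f\circ R_\alpha^{u_k}$$ converges in law to $\mathcal N(0,1)$ as $N\to+\infty$. Moreover, if $d$ is the Diophantine type of $\alpha$, then for every $a$ with $0<a<(1-\beta)/d$ the function $\tilde f$ can be taken in $\mathrm{lip}(a)$. The same conclusions hold with $\theta^{-}$ in place of $\theta^{+}$.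
   Context: $\mathbb N=\{0,1,2,\dots\}$; $\mathbb T=\mathbb R/\mathbb Z$ with its Borel $\sigma$-algebra $\mathcal B$ and Haar probability measure $\mu$; $R_\alpha x=x+\alpha \bmod 1$. A sequence $(Z_n)$ of real random variables on $(X,\mathcal B,\mu)$ converges in law to $\mathcal N(0,1)$ if for all $t\in\mathbb R$, $\lim_{n\to+\infty}\mu\{Z_n\ge t\}=\frac1{\sqrt{2\pi}}\int_t^{+\infty}e^{-v^2/2}\,dv$. $\mathrm{lip}(a)$ is the set of functions $f\in L^2(\mu)$ such that $|f(x)-f(y)|\le|x-y|^a$ (where $|x-y|$ is the distance on $\mathbb T$). The Diophantine type of an irrational $\alpha$ is $d=\sup\{\eta>0:\liminf_{n\to+\infty}n^{\eta}\|n\alpha\|=0\}$, where $\|\cdot\|$ is the distance to the nearest integer. *)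

theory Defs
  imports "HOL-Probability.Probability"
begin

definition nint_dist :: "real \<Rightarrow> real" where
  "nint_dist x = \<bar>x - of_int (round x)\<bar>"

lemma nint_dist_le: "nint_dist x \<le> \<bar>x - of_int m\<bar>"
  unfolding nint_dist_def using round_diff_minimal[of x m] by (simp add: abs_minus_commute)

lemma nint_dist_add_int: "nint_dist (x + of_int m) = nint_dist x"
proof -
  have "\<lfloor>x + of_int m + 1 / 2\<rfloor> = \<lfloor>x + 1 / 2\<rfloor> + m"
    using floor_add_int[of "x + 1 / 2" m] by (simp add: algebra_simps)
  then show ?thesis by (simp add: nint_dist_def round_def)
qed

lemma nint_dist_uminus: "nint_dist (- x) = nint_dist x"
proof -
  have "nint_dist (- y) \<le> nint_dist y" for y
    using nint_dist_le[of "- y" "- round y"] by (simp add: nint_dist_def)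
  from this[of x] this[of "- x"] show ?thesis by simp
qed

lemma nint_dist_triangle: "nint_dist (x + y) \<le> nint_dist x + nint_dist y"
  using nint_dist_le[of "x + y" "round x + round y"] by (simp add: nint_dist_def)

lemma nint_dist_eq_0_iff: "nint_dist x = 0 \<longleftrightarrow> x \<in> \<int>"
proof
  assume "nint_dist x = 0"
  then have "x = of_int (round x)" by (simp add: nint_dist_def)
  then show "x \<in> \<int>" by (metis Ints_of_int)
qed (auto simp: nint_dist_def elim: Ints_cases)

quotient_type circle = real / "\<lambda>x y. x - y \<in> \<int>"
  morphisms rep_circle to_circle
proof (rule equivpI)
  show "reflp (\<lambda>x y::real. x - y \<in> \<int>)"
    by (simp add: reflp_def)
  show "symp (\<lambda>x y::real. x - y \<in> \<int>)"
    by (auto simp: symp_def intro: Ints_minus dest: Ints_minus)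
  show "transp (\<lambda>x y::real. x - y \<in> \<int>)"
  proof (rule transpI)
    fix x y z :: real
    assume "x - y \<in> \<int>" "y - z \<in> \<int>"
    from Ints_add[OF this] show "x - z \<in> \<int>" by simp
  qed
qed

instantiation circle :: ab_group_add
begin

lift_definition zero_circle :: circle is "0 :: real" .

lift_definition plus_circle :: "circle \<Rightarrow> circle \<Rightarrow> circle" is "(+) :: real \<Rightarrow> _"
  by (metis Ints_add add_diff_add)

lift_definition uminus_circle :: "circle \<Rightarrow> circle" is "uminus :: real \<Rightarrow> _"
  by (metis Ints_minus minus_diff_minus)

lift_definition minus_circle :: "circle \<Rightarrow> circle \<Rightarrow> circle" is "(-) :: real \<Rightarrow> _"
  by (metis Ints_diff diff_diff_eq2 diff_add_eq diff_diff_add add.commute)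

instance
  by standard (transfer; simp)+

end

instantiation circle :: metric_space
begin

lift_definition dist_circle :: "circle \<Rightarrow> circle \<Rightarrow> real" is "\<lambda>x y. nint_dist (x - y)"
proof -
  fix x x' y y' :: real
  assume "x - x' \<in> \<int>" "y - y' \<in> \<int>"
  then obtain m n where "x = x' + of_int m" "y = y' + of_int n"
    by (auto elim!: Ints_cases simp: algebra_simps)
  then have "x - y = (x' - y') + of_int (m - n)" by simp
  then show "nint_dist (x - y) = nint_dist (x' - y')"
    by (simp only: nint_dist_add_int)
qed

definition uniformity_circle :: "(circle \<times> circle) filter" where
  "uniformity_circle = (INF e\<in>{0<..}. principal {(x, y). dist x y < e})"

definition open_circle :: "circle set \<Rightarrow> bool" where
  "open_circle U \<longleftrightarrow> (\<forall>x\<in>U. eventually (\<lambda>(x', y). x' = x \<longrightarrow> y \<in> U) uniformity)"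

instance
proof
  fix x y z :: circle
  show "dist x y = 0 \<longleftrightarrow> x = y"
    by transfer (simp add: nint_dist_eq_0_iff)
  show "dist x y \<le> dist x z + dist y z"
  proof transfer
    fix x y z :: real
    show "nint_dist (x - y) \<le> nint_dist (x - z) + nint_dist (y - z)"
      using nint_dist_triangle[of "x - z" "z - y"] nint_dist_uminus[of "y - z"] by simp
  qed
qed (simp_all add: uniformity_circle_def open_circle_def)

end

lemma continuous_to_circle: "continuous_on UNIV to_circle"
proof (rule continuous_on_iff[THEN iffD2], safe)
  fix x e :: real
  assume "e > 0"
  moreover have "dist (to_circle y) (to_circle x) \<le> dist y x" for y
    using nint_dist_le[of "y - x" 0] by (simp add: dist_circle.abs_eq dist_real_def)
  ultimately show "\<exists>d>0. \<forall>y\<in>UNIV. dist y x < d \<longrightarrow> dist (to_circle y) (to_circle x) < e"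
    by (meson le_less_trans)
qed

lemma measurable_to_circle [measurable]: "to_circle \<in> borel_measurable borel"
  by (rule borel_measurable_continuous_onI[OF continuous_to_circle])

definition circle_measure :: "circle measure" where
  "circle_measure = distr (uniform_measure lborel {0..<1}) borel to_circle"

lemma sets_circle_measure: "sets circle_measure = sets borel"
  by (simp add: circle_measure_def)

lemma prob_space_circle_measure: "prob_space circle_measure"
proof -
  interpret prob_space "uniform_measure lborel {0..<1::real}"
    by (rule prob_space_uniform_measure) auto
  show ?thesis unfolding circle_measure_def
    by (rule prob_space_distr) measurable
qed

lemma emeasure_circle_measure:
  assumes "B \<in> sets borel"
  shows "emeasure circle_measure B = emeasure lborel ({0..<1} \<inter> to_circle -` B)"
proof -
  have B: "to_circle -` B \<in> sets borel"
    using measurable_sets[OF measurable_to_circle assms] by simp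
  then show ?thesis
    using assms by (simp add: circle_measure_def emeasure_distr Int_commute divide_ennreal_def)
qed

lemma emeasure_lborel_translate:
  fixes A :: "real set"
  assumes "A \<in> sets borel"
  shows "emeasure lborel {x. c + x \<in> A} = emeasure lborel A"
proof -
  have "emeasure lborel A = emeasure (distr lborel borel ((+) c)) A"
    by (simp add: lborel_distr_plus)
  also have "\<dots> = emeasure lborel {x. c + x \<in> A}"
    using assms by (subst emeasure_distr) (auto simp: vimage_def)
  finally show ?thesis by simp
qed

text \<open>Translation invariance identifies \<open>circle_measure\<close> as the Haar probability measure.\<close>

lemma circle_measure_translation_invariant:
  assumes B: "B \<in> sets borel"
  shows "emeasure circle_measure {x. x + c \<in> B} = emeasure circle_measure B"
proof -
  define s where "s = frac (rep_circle c)"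
  have "rep_circle c - s \<in> \<int>" by (simp add: s_def frac_def)
  then have "to_circle (rep_circle c) = to_circle s"
    by (simp add: circle.abs_eq_iff)
  then have c: "c = to_circle s"
    by (simp add: Quotient_abs_rep[OF Quotient_circle])
  have s: "0 \<le> s" "s < 1" by (simp_all add: s_def frac_ge_0 frac_lt_1)
  define P where "P = to_circle -` B"
  have [measurable]: "P \<in> sets borel"
    using measurable_sets[OF measurable_to_circle B] by (simp add: P_def)
  have add: "to_circle x + c = to_circle (s + x)" for x
    by (simp add: c plus_circle.abs_eq add.commute)
  have per: "1 + x \<in> P \<longleftrightarrow> x \<in> P" for x
  proof -
    have "to_circle (1 + x) = to_circle x" by (simp add: circle.abs_eq_iff)
    then show ?thesis by (simp add: P_def)
  qed
  have cont: "continuous_on UNIV (\<lambda>x. x + c)"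
  proof -
    have "dist (x + c) (y + c) = dist x y" for x y :: circle
      by transfer simp
    then show ?thesis unfolding continuous_on_iff by auto
  qed
  have "(\<lambda>x. x + c) -` B \<inter> space borel \<in> sets borel"
    by (rule measurable_sets[OF borel_measurable_continuous_onI[OF cont] B])
  then have "{x. x + c \<in> B} \<in> sets borel" by (simp add: vimage_def)
  then have "emeasure circle_measure {x. x + c \<in> B} =
      emeasure lborel ({0..<1} \<inter> to_circle -` {x. x + c \<in> B})"
    by (rule emeasure_circle_measure)
  also have "{0..<1} \<inter> to_circle -` {x. x + c \<in> B} = {x. s + x \<in> {s..<s + 1} \<inter> P}"
    by (auto simp: P_def add)
  also have "emeasure lborel \<dots> = emeasure lborel ({s..<s + 1} \<inter> P)"
    by (rule emeasure_lborel_translate) simp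
  also have "{s..<s + 1} \<inter> P = ({s..<1} \<inter> P) \<union> ({1..<1 + s} \<inter> P)"
    using s by auto
  also have "emeasure lborel \<dots> = emeasure lborel ({s..<1} \<inter> P) + emeasure lborel ({1..<1 + s} \<inter> P)"
    by (rule plus_emeasure[symmetric]) auto
  also have "emeasure lborel ({1..<1 + s} \<inter> P) = emeasure lborel {x. 1 + x \<in> {1..<1 + s} \<inter> P}"
    by (rule emeasure_lborel_translate[symmetric]) simp
  also have "{x. 1 + x \<in> {1..<1 + s} \<inter> P} = {0..<s} \<inter> P"
    by (auto simp: per)
  also have "emeasure lborel ({s..<1} \<inter> P) + emeasure lborel ({0..<s} \<inter> P) =
      emeasure lborel (({s..<1} \<inter> P) \<union> ({0..<s} \<inter> P))"
    by (rule plus_emeasure) auto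
  also have "({s..<1} \<inter> P) \<union> ({0..<s} \<inter> P) = {0..<1} \<inter> to_circle -` B"
    using s by (auto simp: P_def)
  also have "emeasure lborel \<dots> = emeasure circle_measure B"
    by (rule emeasure_circle_measure[OF B, symmetric])
  finally show ?thesis .
qed

definition rotation :: "real \<Rightarrow> circle \<Rightarrow> circle" where
  "rotation \<alpha> x = x + to_circle \<alpha>"

lemma bij_rotation: "bij (rotation \<alpha>)"
  by (rule bij_betw_byWitness[where f' = "\<lambda>x. x - to_circle \<alpha>"]) (auto simp: rotation_def)

definition int_iterate :: "('a \<Rightarrow> 'a) \<Rightarrow> int \<Rightarrow> 'a \<Rightarrow> 'a" where
  "int_iterate T n = (if 0 \<le> n then T ^^ nat n else inv T ^^ nat (- n))"

definition converges_in_law_std_normal :: "'a measure \<Rightarrow> (nat \<Rightarrow> 'a \<Rightarrow> real) \<Rightarrow> bool" where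
  "converges_in_law_std_normal M Z \<longleftrightarrow>
     (\<forall>n. Z n \<in> borel_measurable M) \<and>
     (\<forall>t::real. (\<lambda>n. measure M {x \<in> space M. Z n x \<ge> t})
        \<longlonglongrightarrow> 1 / sqrt (2 * pi) * (LINT v:{t..}|lborel. exp (- v\<^sup>2 / 2)))"

text \<open>The Hoelder constant is exactly 1.\<close>

definition lip :: "real \<Rightarrow> (circle \<Rightarrow> real) set" where
  "lip a = {f. f \<in> borel_measurable circle_measure \<and> integrable circle_measure (\<lambda>x. (f x)\<^sup>2) \<and>
               (\<forall>x y. \<bar>f x - f y\<bar> \<le> dist x y powr a)}"

text \<open>The supremum is infinite for Liouville numbers, hence the extended reals.\<close>

definition diophantine_type :: "real \<Rightarrow> ereal" where
  "diophantine_type \<alpha> =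
     Sup {ereal \<eta> | \<eta>. \<eta> > 0 \<and>
       liminf (\<lambda>n. ereal (real n powr \<eta> * nint_dist (real n * \<alpha>))) = 0}"

definition theta_plus :: "(nat \<Rightarrow> real) \<Rightarrow> nat \<Rightarrow> real" where
  "theta_plus \<theta> k = (\<theta> k + 1) / 2"

definition theta_minus :: "(nat \<Rightarrow> real) \<Rightarrow> nat \<Rightarrow> real" where
  "theta_minus \<theta> k = (1 - \<theta> k) / 2"

definition normalized_sum ::
    "(nat \<Rightarrow> real) \<Rightarrow> (nat \<Rightarrow> int) \<Rightarrow> real \<Rightarrow> real \<Rightarrow> (circle \<Rightarrow> real) \<Rightarrow> nat \<Rightarrow> circle \<Rightarrow> real" where
  "normalized_sum w u \<alpha> \<beta> f N x =
     1 / (real N powr \<beta>) * (\<Sum>k<N. w k * f (int_iterate (rotation \<alpha>) (u k) x))"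

end

theory Submission
  imports Defs "HOL-Real_Asymp.Real_Asymp"
begin

text \<open>
  The function is a cosine series \<open>f x = \<Sum>\<^sub>j a\<^sub>j cos (2 \<pi> m\<^sub>j x)\<close> with absolutely summable
  coefficients. As \<open>\<theta>\<^sup>\<plusminus> = (1 \<plusminus> \<theta>) / 2\<close>, the hypothesis on exponential sums bounds the
  \<open>\<theta>\<close>-part uniformly by \<open>O(N\<^sup>\<delta>) = o(N\<^sup>\<beta>)\<close>. A strictly increasing integer sequence with
  \<open>u\<^sub>N / N \<rightarrow> \<zeta> \<le> 1\<close> has \<open>\<zeta> = 1\<close> and omits only \<open>o(N\<^sup>\<beta>)\<close> integers up to time \<open>N\<close>. What remains is
  half of an ordinary Birkhoff sum, which equals \<open>\<Sum>\<^sub>j a\<^sub>j D\<^sub>N (m\<^sub>j \<alpha>) cos (2 \<pi> m\<^sub>j x + \<dots>)\<close>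
  with the Dirichlet kernel \<open>D\<^sub>N\<close>.

  The frequencies are chosen such that \<open>m\<^sub>j \<alpha>\<close> mod 1 lies between consecutive points of the mesh
  \<open>\<epsilon>\<^sub>j = exp (- j\<^sup>3\<^sup>/\<^sup>4)\<close>, and \<open>a\<^sub>j\<^sup>2\<close> is proportional to \<open>\<epsilon>\<^sub>j\<^sup>g - \<epsilon>\<^sub>j\<^sub>+\<^sub>1\<^sup>g\<close> with
  \<open>g = 2 - 2 \<beta>\<close>. Since the ratio of consecutive mesh points tends to 1, the variance divided by
  \<open>N\<^sup>2\<^sup>\<beta>\<close> is a Riemann sum of a fixed convergent integral and each single term is negligible. Only the
  indices with \<open>\<epsilon>\<^sub>j\<close> close to \<open>1 / N\<close> contribute; on these windows the \<open>m\<^sub>j\<close> are made dissociated by a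
  greedy choice, so that the Salem--Zygmund argument with Riesz products yields the Gaussian limit. If \<open>\<alpha>\<close> has
  type \<open>d\<close>, any interval of length \<open>L\<close> is visited within \<open>L\<^sup>-\<^sup>D\<close> steps for each \<open>D > d\<close>, which
  bounds \<open>m\<^sub>j\<close> and gives the Hoelder exponent; removing finitely many terms makes the Hoelder constant 1
  without changing the limit.
\<close>

section \<open>Trigonometric integrals\<close>

abbreviation unit_interval_measure :: "real measure" where
  "unit_interval_measure \<equiv> uniform_measure lborel {0..<1}"

lemma prob_space_unit_interval_measure: "prob_space unit_interval_measure"
  by (rule prob_space_uniform_measure) auto

lemma integrable_unit_interval_measure:
  fixes f :: "real \<Rightarrow> 'b :: {banach, second_countable_topology}"
  assumes "f \<in> borel_measurable borel" "\<And>x. norm (f x) \<le> B"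
  shows "integrable unit_interval_measure f"
proof -
  interpret prob_space unit_interval_measure by (rule prob_space_unit_interval_measure)
  show ?thesis
    by (rule integrable_const_bound[where B = B]) (use assms in auto)
qed

text \<open>Passes from the half-open fundamental domain to the closed interval, on which the
  fundamental theorem of calculus applies; the two differ by the null set
  \<open>{1}\<close>.\<close>

lemma integral_unit_interval_measure:
  fixes f :: "real \<Rightarrow> 'b :: {banach, second_countable_topology}"
  assumes [measurable]: "f \<in> borel_measurable borel"
  shows "integral\<^sup>L unit_interval_measure f = (LINT x:{0..1}|lborel. f x)"
proof -
  have "unit_interval_measure = density lborel (\<lambda>x. ennreal (indicator {0..<1} x))"
    by (simp add: uniform_measure_def ennreal_indicator divide_ennreal_def)
  then have "integral\<^sup>L unit_interval_measure f = (\<integral>x. indicator {0..<1} x *\<^sub>R f x \<partial>lborel)"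
    by (simp add: integral_density)
  also have "\<dots> = (\<integral>x. indicator {0..1} x *\<^sub>R f x \<partial>lborel)"
  proof (rule integral_cong_AE)
    show "AE x in lborel. indicator {0..<1} x *\<^sub>R f x = indicator {0..1} x *\<^sub>R f x"
      using AE_lborel_singleton[of "1::real"] by eventually_elim (auto simp: indicator_def)
  qed auto
  finally show ?thesis by (simp add: set_lebesgue_integral_def)
qed

lemma integral_cis_unit_interval:
  fixes n :: int
  assumes "n \<noteq> 0"
  shows "(\<integral>x. cis (2 * pi * of_int n * x + \<phi>) \<partial>unit_interval_measure) = 0"
proof -
  define c where "c = 2 * pi * of_int n"
  have c: "c \<noteq> 0" using assms by (simp add: c_def)
  have cont: "continuous_on A (\<lambda>x. cis (c * x + \<phi>))" for A
    by (intro continuous_intros)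
  have meas: "(\<lambda>x. cis (c * x + \<phi>)) \<in> borel_measurable borel"
    by (rule borel_measurable_continuous_onI[OF cont])
  have deriv: "((\<lambda>x. cis (c * x + \<phi>) / (\<i> * c)) has_vector_derivative cis (c * x + \<phi>)) (at x within {0..1})" for x
    unfolding cis_conv_exp
    by (rule derivative_eq_intros has_vector_derivative_real_field refl exI
         | (use c in \<open>auto simp: field_simps\<close>))+
  have "((\<lambda>x. cis (c * x + \<phi>)) has_integral (cis (c * 1 + \<phi>) / (\<i> * c) - cis (c * 0 + \<phi>) / (\<i> * c))) {0..1}"
    by (rule fundamental_theorem_of_calculus[OF _ deriv]) auto
  moreover have "cis (c * 1 + \<phi>) = cis \<phi>"
    by (simp add: cis_mult[symmetric] c_def cis_multiple_2pi)
  ultimately have "integral {0..1} (\<lambda>x. cis (c * x + \<phi>)) = 0"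
    by (simp add: integral_unique)
  moreover have "set_integrable lborel {0..1} (\<lambda>x. cis (c * x + \<phi>))"
    by (rule borel_integrable_atLeastAtMost') (rule cont)
  ultimately have "(LINT x:{0..1}|lborel. cis (c * x + \<phi>)) = 0"
    using set_borel_integral_eq_integral(2) by metis
  then show ?thesis
    unfolding c_def[symmetric] using integral_unit_interval_measure[OF meas] by simp
qed

lemma integral_cos_unit_interval:
  fixes n :: int
  assumes "n \<noteq> 0"
  shows "(\<integral>x. cos (2 * pi * of_int n * x + \<phi>) \<partial>unit_interval_measure) = 0"
proof -
  have "(\<lambda>x. cis (2 * pi * of_int n * x + \<phi>)) \<in> borel_measurable borel"
    by (intro borel_measurable_continuous_onI continuous_intros)
  then have "integrable unit_interval_measure (\<lambda>x. cis (2 * pi * of_int n * x + \<phi>))"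
    by (rule integrable_unit_interval_measure[where B = 1]) simp
  from integral_Re[OF this] show ?thesis
    by (simp add: integral_cis_unit_interval[OF assms])
qed

text \<open>Orthogonality with arbitrary phases: a product of two cosines splits into the
  frequencies \<open>m i - m j\<close> and \<open>m i + m j\<close>. Positivity keeps the sum away
  from 0, injectivity the difference when \<open>i\<close> and \<open>j\<close> are distinct; on the
  diagonal the difference term leaves 1/2.\<close>

lemma second_moment_cos_sum:
  fixes m :: "'i \<Rightarrow> int" and b \<phi> :: "'i \<Rightarrow> real"
  assumes fin: "finite A" and pos: "\<And>j. j \<in> A \<Longrightarrow> m j > 0" and inj: "inj_on m A"
  shows "(\<integral>x. (\<Sum>j\<in>A. b j * cos (2 * pi * of_int (m j) * x + \<phi> j))\<^sup>2 \<partial>unit_interval_measure)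
       = (\<Sum>j\<in>A. (b j)\<^sup>2) / 2"
proof -
  let ?M = unit_interval_measure
  interpret prob_space ?M by (rule prob_space_unit_interval_measure)
  have int: "integrable ?M (\<lambda>x. cos (2 * pi * of_int n * x + c))" for n c
    by (rule integrable_unit_interval_measure[where B = 1])
       (auto intro!: borel_measurable_continuous_onI continuous_intros)
  define p where "p i j x = cos (2 * pi * of_int (m i - m j) * x + (\<phi> i - \<phi> j)) / 2
     + cos (2 * pi * of_int (m i + m j) * x + (\<phi> i + \<phi> j)) / 2" for i j x
  have eq: "(\<Sum>j\<in>A. b j * cos (2 * pi * of_int (m j) * x + \<phi> j))\<^sup>2 = (\<Sum>i\<in>A. \<Sum>j\<in>A. b i * b j * p i j x)" for x
  proof -
    have "(\<Sum>j\<in>A. b j * cos (2 * pi * of_int (m j) * x + \<phi> j))\<^sup>2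
      = (\<Sum>i\<in>A. \<Sum>j\<in>A. (b i * cos (2 * pi * of_int (m i) * x + \<phi> i)) * (b j * cos (2 * pi * of_int (m j) * x + \<phi> j)))"
      by (simp add: power2_eq_square sum_product)
    also have "\<dots> = (\<Sum>i\<in>A. \<Sum>j\<in>A. b i * b j * p i j x)"
    proof (intro sum.cong refl)
      fix i j
      have "cos (2 * pi * of_int (m i) * x + \<phi> i) * cos (2 * pi * of_int (m j) * x + \<phi> j) = p i j x"
        unfolding cos_times_cos p_def by (simp add: algebra_simps add_divide_distrib)
      then show "(b i * cos (2 * pi * of_int (m i) * x + \<phi> i)) * (b j * cos (2 * pi * of_int (m j) * x + \<phi> j)) = b i * b j * p i j x"
        by (metis mult.assoc mult.left_commute)
    qed
    finally show ?thesis .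
  qed
  have pint: "integrable ?M (p i j)" for i j
    unfolding p_def by (intro Bochner_Integration.integrable_add integrable_divide int)
  have pval: "integral\<^sup>L ?M (p i j) = (if i = j then 1 / 2 else 0)" if "i \<in> A" "j \<in> A" for i j
  proof -
    have "integral\<^sup>L ?M (p i j) = (\<integral>x. cos (2 * pi * of_int (m i - m j) * x + (\<phi> i - \<phi> j)) \<partial>?M) / 2
      + (\<integral>x. cos (2 * pi * of_int (m i + m j) * x + (\<phi> i + \<phi> j)) \<partial>?M) / 2"
      unfolding p_def by (subst Bochner_Integration.integral_add) (auto intro!: int integrable_divide simp del: of_int_diff of_int_add)
    also have "(\<integral>x. cos (2 * pi * of_int (m i + m j) * x + (\<phi> i + \<phi> j)) \<partial>?M) = 0"
      using pos[OF that(1)] pos[OF that(2)] by (intro integral_cos_unit_interval) auto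
    also have "(\<integral>x. cos (2 * pi * of_int (m i - m j) * x + (\<phi> i - \<phi> j)) \<partial>?M) = (if i = j then 1 else 0)"
    proof (cases "i = j")
      case True
      then show ?thesis using prob_space by simp
    next
      case False
      then have "m i - m j \<noteq> 0" using inj that by (auto dest: inj_onD)
      from integral_cos_unit_interval[OF this] show ?thesis using False by auto
    qed
    finally show ?thesis by auto
  qed
  have "(\<integral>x. (\<Sum>i\<in>A. \<Sum>j\<in>A. b i * b j * p i j x) \<partial>?M) = (\<Sum>i\<in>A. \<Sum>j\<in>A. b i * b j * integral\<^sup>L ?M (p i j))"
    by (simp add: pint)
  also have "\<dots> = (\<Sum>i\<in>A. \<Sum>j\<in>A. if i = j then (b i)\<^sup>2 / 2 else 0)"
    by (intro sum.cong refl) (auto simp: pval power2_eq_square)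
  also have "\<dots> = (\<Sum>i\<in>A. (b i)\<^sup>2 / 2)"
    using fin by (simp add: sum.delta)
  finally show ?thesis unfolding eq by (simp add: sum_divide_distrib)
qed

text \<open>Jensen's inequality reduces this to the second moment, and the factor 1/2 is given away.
  The first absolute moment is the form in which remainders enter differences of characteristic
  functions.\<close>

lemma first_moment_cos_sum:
  fixes m :: "'i \<Rightarrow> int" and b \<phi> :: "'i \<Rightarrow> real"
  assumes "finite A" "\<And>j. j \<in> A \<Longrightarrow> m j > 0" "inj_on m A"
  shows "(\<integral>x. \<bar>\<Sum>j\<in>A. b j * cos (2 * pi * of_int (m j) * x + \<phi> j)\<bar> \<partial>unit_interval_measure)
       \<le> sqrt (\<Sum>j\<in>A. (b j)\<^sup>2)"
proof -
  let ?M = unit_interval_measure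
  let ?X = "\<lambda>x. \<Sum>j\<in>A. b j * cos (2 * pi * of_int (m j) * x + \<phi> j)"
  interpret prob_space ?M by (rule prob_space_unit_interval_measure)
  have meas: "?X \<in> borel_measurable borel"
    by (intro borel_measurable_continuous_onI continuous_intros)
  have bd: "\<bar>?X x\<bar> \<le> (\<Sum>j\<in>A. \<bar>b j\<bar>)" for x
    by (rule order_trans[OF sum_abs sum_mono]) (simp add: abs_mult mult_left_le)
  have bd2: "(?X x)\<^sup>2 \<le> (\<Sum>j\<in>A. \<bar>b j\<bar>)\<^sup>2" for x
    using power_mono[OF bd[of x], of 2] by simp
  have int1: "integrable ?M (\<lambda>x. \<bar>?X x\<bar>)"
    by (rule integrable_unit_interval_measure[where B = "\<Sum>j\<in>A. \<bar>b j\<bar>"])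
       (use meas bd in auto)
  have int2: "integrable ?M (\<lambda>x. \<bar>?X x\<bar>\<^sup>2)"
    by (rule integrable_unit_interval_measure[where B = "(\<Sum>j\<in>A. \<bar>b j\<bar>)\<^sup>2"])
       (use meas bd2 in auto)
  have "(\<integral>x. \<bar>?X x\<bar> \<partial>?M)\<^sup>2 \<le> (\<integral>x. \<bar>?X x\<bar>\<^sup>2 \<partial>?M)"
    by (rule jensens_inequality[where I = UNIV, OF int1 _ _ int2]) (auto simp: convex_power2)
  also have "\<dots> = (\<Sum>j\<in>A. (b j)\<^sup>2) / 2"
    using second_moment_cos_sum[OF assms] by simp
  also have "\<dots> \<le> (\<Sum>j\<in>A. (b j)\<^sup>2)"
    by (simp add: sum_nonneg)
  finally show ?thesis by (rule real_le_rsqrt)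
qed

section \<open>Gaussian approximation for dissociated cosine sums\<close>

text \<open>The coefficients -1, 0, 1 are those that arise when a product of factors
  \<open>1 + c j * cos\<close> is expanded, each cosine carrying the frequencies \<open>m j\<close>
  and \<open>- m j\<close>.\<close>

definition dissociated :: "('i \<Rightarrow> int) \<Rightarrow> 'i set \<Rightarrow> bool" where
  "dissociated m W \<longleftrightarrow> (\<forall>s. (\<forall>j\<in>W. s j \<in> {-1, 0, 1}) \<longrightarrow> (\<Sum>j\<in>W. s j * m j) = 0 \<longrightarrow> (\<forall>j\<in>W. s j = 0))"

text \<open>Expanding gives one exponential per sign vector. Dissociation makes the zero vector the
  only one with frequency 0, and its coefficient is 1; all other terms integrate to 0.\<close>

lemma integral_riesz_product:
  fixes m :: "'i \<Rightarrow> int" and c :: "'i \<Rightarrow> complex" and \<phi> :: "'i \<Rightarrow> real"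
  assumes fin: "finite W" and dis: "dissociated m W"
  shows "(\<integral>x. (\<Prod>j\<in>W. 1 + c j * of_real (cos (2 * pi * of_int (m j) * x + \<phi> j))) \<partial>unit_interval_measure) = 1"
proof -
  let ?M = unit_interval_measure
  interpret prob_space ?M by (rule prob_space_unit_interval_measure)
  define k where "k j s = (if s = 0 then 1 else c j / 2)" for j and s :: int
  define S where "S = PiE W (\<lambda>_. {-1, 0, 1 :: int})"
  have finS: "finite S" unfolding S_def using fin by (intro finite_PiE) auto
  have fac: "1 + c j * of_real (cos t) = (\<Sum>s\<in>{-1, 0, 1}. k j s * cis (of_int s * t))" for j t
  proof -
    have cos: "complex_of_real (cos t) = (cis t + cis (- t)) / 2"
      by (simp add: complex_eq_iff)
    show ?thesis unfolding cos by (simp add: k_def field_simps)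
  qed
  have cis_sum: "(\<Prod>j\<in>A. cis (g j)) = cis (\<Sum>j\<in>A. g j)" for A :: "'i set" and g
    by (induction A rule: infinite_finite_induct) (auto simp: cis_mult)
  define K where "K s = (\<Prod>j\<in>W. k j (s j))" for s
  have expand: "(\<Prod>j\<in>W. 1 + c j * of_real (cos (2 * pi * of_int (m j) * x + \<phi> j)))
     = (\<Sum>s\<in>S. K s * cis (2 * pi * of_int (\<Sum>j\<in>W. s j * m j) * x + (\<Sum>j\<in>W. of_int (s j) * \<phi> j)))" for x
    unfolding fac S_def
    by (subst prod_sum_PiE[OF fin])
       (auto simp: prod.distrib cis_sum K_def sum.distrib[symmetric] sum_distrib_left sum_distrib_right algebra_simps
         intro!: sum.cong)
  have int: "integrable ?M (\<lambda>x. cis (2 * pi * of_int n * x + t))" for n t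
    by (rule integrable_unit_interval_measure[where B = 1])
       (auto intro!: borel_measurable_continuous_onI continuous_intros)
  \<comment> \<open>Members of \<open>PiE\<close> are \<open>undefined\<close> off \<open>W\<close>,
    so the zero vector has to be restricted in the same way.\<close>
  define z where "z = (\<lambda>j\<in>W. 0 :: int)"
  have zS: "z \<in> S" by (auto simp: z_def S_def)
  have "(\<integral>x. (\<Prod>j\<in>W. 1 + c j * of_real (cos (2 * pi * of_int (m j) * x + \<phi> j))) \<partial>?M)
     = (\<Sum>s\<in>S. K s * (\<integral>x. cis (2 * pi * of_int (\<Sum>j\<in>W. s j * m j) * x + (\<Sum>j\<in>W. of_int (s j) * \<phi> j)) \<partial>?M))"
    unfolding expand by (subst Bochner_Integration.integral_sum) (auto intro!: int integrable_mult_right simp del: of_int_sum of_int_mult)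
  also have "\<dots> = (\<Sum>s\<in>S. if s = z then 1 else 0)"
  proof (rule sum.cong[OF refl])
    fix s assume s: "s \<in> S"
    show "K s * (\<integral>x. cis (2 * pi * of_int (\<Sum>j\<in>W. s j * m j) * x + (\<Sum>j\<in>W. of_int (s j) * \<phi> j)) \<partial>?M)
      = (if s = z then 1 else 0)"
    proof (cases "s = z")
      case True
      have "s j = 0" if "j \<in> W" for j using True that by (simp add: z_def)
      then show ?thesis using True prob_space by (simp add: K_def k_def)
    next
      case False
      have "(\<Sum>j\<in>W. s j * m j) \<noteq> 0"
      proof
        assume "(\<Sum>j\<in>W. s j * m j) = 0"
        moreover have "\<forall>j\<in>W. s j \<in> {-1, 0, 1}" using s by (auto simp: S_def)
        ultimately have "\<forall>j\<in>W. s j = 0" using dis by (auto simp: dissociated_def)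
        then have "s = z" using s by (auto simp: S_def z_def PiE_def extensional_def)
        then show False using False by simp
      qed
      from integral_cis_unit_interval[OF this] show ?thesis using False by simp
    qed
  qed
  also have "\<dots> = 1" using finS zS by simp
  finally show ?thesis .
qed

lemma cmod_one_plus_i_le: "cmod (1 + \<i> * of_real y) \<le> exp (y\<^sup>2 / 2)"
proof -
  have "(cmod (1 + \<i> * of_real y))\<^sup>2 = 1 + y\<^sup>2"
    by (simp add: cmod_power2)
  also have "\<dots> \<le> exp (y\<^sup>2)" by simp
  also have "\<dots> = (exp (y\<^sup>2 / 2))\<^sup>2" by (simp add: exp_double[symmetric])
  finally show ?thesis by (rule power2_le_imp_le) simp
qed

text \<open>Membership in the unit disc is what \<open>norm_prod_diff\<close> asks of the factors
  when two products are compared.\<close>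

lemma cmod_gauss_factor_le_1: "cmod ((1 + \<i> * of_real y) * of_real (exp (- y\<^sup>2 / 2))) \<le> 1"
  using mult_right_mono[OF cmod_one_plus_i_le[of y], of "exp (- y\<^sup>2 / 2)"]
  by (simp add: norm_mult exp_minus norm_inverse del: of_real_exp)

text \<open>Both terms agree with \<open>1 + \<i> * y - y\<^sup>2 / 2\<close> up to a cubic error.
  For \<open>\<bar>y\<bar> > 1\<close> two points of the unit disc differ by at most 2, which gives
  the constant.\<close>

lemma iexp_gauss_factor_diff:
  "cmod (exp (\<i> * of_real y) - (1 + \<i> * of_real y) * of_real (exp (- y\<^sup>2 / 2))) \<le> 2 * \<bar>y\<bar> ^ 3"
proof (cases "\<bar>y\<bar> \<le> 1")
  case True
  define v where "v = y\<^sup>2 / 2"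
  define r where "r = exp (- v) - (1 - v)"
  have v: "0 \<le> v" by (simp add: v_def)
  have "exp (- v) \<le> 1 / (1 + v)"
    using exp_ge_add_one_self[of v] v by (simp add: exp_minus inverse_eq_divide frac_le)
  also have "\<dots> \<le> 1 - v + v\<^sup>2"
  proof -
    \<comment> \<open>The product on the right is \<open>1 + v ^ 3\<close>.\<close>
    have "1 \<le> (1 - v + v\<^sup>2) * (1 + v)"
      using v by (simp add: algebra_simps power2_eq_square)
    then show ?thesis using v by (simp add: divide_le_eq)
  qed
  finally have "r \<le> v\<^sup>2" by (simp add: r_def)
  moreover have "0 \<le> r" using exp_ge_add_one_self[of "- v"] by (simp add: r_def)
  moreover have "v\<^sup>2 = \<bar>y\<bar> ^ 3 * \<bar>y\<bar> / 4"
    by (simp add: v_def power2_eq_square eval_nat_numeral)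
  moreover have "\<bar>y\<bar> ^ 3 * \<bar>y\<bar> \<le> \<bar>y\<bar> ^ 3"
    using True by (simp add: mult_left_le)
  ultimately have r: "\<bar>r\<bar> \<le> \<bar>y\<bar> ^ 3 / 4" by linarith
  have a: "cmod (exp (\<i> * of_real y) - (1 + \<i> * of_real y - of_real v)) \<le> \<bar>y\<bar> ^ 3 / 6"
    using iexp_approx1[of y 2] by (simp add: eval_nat_numeral algebra_simps fact_numeral v_def)
  have split: "exp (\<i> * of_real y) - (1 + \<i> * of_real y) * of_real (exp (- y\<^sup>2 / 2)) =
     (exp (\<i> * of_real y) - (1 + \<i> * of_real y - of_real v)) + (\<i> * of_real (y * v) - (1 + \<i> * of_real y) * of_real r)"
  proof -
    have e: "exp (- y\<^sup>2 / 2) = 1 - v + r" by (simp add: r_def v_def)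
    show ?thesis unfolding e by (simp add: algebra_simps)
  qed
  have "cmod (\<i> * of_real (y * v)) = \<bar>y\<bar> ^ 3 / 2"
    by (simp add: norm_mult v_def power2_eq_square eval_nat_numeral abs_mult)
  moreover have "cmod ((1 + \<i> * of_real y) * of_real r) \<le> 2 * (\<bar>y\<bar> ^ 3 / 4)"
  proof -
    have "cmod (1 + \<i> * of_real y) \<le> 2"
      using norm_triangle_ineq[of 1 "\<i> * of_real y"] True by (simp add: norm_mult)
    then show ?thesis unfolding norm_mult using r by (intro mult_mono) auto
  qed
  ultimately have "cmod (\<i> * of_real (y * v) - (1 + \<i> * of_real y) * of_real r) \<le> \<bar>y\<bar> ^ 3"
    using norm_triangle_ineq4[of "\<i> * of_real (y * v)" "(1 + \<i> * of_real y) * of_real r"] by linarith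
  then show ?thesis unfolding split using a
    norm_triangle_ineq[of "exp (\<i> * of_real y) - (1 + \<i> * of_real y - of_real v)"
       "\<i> * of_real (y * v) - (1 + \<i> * of_real y) * of_real r"] zero_le_power[of "\<bar>y\<bar>" 3]
    by linarith
next
  case False
  have "cmod (exp (\<i> * of_real y)) \<le> 1" by simp
  then have "cmod (exp (\<i> * of_real y) - (1 + \<i> * of_real y) * of_real (exp (- y\<^sup>2 / 2))) \<le> 1 + 1"
    using cmod_gauss_factor_le_1[of y] by (intro order_trans[OF norm_triangle_ineq4 add_mono])
  also have "\<dots> \<le> 2 * \<bar>y\<bar> ^ 3"
    using False one_le_power[of "\<bar>y\<bar>" 3] by simp
  finally show ?thesis .
qed

text \<open>Two equal values would give a relation with the signs 1 and -1 at their indices.\<close>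

lemma dissociated_imp_inj_on:
  fixes m :: "'i \<Rightarrow> int"
  assumes fin: "finite W" and dis: "dissociated m W"
  shows "inj_on m W"
proof (rule inj_onI, rule ccontr)
  fix i j assume ij: "i \<in> W" "j \<in> W" "m i = m j" "i \<noteq> j"
  define s :: "'i \<Rightarrow> int" where "s = (\<lambda>k. of_bool (k = i) - of_bool (k = j))"
  have "(\<Sum>k\<in>W. s k * m k) = (\<Sum>k\<in>W. of_bool (k = i) * m k) - (\<Sum>k\<in>W. of_bool (k = j) * m k)"
    by (simp add: s_def left_diff_distrib sum_subtractf)
  also have "\<dots> = m i - m j"
    using fin ij by (simp add: of_bool_def if_distrib[of "\<lambda>x. x * _"] cong: if_cong)
  finally have "(\<Sum>k\<in>W. s k * m k) = 0" using ij by simp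
  moreover have "\<forall>k\<in>W. s k \<in> {-1, 0, 1}" by (auto simp: s_def of_bool_def)
  ultimately have "s i = 0" using dis ij unfolding dissociated_def by blast
  then show False using ij by (simp add: s_def)
qed

lemma exp_minus_diff_le:
  fixes a b :: real
  assumes "0 \<le> a" "0 \<le> b"
  shows "\<bar>exp (- a) - exp (- b)\<bar> \<le> \<bar>a - b\<bar>"
proof -
  have *: "exp (- a) - exp (- b) \<le> b - a \<and> exp (- b) \<le> exp (- a)" if "0 \<le> a" "a \<le> b" for a b :: real
  proof -
    have "exp (- a) - exp (- b) = exp (- a) * (1 - exp (- (b - a)))"
      by (simp add: algebra_simps flip: exp_add)
    also have "\<dots> \<le> 1 * (b - a)"
      using exp_ge_add_one_self[of "- (b - a)"] that by (intro mult_mono) (simp_all del: exp_ge_add_one_self)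
    finally show ?thesis using that by simp
  qed
  show ?thesis using *[of a b] *[of b a] assms by (cases "a \<le> b") auto
qed

text \<open>Salem--Zygmund: on the dissociated block the product of the factors \<open>1 + i t X\<^sub>j\<close> has mean 1,
  while \<open>exp (i t X) = (1 + i t X) exp (- t\<^sup>2 X\<^sup>2 / 2)\<close> up to a cubic error and the sum of the squares
  concentrates around its mean.\<close>

lemma char_dissociated_cos_sum:
  fixes m :: "'i \<Rightarrow> int" and b \<phi> :: "'i \<Rightarrow> real"
  assumes fin: "finite W" and dis: "dissociated m W" and pos: "\<And>j. j \<in> W \<Longrightarrow> m j > 0"
    and small: "\<And>j. j \<in> W \<Longrightarrow> \<bar>b j\<bar> \<le> \<eta>"
  defines "V \<equiv> (\<Sum>j\<in>W. (b j)\<^sup>2)"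
  shows "cmod ((\<integral>x. exp (\<i> * of_real (t * (\<Sum>j\<in>W. b j * cos (2 * pi * of_int (m j) * x + \<phi> j)))) \<partial>unit_interval_measure)
      - of_real (exp (- t\<^sup>2 * V / 4))) \<le> \<eta> * (2 * \<bar>t\<bar> ^ 3 * V + exp (t\<^sup>2 * V / 2) * t\<^sup>2 * sqrt V)"
proof (cases "W = {}")
  \<comment> \<open>Here \<eta> is unconstrained and may be negative, but \<open>V = 0\<close> makes
    both sides vanish.\<close>
  case True
  interpret prob_space unit_interval_measure by (rule prob_space_unit_interval_measure)
  show ?thesis using True prob_space by (simp add: V_def)
next
  case False
  then have eta: "0 \<le> \<eta>" using small by force
  let ?M = unit_interval_measure
  interpret prob_space ?M by (rule prob_space_unit_interval_measure)
  define X where "X j x = b j * cos (2 * pi * of_int (m j) * x + \<phi> j)" for j x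
  define Q where "Q x = (\<Prod>j\<in>W. 1 + \<i> * of_real (t * X j x))" for x
  define U where "U x = (\<Sum>j\<in>W. (X j x)\<^sup>2)" for x
  have V0: "0 \<le> V" by (simp add: V_def sum_nonneg)
  have Xb: "\<bar>X j x\<bar> \<le> \<bar>b j\<bar>" for j x by (simp add: X_def abs_mult mult_left_le)
  have Xb2: "(X j x)\<^sup>2 \<le> (b j)\<^sup>2" for j x using Xb by (simp add: abs_le_square_iff)
  have UV: "U x \<le> V" for x unfolding U_def V_def by (intro sum_mono Xb2)
  have U0: "0 \<le> U x" for x by (simp add: U_def sum_nonneg)
  have contX: "continuous_on UNIV (X j)" for j unfolding X_def by (intro continuous_intros)
  have [measurable]: "X j \<in> borel_measurable borel" for j
    by (rule borel_measurable_continuous_onI[OF contX])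
  have [measurable]: "U \<in> borel_measurable borel" unfolding U_def by measurable
  have [measurable]: "Q \<in> borel_measurable borel" unfolding Q_def by measurable
  have Qb: "cmod (Q x) \<le> exp (t\<^sup>2 * V / 2)" for x
  proof -
    have "cmod (Q x) \<le> (\<Prod>j\<in>W. exp ((t * X j x)\<^sup>2 / 2))"
      unfolding Q_def prod_norm[symmetric] by (intro prod_mono conjI norm_ge_zero cmod_one_plus_i_le)
    also have "\<dots> = exp (t\<^sup>2 * U x / 2)"
      by (simp add: exp_sum[OF fin, symmetric] U_def power_mult_distrib sum_distrib_left sum_divide_distrib)
    also have "\<dots> \<le> exp (t\<^sup>2 * V / 2)" using UV by (simp add: mult_left_mono)
    finally show ?thesis .
  qed
  have EQ: "integral\<^sup>L ?M Q = 1"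
    unfolding Q_def X_def using integral_riesz_product[OF fin dis, of "\<lambda>j. \<i> * of_real (t * b j)" \<phi>]
    by (simp add: mult.assoc)
  have prodq: "(\<Prod>j\<in>W. (1 + \<i> * of_real (t * X j x)) * of_real (exp (- (t * X j x)\<^sup>2 / 2)))
     = Q x * of_real (exp (- (t\<^sup>2 * U x / 2)))" for x
    unfolding prod.distrib Q_def of_real_prod[symmetric] exp_sum[OF fin, symmetric] U_def
    by (simp add: power_mult_distrib sum_distrib_left sum_divide_distrib sum_negf)
  \<comment> \<open>Comparing factor by factor costs a cubic error, and
    \<open>\<bar>X j x\<bar> ^ 3\<close> is at most \<open>\<eta> * (b j)\<^sup>2\<close>, which
    sums to a multiple of \<open>V\<close>.\<close>
  have step1: "cmod (exp (\<i> * of_real (t * (\<Sum>j\<in>W. X j x))) - Q x * of_real (exp (- (t\<^sup>2 * U x / 2))))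
     \<le> \<eta> * (2 * \<bar>t\<bar> ^ 3 * V)" for x
  proof -
    have "exp (\<i> * of_real (t * (\<Sum>j\<in>W. X j x))) = (\<Prod>j\<in>W. exp (\<i> * of_real (t * X j x)))"
      using exp_sum[OF fin, of "\<lambda>j. \<i> * of_real (t * X j x)"]
      by (simp add: sum_distrib_left)
    then have "cmod (exp (\<i> * of_real (t * (\<Sum>j\<in>W. X j x))) - Q x * of_real (exp (- (t\<^sup>2 * U x / 2))))
      \<le> (\<Sum>j\<in>W. cmod (exp (\<i> * of_real (t * X j x)) - (1 + \<i> * of_real (t * X j x)) * of_real (exp (- (t * X j x)\<^sup>2 / 2))))"
      unfolding prodq[symmetric]
      by (simp only:) (intro norm_prod_diff cmod_gauss_factor_le_1, simp)
    also have "\<dots> \<le> (\<Sum>j\<in>W. 2 * \<bar>t * X j x\<bar> ^ 3)"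
      by (intro sum_mono iexp_gauss_factor_diff)
    also have "\<dots> \<le> (\<Sum>j\<in>W. 2 * \<bar>t\<bar> ^ 3 * (\<eta> * (b j)\<^sup>2))"
    proof (intro sum_mono)
      fix j assume j: "j \<in> W"
      have "\<bar>X j x\<bar> ^ 3 = \<bar>X j x\<bar> * (X j x)\<^sup>2"
        by (simp add: eval_nat_numeral)
      also have "\<dots> \<le> \<eta> * (b j)\<^sup>2"
        using small[OF j] Xb[of j x] Xb2[of j x] eta by (intro mult_mono) auto
      finally show "2 * \<bar>t * X j x\<bar> ^ 3 \<le> 2 * \<bar>t\<bar> ^ 3 * (\<eta> * (b j)\<^sup>2)"
        by (simp add: abs_mult power_mult_distrib mult_left_mono)
    qed
    also have "\<dots> = \<eta> * (2 * \<bar>t\<bar> ^ 3 * V)"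
      by (simp add: V_def sum_distrib_left algebra_simps)
    finally show ?thesis .
  qed
  \<comment> \<open>The double-angle formula turns the fluctuation of the squares into a cosine sum
    with frequencies \<open>2 * m j\<close>. These are again positive and distinct, so the moment
    bound applies once more.\<close>
  have Udev: "U x - V / 2 = (\<Sum>j\<in>W. ((b j)\<^sup>2 / 2) * cos (2 * pi * of_int (2 * m j) * x + 2 * \<phi> j))" for x
  proof -
    have "(X j x)\<^sup>2 = (b j)\<^sup>2 / 2 + ((b j)\<^sup>2 / 2) * cos (2 * pi * of_int (2 * m j) * x + 2 * \<phi> j)" for j
    proof -
      have "cos (2 * (2 * pi * of_int (m j) * x + \<phi> j)) = 2 * (cos (2 * pi * of_int (m j) * x + \<phi> j))\<^sup>2 - 1"
        by (rule cos_double_cos)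
      moreover have "2 * (2 * pi * of_int (m j) * x + \<phi> j) = 2 * pi * of_int (2 * m j) * x + 2 * \<phi> j"
        by simp
      ultimately have c2: "cos (2 * pi * of_int (2 * m j) * x + 2 * \<phi> j) = 2 * (cos (2 * pi * of_int (m j) * x + \<phi> j))\<^sup>2 - 1"
        by metis
      show ?thesis unfolding c2 by (simp add: X_def power_mult_distrib right_diff_distrib)
    qed
    then show ?thesis by (simp add: U_def V_def sum.distrib sum_divide_distrib)
  qed
  have Edev: "(\<integral>x. \<bar>U x - V / 2\<bar> \<partial>?M) \<le> \<eta> * sqrt V"
  proof -
    have "inj_on (\<lambda>j. 2 * m j) W"
      using dissociated_imp_inj_on[OF fin dis] by (auto simp: inj_on_def)
    then have "(\<integral>x. \<bar>U x - V / 2\<bar> \<partial>?M) \<le> sqrt (\<Sum>j\<in>W. ((b j)\<^sup>2 / 2)\<^sup>2)"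
      unfolding Udev using pos by (intro first_moment_cos_sum fin) auto
    also have "\<dots> \<le> sqrt (\<Sum>j\<in>W. \<eta>\<^sup>2 * (b j)\<^sup>2)"
    proof (intro real_sqrt_le_mono sum_mono)
      fix j assume j: "j \<in> W"
      have "(b j)\<^sup>2 \<le> \<eta>\<^sup>2" using small[OF j] eta by (simp add: abs_le_square_iff[symmetric])
      then have "(b j)\<^sup>2 * (b j)\<^sup>2 \<le> \<eta>\<^sup>2 * (b j)\<^sup>2" by (intro mult_right_mono) auto
      moreover have "((b j)\<^sup>2 / 2)\<^sup>2 = (b j)\<^sup>2 * (b j)\<^sup>2 / 4"
        by (simp add: power2_eq_square)
      moreover have "0 \<le> (b j)\<^sup>2 * (b j)\<^sup>2" by simp
      ultimately show "((b j)\<^sup>2 / 2)\<^sup>2 \<le> \<eta>\<^sup>2 * (b j)\<^sup>2" by linarith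
    qed
    also have "\<dots> = \<eta> * sqrt V"
      using eta by (simp add: V_def sum_distrib_left[symmetric] real_sqrt_mult)
    finally show ?thesis .
  qed
  have intU: "integrable ?M (\<lambda>x. \<bar>U x - V / 2\<bar>)"
    by (rule integrable_unit_interval_measure[where B = V])
       (use U0 UV V0 in \<open>auto simp: abs_le_iff intro: order_trans[of _ "V / 2"] add_increasing2\<close>)
  have intE: "integrable ?M (\<lambda>x. exp (\<i> * of_real (t * (\<Sum>j\<in>W. X j x))))"
    by (rule integrable_unit_interval_measure[where B = 1]) auto
  have intQ: "integrable ?M Q"
    by (rule integrable_unit_interval_measure[OF _ Qb]) simp
  \<comment> \<open>Replacing the random \<open>U x\<close> by its mean \<open>V / 2\<close> costs
    the bound on \<open>Q\<close> times the deviation, because \<open>exp (- a)\<close> is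
    1-Lipschitz for nonnegative \<open>a\<close>.\<close>
  have point: "cmod (exp (\<i> * of_real (t * (\<Sum>j\<in>W. X j x))) - Q x * of_real (exp (- t\<^sup>2 * V / 4)))
     \<le> \<eta> * (2 * \<bar>t\<bar> ^ 3 * V) + exp (t\<^sup>2 * V / 2) * t\<^sup>2 * \<bar>U x - V / 2\<bar>" for x
  proof -
    have "cmod (Q x * of_real (exp (- (t\<^sup>2 * U x / 2))) - Q x * of_real (exp (- t\<^sup>2 * V / 4)))
       = cmod (Q x) * \<bar>exp (- (t\<^sup>2 * U x / 2)) - exp (- (t\<^sup>2 * V / 4))\<bar>"
      by (simp add: norm_mult right_diff_distrib[symmetric] of_real_diff[symmetric]
            del: of_real_diff of_real_exp)
    also have "\<dots> \<le> exp (t\<^sup>2 * V / 2) * \<bar>t\<^sup>2 * U x / 2 - t\<^sup>2 * V / 4\<bar>"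
      using Qb U0 V0 by (intro mult_mono exp_minus_diff_le) auto
    also have "t\<^sup>2 * U x / 2 - t\<^sup>2 * V / 4 = t\<^sup>2 / 2 * (U x - V / 2)"
      by (simp add: field_simps)
    also have "exp (t\<^sup>2 * V / 2) * \<bar>t\<^sup>2 / 2 * (U x - V / 2)\<bar> \<le> exp (t\<^sup>2 * V / 2) * t\<^sup>2 * \<bar>U x - V / 2\<bar>"
      by (simp add: abs_mult mult_right_mono)
    finally have "cmod (Q x * of_real (exp (- (t\<^sup>2 * U x / 2))) - Q x * of_real (exp (- t\<^sup>2 * V / 4)))
      \<le> exp (t\<^sup>2 * V / 2) * t\<^sup>2 * \<bar>U x - V / 2\<bar>" .
    from norm_triangle_mono[OF step1[of x] this] show ?thesis by simp
  qed
  \<comment> \<open>As \<open>Q\<close> has mean 1, the Gaussian constant is the integral of its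
    product with \<open>Q\<close>.\<close>
  have eq: "(\<integral>x. exp (\<i> * of_real (t * (\<Sum>j\<in>W. X j x))) \<partial>?M) - of_real (exp (- t\<^sup>2 * V / 4))
    = (\<integral>x. exp (\<i> * of_real (t * (\<Sum>j\<in>W. X j x))) - Q x * of_real (exp (- t\<^sup>2 * V / 4)) \<partial>?M)"
    using intE intQ EQ by simp
  have "cmod ((\<integral>x. exp (\<i> * of_real (t * (\<Sum>j\<in>W. X j x))) \<partial>?M) - of_real (exp (- t\<^sup>2 * V / 4))) \<le> (\<integral>x. \<eta> * (2 * \<bar>t\<bar> ^ 3 * V) + exp (t\<^sup>2 * V / 2) * t\<^sup>2 * \<bar>U x - V / 2\<bar> \<partial>?M)"
    unfolding eq using intE intQ intU point by (intro Bochner_Integration.integral_norm_bound_integral) auto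
  also have "\<dots> = \<eta> * (2 * \<bar>t\<bar> ^ 3 * V) + exp (t\<^sup>2 * V / 2) * t\<^sup>2 * (\<integral>x. \<bar>U x - V / 2\<bar> \<partial>?M)"
    using intU by (subst Bochner_Integration.integral_add) (auto simp: prob_space)
  also have "\<dots> \<le> \<eta> * (2 * \<bar>t\<bar> ^ 3 * V) + exp (t\<^sup>2 * V / 2) * t\<^sup>2 * (\<eta> * sqrt V)"
    using Edev by (intro add_left_mono mult_left_mono) auto
  also have "\<dots> = \<eta> * (2 * \<bar>t\<bar> ^ 3 * V + exp (t\<^sup>2 * V / 2) * t\<^sup>2 * sqrt V)"
    by (simp add: algebra_simps)
  finally show ?thesis unfolding X_def .
qed

section \<open>Diophantine approximation and the choice of frequencies\<close>

text \<open>Uniformity in the starting point \<open>M\<close> is what the greedy choice needs: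
  disjoint blocks of integers then supply as many distinct candidates as required. The integer
  \<open>z\<close> encodes reduction modulo 1.\<close>

definition hits :: "real \<Rightarrow> real \<Rightarrow> nat \<Rightarrow> bool" where
  "hits \<alpha> L G \<longleftrightarrow> (\<forall>s M. \<exists>m z. M \<le> m \<and> m < M + int G \<and> s \<le> of_int m * \<alpha> - of_int z \<and> of_int m * \<alpha> - of_int z \<le> s + L)"

text \<open>As \<open>h\<close> is invertible modulo \<open>k\<close>, the points
  \<open>i * h / k\<close> with \<open>0 \<le> i < k\<close> form modulo 1 the whole grid of spacing
  \<open>1 / k\<close>, and \<open>i * \<alpha>\<close> is within \<open>1 / k\<close> of its grid
  point. With the rounding error \<open>1 / (2 * k)\<close> this reaches every interval of length
  \<open>3 / k\<close>; \<open>c\<close> is the centre of such an interval starting at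
  \<open>s\<close>.\<close>

lemma hits_of_approximation:
  fixes h k :: int
  assumes cop: "coprime h k" and k: "0 < k" "k \<le> int N" and app: "\<bar>of_int k * \<alpha> - of_int h\<bar> < 1 / real N"
    and L: "3 \<le> L * of_int k"
  shows "hits \<alpha> L (nat k)"
  unfolding hits_def
proof (intro allI)
  fix s :: real and M :: int
  define c where "c = s + 3 / (2 * of_int k)"
  define r where "r = round (of_int k * (c - of_int M * \<alpha>))"
  obtain a b where ab: "a * h + b * k = 1"
    using bezout_int[of h k] cop by (auto simp: coprime_iff_gcd_eq_1)
  \<comment> \<open>By the Bezout identity \<open>a\<close> inverts \<open>h\<close> modulo
    \<open>k\<close>, so \<open>i * h\<close> is congruent to \<open>r\<close>.\<close>
  define i where "i = (r * a) mod k"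
  have i: "0 \<le> i" "i < k" using k by (auto simp: i_def)
  have "i * h - r = - (r * b + (r * a div k) * h) * k"
  proof -
    have "i = r * a - (r * a div k) * k" by (simp add: i_def minus_div_mult_eq_mod)
    then have "i * h = (r * a - (r * a div k) * k) * h" by (rule arg_cong)
    then have "i * h - r = r * (a * h) - r - (r * a div k) * k * h" by (simp add: algebra_simps)
    also have "a * h = 1 - b * k" using ab by simp
    finally show ?thesis by (simp add: algebra_simps)
  qed
  then obtain z where z: "i * h - r = z * k" by blast
  have kr: "real_of_int k > 0" using k by simp
  have N: "real N > 0" using k by simp
  have ih: "of_int i * of_int h = (of_int r + of_int z * of_int k :: real)"
    using z by (metis add.commute diff_eq_eq of_int_add of_int_mult)
  have e1: "\<bar>of_int i * \<alpha> - of_int r / of_int k - of_int z\<bar> \<le> 1 / of_int k"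
  proof -
    have "of_int i * \<alpha> - of_int r / of_int k - of_int z = of_int i * (of_int k * \<alpha> - of_int h) / of_int k"
      using kr ih by (simp add: field_simps)
    also have "\<bar>\<dots>\<bar> = of_int i / of_int k * \<bar>of_int k * \<alpha> - of_int h\<bar>"
      using kr i by (simp add: abs_mult)
    also have "\<dots> \<le> 1 * (1 / real N)"
      using i kr app by (intro mult_mono) auto
    also have "\<dots> \<le> 1 / of_int k"
      using k N kr by (simp add: frac_le)
    finally show ?thesis .
  qed
  have e2: "\<bar>of_int M * \<alpha> + of_int r / of_int k - c\<bar> \<le> 1 / (2 * of_int k)"
  proof -
    have "\<bar>of_int r - of_int k * (c - of_int M * \<alpha>)\<bar> \<le> 1 / 2"
      unfolding r_def by (rule of_int_round_abs_le)
    then have "\<bar>of_int r - of_int k * (c - of_int M * \<alpha>)\<bar> / of_int k \<le> 1 / 2 / of_int k"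
      using kr by (intro divide_right_mono) auto
    also have "\<bar>of_int r - of_int k * (c - of_int M * \<alpha>)\<bar> / of_int k = \<bar>(of_int r - of_int k * (c - of_int M * \<alpha>)) / of_int k\<bar>"
      using kr by simp
    also have "(of_int r - of_int k * (c - of_int M * \<alpha>)) / of_int k = of_int M * \<alpha> + of_int r / of_int k - c"
      using kr by (simp add: field_simps)
    finally show ?thesis by (simp add: mult.commute)
  qed
  have half: "1 / (2 * of_int k) + 1 / of_int k = 3 / (2 * real_of_int k)"
    using kr by (simp add: field_simps)
  have "\<bar>of_int (M + i) * \<alpha> - of_int z - c\<bar> \<le> 3 / (2 * of_int k)"
    unfolding half[symmetric] using e1 e2 by (simp add: algebra_simps)
  moreover have "3 / (2 * of_int k) + 3 / (2 * of_int k) \<le> L"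
    using L kr by (simp add: field_simps)
  ultimately have "s \<le> of_int (M + i) * \<alpha> - of_int z \<and> of_int (M + i) * \<alpha> - of_int z \<le> s + L"
    unfolding c_def by linarith
  then show "\<exists>m z. M \<le> m \<and> m < M + int (nat k) \<and> s \<le> of_int m * \<alpha> - of_int z \<and> of_int m * \<alpha> - of_int z \<le> s + L"
    using i by (intro exI[of _ "M + i"] exI[of _ z]) auto
qed

section \<open>Visiting times of short intervals under an irrational rotation\<close>

lemma nint_dist_nonneg: "0 \<le> nint_dist x"
  by (simp add: nint_dist_def)

lemma nint_dist_irrational_pos:
  assumes "\<alpha> \<notin> \<rat>" "n \<noteq> 0"
  shows "0 < nint_dist (real n * \<alpha>)"
proof -
  have "real n * \<alpha> \<notin> \<int>"
  proof
    assume "real n * \<alpha> \<in> \<int>"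
    then have "real n * \<alpha> / real n \<in> \<rat>" by (intro Rats_divide) (auto intro: subsetD[OF Ints_subset_Rats])
    then show False using assms by simp
  qed
  then show ?thesis using nint_dist_nonneg[of "real n * \<alpha>"] nint_dist_eq_0_iff[of "real n * \<alpha>"] by linarith
qed

text \<open>Choosing \<open>1 / N\<close> below the distances to the integers of all multiples up to
  \<open>B\<close> forces the Dirichlet denominator beyond \<open>B\<close>, hence beyond
  \<open>3 / L\<close>. This qualitative version covers every irrational, Liouville numbers
  included.\<close>

lemma hits_exists:
  assumes irr: "\<alpha> \<notin> \<rat>" and L: "0 < L"
  shows "\<exists>G. hits \<alpha> L G"
proof -
  define B where "B = nat \<lceil>3 / L\<rceil> + 1"
  define \<mu> where "\<mu> = Min ((\<lambda>n. nint_dist (real n * \<alpha>)) ` {1..B})"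
  have "\<mu> \<in> (\<lambda>n. nint_dist (real n * \<alpha>)) ` {1..B}"
    unfolding \<mu>_def by (rule Min_in) (auto simp: B_def)
  then have mu: "0 < \<mu>" using nint_dist_irrational_pos[OF irr] by auto
  obtain N where N: "0 < N" "1 / real N < \<mu>"
    using reals_Archimedean[OF mu] by (metis inverse_eq_divide zero_less_Suc)
  obtain h k where hk: "coprime h k" "0 < k" "k \<le> int N" "\<bar>of_int k * \<alpha> - of_int h\<bar> < 1 / real N"
    by (rule Dirichlet_approx_coprime[OF N(1)])
  have "\<not> k \<le> int B"
  proof
    assume "k \<le> int B"
    then have "nat k \<in> {1..B}" using hk by auto
    then have "\<mu> \<le> nint_dist (real (nat k) * \<alpha>)" unfolding \<mu>_def by (intro Min_le) auto
    also have "\<dots> \<le> \<bar>of_int k * \<alpha> - of_int h\<bar>" using nint_dist_le[of "of_int k * \<alpha>" h] hk by simp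
    finally show False using hk N by linarith
  qed
  then have "real B \<le> of_int k" by linarith
  moreover have "3 / L \<le> real B" unfolding B_def by linarith
  ultimately have "3 / L \<le> of_int k" by linarith
  then have "3 \<le> L * of_int k" using L by (simp add: field_simps)
  then show ?thesis using hits_of_approximation[OF hk] by blast
qed

text \<open>The Dirichlet denominator is pinned from both sides. The lower bound on
  \<open>nint_dist\<close> gives \<open>k powr D > c * N\<close>, which is at least
  \<open>(3 / L) powr D\<close>, so \<open>k\<close> is large enough; \<open>k \<le> N\<close>
  bounds the visiting time. The summand 2 absorbs the rounding in \<open>N\<close>.\<close>

lemma hits_diophantine:
  assumes c: "0 < c" and D: "0 < D" and dio: "\<And>n. n \<ge> 1 \<Longrightarrow> c * real n powr (- D) \<le> nint_dist (real n * \<alpha>)"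
    and L: "0 < L" "L \<le> 1"
  shows "\<exists>G. hits \<alpha> L G \<and> real G \<le> (3 powr D / c + 2) * L powr (- D)"
proof -
  define N where "N = nat \<lceil>(3 / L) powr D / c\<rceil> + 1"
  have N: "0 < N" "(3 / L) powr D / c \<le> real N" "real N \<le> (3 / L) powr D / c + 2"
    using c by (auto simp: N_def) linarith+
  obtain h k where hk: "coprime h k" "0 < k" "k \<le> int N" "\<bar>of_int k * \<alpha> - of_int h\<bar> < 1 / real N"
    by (rule Dirichlet_approx_coprime[OF N(1)])
  have kr: "real_of_int k > 0" using hk by simp
  have "c * of_int k powr (- D) \<le> nint_dist (of_int k * \<alpha>)"
    using dio[of "nat k"] hk by simp
  also have "\<dots> < 1 / real N" using nint_dist_le[of "of_int k * \<alpha>" h] hk by linarith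
  finally have "c * real N < of_int k powr D"
    using kr N by (simp add: powr_minus field_simps)
  moreover have "(3 / L) powr D \<le> c * real N" using N c by (simp add: field_simps)
  ultimately have "(3 / L) powr D < of_int k powr D" by linarith
  then have "3 / L < of_int k" using D kr powr_mono2[of D "of_int k" "3 / L"] by linarith
  then have "3 \<le> L * of_int k" using L by (simp add: field_simps)
  then have "hits \<alpha> L (nat k)" by (rule hits_of_approximation[OF hk])
  moreover have "real (nat k) \<le> (3 powr D / c + 2) * L powr (- D)"
  proof -
    have "real (nat k) \<le> real N" using hk by simp
    also have "\<dots> \<le> (3 / L) powr D / c + 2" by (rule N)
    also have "(3 / L) powr D = 3 powr D * L powr (- D)"
      using L by (simp add: powr_divide powr_minus_divide)
    also have "(3 powr D * L powr (- D)) / c + 2 \<le> (3 powr D * L powr (- D)) / c + 2 * L powr (- D)"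
      using L D powr_mono'[of "- D" 0 L] by simp
    finally show ?thesis by (simp add: algebra_simps)
  qed
  ultimately show ?thesis by blast
qed

text \<open>A smaller exponent would contradict Dirichlet's theorem for large \<open>N\<close>. Its
  use is to force the Hoelder exponent to be at most 1.\<close>

lemma diophantine_exponent_ge_1:
  assumes c: "0 < c" and D: "0 < D" and dio: "\<And>n. n \<ge> 1 \<Longrightarrow> c * real n powr (- D) \<le> nint_dist (real n * \<alpha>)"
  shows "1 \<le> D"
proof (rule ccontr)
  assume "\<not> 1 \<le> D"
  then have "(\<lambda>N. real N powr (D - 1)) \<longlonglongrightarrow> 0"
    by (intro tendsto_neg_powr filterlim_real_sequentially) auto
  then have "eventually (\<lambda>N. real N powr (D - 1) < c) sequentially"
    using c by (rule order_tendstoD)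
  then obtain N where N: "0 < N" "real N powr (D - 1) < c"
    using eventually_conj[OF eventually_gt_at_top[of 0]] eventually_happens sequentially_bot by blast
  obtain h k where hk: "0 < k" "k \<le> int N" "\<bar>of_int k * \<alpha> - of_int h\<bar> < 1 / real N"
    by (rule Dirichlet_approx[OF N(1)])
  have "c * real N powr (- D) \<le> c * real (nat k) powr (- D)"
    using hk c D by (intro mult_left_mono powr_mono2') auto
  also have "\<dots> \<le> nint_dist (of_int k * \<alpha>)" using dio[of "nat k"] hk by simp
  also have "\<dots> < 1 / real N" using nint_dist_le[of "of_int k * \<alpha>" h] hk by linarith
  finally have "c < real N powr D / real N" using N by (simp add: powr_minus field_simps)
  also have "real N powr D / real N = real N powr (D - 1)" using N by (simp add: powr_diff)
  finally show False using N by simp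
qed

section \<open>Greedy choice of frequencies free of additive relations\<close>

definition signed_sums :: "(nat \<Rightarrow> int) \<Rightarrow> nat set \<Rightarrow> int set" where
  "signed_sums m P = (\<lambda>t. \<Sum>i\<in>P. t i * m i) ` PiE P (\<lambda>_. {-1, 0, 1})"

text \<open>A nontrivial relation can be solved for the frequency of largest index \<open>j\<close>
  in it. This exhibits \<open>m j\<close> as a signed sum over earlier indices of \<open>W\<close>,
  all of which lie in \<open>P j\<close>.\<close>

lemma dissociated_greedy:
  fixes m :: "nat \<Rightarrow> int"
  assumes fin: "finite W" and P: "\<And>j. finite (P j)" and win: "\<And>i j. i \<in> W \<Longrightarrow> j \<in> W \<Longrightarrow> i < j \<Longrightarrow> i \<in> P j"
    and lt: "\<And>j. P j \<subseteq> {..<j}" and avoid: "\<And>j. m j \<notin> signed_sums m (P j)"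
  shows "dissociated m W"
  unfolding dissociated_def
proof (intro allI impI, rule ccontr)
  fix s :: "nat \<Rightarrow> int"
  assume s: "\<forall>j\<in>W. s j \<in> {-1, 0, 1}" and sum0: "(\<Sum>j\<in>W. s j * m j) = 0" and ne: "\<not> (\<forall>j\<in>W. s j = 0)"
  define T where "T = {j \<in> W. s j \<noteq> 0}"
  have T: "finite T" "T \<noteq> {}" using fin ne by (auto simp: T_def)
  define j where "j = Max T"
  have jT: "j \<in> T" unfolding j_def by (rule Max_in[OF T])
  have jW: "j \<in> W" "s j \<in> {-1, 1}" using jT s by (auto simp: T_def)
  have above: "s i = 0" if "i \<in> W" "j < i" for i
    using Max_ge[OF T(1), of i] that by (auto simp: j_def T_def)
  \<comment> \<open>Multiplication by \<open>- s j\<close> solves the relation for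
    \<open>m j\<close>, since \<open>s j * s j = 1\<close>; indices of \<open>P j\<close> outside
    \<open>W\<close> get coefficient 0.\<close>
  define t where "t = (\<lambda>i\<in>P j. if i \<in> W then - s j * s i else 0)"
  have "(if i \<in> W then - s j * s i else 0) \<in> {-1, 0, 1}" for i
  proof (cases "i \<in> W")
    case True
    then have "s i \<in> {-1, 0, 1}" using s by blast
    then show ?thesis using True jW(2) by auto
  qed simp
  then have "t \<in> PiE (P j) (\<lambda>_. {-1, 0, 1})"
    unfolding t_def by (intro restrict_PiE_iff[THEN iffD2]) blast
  moreover have "(\<Sum>i\<in>P j. t i * m i) = m j"
  proof -
    have "i \<in> W \<Longrightarrow> i \<notin> W \<inter> {..<j} \<union> {j} \<Longrightarrow> s i = 0" for i
      using above[of i] by (cases "i < j") auto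
    then have "(\<Sum>i\<in>W. s i * m i) = (\<Sum>i\<in>W \<inter> {..<j} \<union> {j}. s i * m i)"
      using jW(1) by (intro sum.mono_neutral_right fin ballI) (blast, simp)
    also have "\<dots> = s j * m j + (\<Sum>i\<in>W \<inter> {..<j}. s i * m i)"
      using fin by (subst Un_commute) (simp add: sum.insert)
    finally have eq: "(\<Sum>i\<in>W \<inter> {..<j}. s i * m i) = - (s j * m j)" using sum0 by simp
    have "(\<Sum>i\<in>P j. t i * m i) = (\<Sum>i\<in>W \<inter> {..<j}. t i * m i)"
      using win jW lt[of j] by (intro sum.mono_neutral_right P) (auto simp: t_def)
    also have "\<dots> = (\<Sum>i\<in>W \<inter> {..<j}. - s j * (s i * m i))"
      using win jW by (intro sum.cong) (auto simp: t_def)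
    also have "\<dots> = - s j * (- (s j * m j))" unfolding sum_distrib_left[symmetric] eq ..
    also have "\<dots> = m j" using jW by auto
    finally show ?thesis .
  qed
  ultimately have "m j \<in> signed_sums m (P j)" unfolding signed_sums_def by (intro image_eqI[of "m j" _ t]) simp_all
  then show False using avoid by blast
qed

text \<open>A counting argument. At most \<open>3 ^ card (P j) + j\<close> values are forbidden,
  namely the signed sums and the earlier frequencies. One block more than that, each of length
  \<open>G j\<close>, contains an admissible hit, which also bounds its size.\<close>

lemma greedy_frequencies:
  fixes L s :: "nat \<Rightarrow> real" and G :: "nat \<Rightarrow> nat" and P :: "nat \<Rightarrow> nat set"
  assumes hit: "\<And>j. hits \<alpha> (L j) (G j)" and lt: "\<And>j. P j \<subseteq> {..<j}"
  obtains m :: "nat \<Rightarrow> int" where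
    "\<And>j. 0 < m j" "\<And>j. m j \<le> (3 ^ card (P j) + int j + 1) * int (G j)" "inj m"
    "\<And>j. m j \<notin> signed_sums m (P j)"
    "\<And>j. \<exists>z::int. s j \<le> of_int (m j) * \<alpha> - of_int z \<and> of_int (m j) * \<alpha> - of_int z \<le> s j + L j"
proof -
  define Q where "Q f j r \<longleftrightarrow> 0 < r \<and> r \<le> (3 ^ card (P j) + int j + 1) * int (G j) \<and> r \<notin> f ` {..<j} \<and>
     r \<notin> signed_sums f (P j) \<and>
     (\<exists>z::int. s j \<le> of_int r * \<alpha> - of_int z \<and> of_int r * \<alpha> - of_int z \<le> s j + L j)" for f j and r :: int
  have finP: "finite (P j)" for j using lt finite_subset by blast
  have "\<exists>f. \<forall>j. Q f j (f j)"
  proof (rule dependent_wellorder_choice)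
    fix r j and f g :: "nat \<Rightarrow> int"
    \<comment> \<open>The recursion is legitimate because the condition at \<open>j\<close> depends
      only on values below \<open>j\<close>.\<close>
    assume eq: "\<And>y. y < j \<Longrightarrow> f y = g y"
    have "f ` {..<j} = g ` {..<j}" using eq by (intro image_cong) auto
    moreover have "signed_sums f (P j) = signed_sums g (P j)"
      unfolding signed_sums_def using eq lt[of j] by (intro image_cong sum.cong) auto
    ultimately show "Q f j r = Q g j r" unfolding Q_def by simp
  next
    fix j and f :: "nat \<Rightarrow> int"
    define B where "B = f ` {..<j} \<union> signed_sums f (P j)"
    have finB: "finite B" unfolding B_def signed_sums_def using finP by (auto intro!: finite_PiE)
    have "card (signed_sums f (P j)) \<le> card (PiE (P j) (\<lambda>_. {-1, 0, 1 :: int}))"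
      unfolding signed_sums_def using finP by (intro card_image_le finite_PiE) auto
    also have "\<dots> = 3 ^ card (P j)" using finP by (simp add: card_PiE eval_nat_numeral)
    finally have cardB: "card B \<le> 3 ^ card (P j) + j"
      unfolding B_def using card_image_le[of "{..<j}" f] by (intro order_trans[OF card_Un_le]) auto
    \<comment> \<open>The blocks are disjoint, so the hits are distinct; they start at 1 to make the
      frequencies positive.\<close>
    have "\<forall>i. \<exists>m. 1 + int (i * G j) \<le> m \<and> m < 1 + int (i * G j) + int (G j) \<and>
       (\<exists>z::int. s j \<le> of_int m * \<alpha> - of_int z \<and> of_int m * \<alpha> - of_int z \<le> s j + L j)"
      using hit[of j] unfolding hits_def by meson
    then obtain q where q: "\<And>i. 1 + int (i * G j) \<le> q i" "\<And>i. q i < 1 + int (i * G j) + int (G j)"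
       "\<And>i. \<exists>z::int. s j \<le> of_int (q i) * \<alpha> - of_int z \<and> of_int (q i) * \<alpha> - of_int z \<le> s j + L j"
      by metis
    have "strict_mono q"
    proof (rule strict_monoI_Suc)
      fix i show "q i < q (Suc i)" using q(2)[of i] q(1)[of "Suc i"] by simp
    qed
    then have inj: "inj_on q {..card B}" using strict_mono_imp_inj_on by blast
    have "\<not> q ` {..card B} \<subseteq> B"
    proof
      assume "q ` {..card B} \<subseteq> B"
      then have "card (q ` {..card B}) \<le> card B" by (rule card_mono[OF finB])
      then show False using card_image[OF inj] by simp
    qed
    then obtain i where i: "i \<le> card B" "q i \<notin> B" by auto
    have "q i \<le> (int i + 1) * int (G j)" using q(2)[of i] by (simp add: algebra_simps)
    also have "\<dots> \<le> (3 ^ card (P j) + int j + 1) * int (G j)"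
    proof (rule mult_right_mono)
      have "int i \<le> int (3 ^ card (P j) + j)" using i cardB by linarith
      then show "int i + 1 \<le> 3 ^ card (P j) + int j + 1" by simp
    qed simp
    finally have "q i \<le> (3 ^ card (P j) + int j + 1) * int (G j)" .
    moreover have "0 < q i" using q(1)[of i] by (rule less_le_trans[rotated]) (simp add: add_pos_nonneg)
    ultimately have "Q f j (q i)" using i(2) q(3)[of i] unfolding Q_def B_def by blast
    then show "\<exists>r. Q f j r" ..
  qed
  then obtain m where m: "\<And>j. Q m j (m j)" by blast
  have "inj m"
  proof (rule injI, rule ccontr)
    fix x y assume xy: "m x = m y" "x \<noteq> y"
    then consider "x < y" | "y < x" by linarith
    then show False
    proof cases
      case 1 then show False using m[of y] xy unfolding Q_def by (metis imageI lessThan_iff)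
    next
      case 2 then show False using m[of x] xy unfolding Q_def by (metis imageI lessThan_iff)
    qed
  qed
  then show thesis using that[of m] m unfolding Q_def by blast
qed

section \<open>The mesh and the Dirichlet kernel\<close>

text \<open>The exponent 3/4 lies below 1, so that consecutive ratios tend to 1, and above 1/2, so
  that a factor \<open>3 powr sqrt j\<close> from the greedy choice grows more slowly than every
  negative power of \<open>mesh j\<close>.\<close>

definition mesh :: "nat \<Rightarrow> real" where
  "mesh j = exp (- (real j powr (3 / 4)))"

text \<open>At integers \<open>t\<close> the quotient takes the default value 0. The upper bounds
  survive this, and the product formula for cosine sums is used only where the denominator is
  nonzero.\<close>

definition dirichlet_kernel :: "nat \<Rightarrow> real \<Rightarrow> real" where
  "dirichlet_kernel N t = sin (pi * real N * t) / sin (pi * t)"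

lemma mesh_pos: "0 < mesh j"
  by (simp add: mesh_def)

lemma mesh_strict_antimono: "i < j \<Longrightarrow> mesh j < mesh i"
  by (simp add: mesh_def powr_less_mono2)

lemma mesh_antimono: "i \<le> j \<Longrightarrow> mesh j \<le> mesh i"
  by (simp add: mesh_def powr_mono2)

lemma mesh_le_half:
  assumes "1 \<le> j"
  shows "mesh j \<le> 1 / 2"
proof -
  have "mesh j \<le> mesh 1" using assms by (rule mesh_antimono)
  also have "mesh 1 = 1 / exp 1" by (simp add: mesh_def exp_minus inverse_eq_divide)
  also have "\<dots> \<le> 1 / 2" using exp_ge_add_one_self[of "1::real"] by (intro divide_left_mono) auto
  finally show ?thesis .
qed

lemma mesh_le_1: "mesh j \<le> 1"
  by (simp add: mesh_def)

text \<open>By subadditivity of \<open>x powr (3 / 4)\<close> the exponent grows by at most 1 per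
  step, and \<open>exp 1 \<le> 3\<close>.\<close>

lemma mesh_Suc_ge: "mesh j \<le> 3 * mesh (Suc j)"
proof -
  have "real (Suc j) powr (3 / 4) \<le> real j powr (3 / 4) + 1"
  proof -
    define x where "x = real j"
    have x: "0 \<le> x" by (simp add: x_def)
    have *: "t \<le> t powr (3 / 4)" if "0 \<le> t" "t \<le> 1" for t :: real
      using powr_mono'[of "3/4" 1 t] that by simp
    have "1 = x / (x + 1) + 1 / (x + 1)" using x by (simp add: add_divide_distrib[symmetric])
    also have "\<dots> \<le> (x / (x + 1)) powr (3 / 4) + (1 / (x + 1)) powr (3 / 4)"
      using x by (intro add_mono *) auto
    also have "\<dots> = (x powr (3 / 4) + 1) / (x + 1) powr (3 / 4)"
      using x by (simp add: powr_divide add_divide_distrib)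
    finally have "(x + 1) powr (3 / 4) \<le> x powr (3 / 4) + 1"
      using x by (simp add: pos_le_divide_eq)
    then show ?thesis by (simp add: x_def add.commute)
  qed
  then have "mesh j \<le> exp (1 - real (Suc j) powr (3 / 4))" by (simp add: mesh_def)
  also have "\<dots> = exp 1 * mesh (Suc j)" by (simp add: mesh_def flip: exp_add)
  also have "\<dots> \<le> 3 * mesh (Suc j)" using exp_le mesh_pos[of "Suc j"] by (intro mult_right_mono) auto
  finally show ?thesis .
qed

lemma mesh_ratio_tendsto: "(\<lambda>j. mesh (Suc j) / mesh j) \<longlonglongrightarrow> 1"
  unfolding mesh_def by real_asymp

section \<open>Bounds for the sine and for the Dirichlet kernel\<close>

lemma sin_ge_quarter:
  fixes x :: real
  assumes "0 \<le> x" "x \<le> pi / 2"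
  shows "x / 4 \<le> sin x"
proof (cases "x \<le> pi / 3")
  case True
  show ?thesis
  proof (cases "x = 0")
    case False
    then have x: "0 < x" using assms by simp
    have "\<exists>z. 0 < z \<and> z < x \<and> sin x - sin 0 = (x - 0) * cos z"
      using x by (intro MVT2) (auto intro!: derivative_eq_intros)
    then obtain z where z: "0 < z" "z < x" "sin x = x * cos z" by auto
    have "cos (pi / 3) \<le> cos z" using z True by (intro cos_monotone_0_pi_le) auto
    then have "1 / 4 \<le> cos z" by (simp add: cos_60)
    then have "x * (1 / 4) \<le> x * cos z" using x by (intro mult_left_mono) auto
    then show ?thesis using z by simp
  qed simp
next
  case False
  have "sin (pi / 6) \<le> sin x"
    using False assms pi_gt_zero by (intro sin_monotone_2pi_le) linarith+
  moreover have "x / 4 \<le> 1 / 2" using assms pi_less_4 by linarith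
  ultimately show ?thesis by (simp add: sin_30)
qed

lemma sin_pi_ge:
  assumes "0 \<le> t" "t \<le> 1 / 2"
  shows "t / 2 \<le> sin (pi * t)"
proof -
  have "pi * t / 4 \<le> sin (pi * t)" using assms by (intro sin_ge_quarter) auto
  moreover have "2 * t \<le> pi * t" using assms pi_ge_two by (intro mult_right_mono) auto
  ultimately show ?thesis by linarith
qed

lemma abs_sin_nat_mult_le: "\<bar>sin (real n * x)\<bar> \<le> real n * \<bar>sin x\<bar>"
proof (induction n)
  case (Suc n)
  have "sin (real (Suc n) * x) = sin (real n * x) * cos x + cos (real n * x) * sin x"
    by (simp add: distrib_right sin_add add.commute)
  also have "\<bar>\<dots>\<bar> \<le> \<bar>sin (real n * x)\<bar> * \<bar>cos x\<bar> + \<bar>cos (real n * x)\<bar> * \<bar>sin x\<bar>"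
    using abs_triangle_ineq[of "sin (real n * x) * cos x" "cos (real n * x) * sin x"] by (simp only: abs_mult)
  also have "\<dots> \<le> real n * \<bar>sin x\<bar> * 1 + 1 * \<bar>sin x\<bar>"
    using Suc by (intro add_mono mult_mono) auto
  finally show ?case by (simp add: distrib_right)
qed simp

lemma dirichlet_kernel_le: "\<bar>dirichlet_kernel N t\<bar> \<le> real N"
  using abs_sin_nat_mult_le[of N "pi * t"]
  by (cases "sin (pi * t) = 0") (simp_all add: dirichlet_kernel_def pos_divide_le_eq mult_ac)

lemma dirichlet_kernel_le_inverse:
  assumes "0 < t" "t \<le> 1 / 2"
  shows "\<bar>dirichlet_kernel N t\<bar> \<le> 2 / t"
proof -
  have "t / 2 \<le> sin (pi * t)" using assms by (intro sin_pi_ge) auto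
  then have "\<bar>dirichlet_kernel N t\<bar> \<le> 1 / (t / 2)"
    unfolding dirichlet_kernel_def abs_divide using assms by (intro frac_le) auto
  then show ?thesis by simp
qed

text \<open>The tag \<delta> is replaced by \<open>mesh j\<close> at the cost of the factor 3
  between neighbouring mesh points: \<open>2 / \<delta> \<le> 6 / mesh j\<close>, whose square gives
  36.\<close>

lemma scaled_kernel_bound:
  assumes N: "0 < N" and j: "1 \<le> j" and \<delta>: "mesh (Suc j) \<le> \<delta>" "\<delta> \<le> mesh j"
  shows "(dirichlet_kernel N \<delta> / real N)\<^sup>2 \<le> min 1 (36 / (real N * mesh j)\<^sup>2)"
proof -
  have "\<bar>dirichlet_kernel N \<delta> / real N\<bar> \<le> 1"
    using dirichlet_kernel_le[of N \<delta>] N by simp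
  then have "(dirichlet_kernel N \<delta> / real N)\<^sup>2 \<le> 1" by (simp add: abs_square_le_1)
  moreover have "\<bar>dirichlet_kernel N \<delta> / real N\<bar> \<le> 6 / (real N * mesh j)"
  proof -
    have d: "0 < \<delta>" "\<delta> \<le> 1 / 2" using \<delta> mesh_pos[of "Suc j"] mesh_le_half[OF j] by linarith+
    have "\<bar>dirichlet_kernel N \<delta>\<bar> \<le> 2 / \<delta>" by (rule dirichlet_kernel_le_inverse[OF d])
    also have "\<dots> \<le> 2 / (mesh j / 3)"
      using mesh_Suc_ge[of j] \<delta> mesh_pos[of j] by (intro divide_left_mono) (auto simp: field_simps intro: mult_pos_pos d(1))
    finally show ?thesis using N by (simp add: field_simps)
  qed
  then have "(dirichlet_kernel N \<delta> / real N)\<^sup>2 \<le> (6 / (real N * mesh j))\<^sup>2"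
    by (metis abs_ge_zero abs_power2 power2_abs power_mono)
  ultimately show ?thesis by (simp add: power_divide)
qed

text \<open>The equation \<open>mesh j = x / N\<close> has the real solution
  \<open>ln (N / x) powr (4 / 3)\<close>; this is its integer part.\<close>

definition mesh_index :: "real \<Rightarrow> nat \<Rightarrow> nat" where
  "mesh_index x N = nat \<lfloor>(ln (real N) - ln x) powr (4 / 3)\<rfloor>"

lemma mesh_index_bounds:
  assumes x: "0 < x" and N: "x \<le> real N"
  shows "mesh (Suc (mesh_index x N)) < x / real N" "x / real N \<le> mesh (mesh_index x N)"
proof -
  define l where "l = ln (real N) - ln x"
  have N0: "0 < real N" using x N by linarith
  have l: "0 \<le> l" using x N by (simp add: l_def)
  have xl: "x / real N = exp (- l)" using x N0 by (simp add: l_def exp_diff)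
  have pw: "(l powr (4 / 3)) powr (3 / 4) = l" using l by (simp add: powr_powr)
  have i: "real (mesh_index x N) \<le> l powr (4 / 3)" "l powr (4 / 3) < real (Suc (mesh_index x N))"
    unfolding mesh_index_def l_def[symmetric] using l by simp_all linarith+
  have "real (mesh_index x N) powr (3 / 4) \<le> l"
    using powr_mono2[OF _ _ i(1), of "3 / 4"] pw by simp
  then show "x / real N \<le> mesh (mesh_index x N)" by (simp add: xl mesh_def)
  have "l < real (Suc (mesh_index x N)) powr (3 / 4)"
    using powr_less_mono2[OF _ _ i(2), of "3 / 4"] pw l by simp
  then show "mesh (Suc (mesh_index x N)) < x / real N" by (simp add: xl mesh_def)
qed

lemma mesh_index_at_top: "filterlim (mesh_index x) at_top sequentially"
  unfolding mesh_index_def by real_asymp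

text \<open>The scaled kernel is the quotient of \<open>sin y / y\<close> at
  \<open>y = pi * N * \<delta> N\<close> and at \<open>y = pi * \<delta> N\<close>. Convergence of
  \<open>N * \<delta> N\<close> forces \<open>\<delta> N\<close> to 0, so the denominator tends to
  1.\<close>

lemma dirichlet_kernel_tendsto:
  fixes \<delta> :: "nat \<Rightarrow> real"
  assumes pos: "\<And>N. 0 < \<delta> N" and lim: "(\<lambda>N. real N * \<delta> N) \<longlonglongrightarrow> x" and x: "0 < x"
  shows "(\<lambda>N. dirichlet_kernel N (\<delta> N) / real N) \<longlonglongrightarrow> sin (pi * x) / (pi * x)"
proof -
  have "(\<lambda>N. (real N * \<delta> N) * inverse (real N)) \<longlonglongrightarrow> x * 0"
    by (intro tendsto_mult lim lim_inverse_n)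
  moreover have "eventually (\<lambda>N. (real N * \<delta> N) * inverse (real N) = \<delta> N) sequentially"
    using eventually_gt_at_top[of 0] by eventually_elim simp
  ultimately have d0: "\<delta> \<longlonglongrightarrow> 0" by (simp add: tendsto_cong)
  have "(\<lambda>N. sin (pi * \<delta> N) / (pi * \<delta> N)) \<longlonglongrightarrow> 1"
  proof (rule filterlim_compose[OF sinc_at_0])
    show "filterlim (\<lambda>N. pi * \<delta> N) (at 0) sequentially"
      unfolding filterlim_at using tendsto_mult_right_zero[OF d0, of pi] pos
      by (auto simp: less_imp_neq[symmetric] intro!: always_eventually)
  qed
  then have "(\<lambda>N. sin (pi * (real N * \<delta> N)) / (pi * (real N * \<delta> N)) / (sin (pi * \<delta> N) / (pi * \<delta> N)))
     \<longlonglongrightarrow> sin (pi * x) / (pi * x) / 1"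
    using x by (intro tendsto_intros lim) auto
  moreover have "eventually (\<lambda>N. sin (pi * (real N * \<delta> N)) / (pi * (real N * \<delta> N)) / (sin (pi * \<delta> N) / (pi * \<delta> N))
      = dirichlet_kernel N (\<delta> N) / real N) sequentially"
    using eventually_gt_at_top[of 0]
  proof eventually_elim
    case (elim N)
    then show ?case using pos[of N] by (simp add: dirichlet_kernel_def field_simps)
  qed
  ultimately show ?thesis by (simp add: tendsto_cong)
qed

section \<open>The limiting variance\<close>

text \<open>Substituting \<open>y = x powr g\<close> turns this into \<open>g\<close> times the
  integral of \<open>x powr (g - 1) * (sin (pi * x) / (pi * x))\<^sup>2\<close> over positive
  \<open>x\<close>. In the variable \<open>y\<close> the increments of
  \<open>(N * mesh j) powr g\<close> are plain interval lengths.\<close>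

definition limit_variance :: "real \<Rightarrow> real" where
  "limit_variance g = (LINT y|lborel. indicator {0<..} y * (sin (pi * y powr (1 / g)) / (pi * y powr (1 / g)))\<^sup>2)"

lemma integrable_powr_tail:
  fixes p :: real
  assumes "1 < p"
  shows "integrable lborel (\<lambda>y. indicator {1..} y * y powr (- p))"
proof -
  have "(\<lambda>y::real. y powr (- p)) integrable_on {1..}"
    using has_integral_powr_to_inf[of "- p" 1] assms by (auto simp: integrable_on_def)
  then have "(\<lambda>y::real. y powr (- p)) absolutely_integrable_on {1..}"
    by (rule nonnegative_absolutely_integrable_1) simp
  then have "integrable (completion lborel) (\<lambda>y::real. indicator {1..} y *\<^sub>R y powr (- p))"
    by (simp add: set_integrable_def)
  then show ?thesis
    by (subst (asm) integrable_completion) auto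
qed

text \<open>The tail is a multiple of \<open>y powr (- (2 / g))\<close>, integrable at infinity
  because \<open>g < 2\<close>; near 0 the bound 1 takes over.\<close>

lemma kernel_dominator_integrable:
  fixes g :: real
  assumes g: "0 < g" "g < 2"
  shows "integrable lborel (\<lambda>y. indicator {0<..} y * min 1 (36 / (y powr (1 / g))\<^sup>2))"
proof -
  have int: "integrable lborel (\<lambda>y::real. indicator {0..1} y + 36 * (indicator {1..} y * y powr (- (2 / g))))"
    using g by (intro Bochner_Integration.integrable_add integrable_mult_right integrable_powr_tail) auto
  show ?thesis
  proof (rule Bochner_Integration.integrable_bound[OF int])
    show "AE y in lborel. norm (indicator {0<..} y * min 1 (36 / (y powr (1 / g))\<^sup>2))
        \<le> norm (indicator {0..1} y + 36 * (indicator {1..} y * y powr (- (2 / g))))"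
    proof (rule AE_I2)
      fix y :: real
      have "36 / (y powr (1 / g))\<^sup>2 = 36 * y powr (- (2 / g))" if "0 < y"
        using that by (simp add: powr_power powr_minus_divide)
      then show "norm (indicator {0<..} y * min 1 (36 / (y powr (1 / g))\<^sup>2))
        \<le> norm (indicator {0..1} y + 36 * (indicator {1..} y * y powr (- (2 / g))))"
        by (auto simp: indicator_def)
    qed
  qed simp
qed

lemma sinc_square_le_dominator:
  assumes "0 < x"
  shows "(sin (pi * x) / (pi * x))\<^sup>2 \<le> min 1 (36 / x\<^sup>2)"
proof -
  have "\<bar>sin (pi * x) / (pi * x)\<bar> \<le> 1"
    using abs_sin_x_le_abs_x[of "pi * x"] assms by simp
  then have "(sin (pi * x) / (pi * x))\<^sup>2 \<le> 1" by (simp add: abs_square_le_1)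
  moreover have "(sin (pi * x) / (pi * x))\<^sup>2 \<le> 36 / x\<^sup>2"
  proof -
    have "(sin (pi * x))\<^sup>2 \<le> 36 * pi\<^sup>2"
    proof -
      have "1 \<le> pi\<^sup>2" using pi_ge_two by (simp add: one_le_power)
      moreover have "(sin (pi * x))\<^sup>2 \<le> 1" by (simp add: abs_square_le_1)
      ultimately show ?thesis by linarith
    qed
    then show ?thesis using assms by (simp add: power_divide power_mult_distrib divide_simps)
  qed
  ultimately show ?thesis by simp
qed

text \<open>For \<open>y \<le> (1 / 2) powr g\<close> the argument \<open>y powr (1 / g)\<close> is
  at most 1/2, where the integrand is bounded below. Positivity is needed because the amplitudes are
  normalised by this number.\<close>

lemma limit_variance_pos:
  assumes g: "0 < g" "g < 2"
  shows "0 < limit_variance g"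
proof -
  define c where "c = (1 / 2) powr g"
  have c: "0 < c" by (simp add: c_def)
  let ?f = "\<lambda>y::real. indicator {0<..} y * (sin (pi * y powr (1 / g)) / (pi * y powr (1 / g)))\<^sup>2"
  have meas: "?f \<in> borel_measurable lborel" by measurable
  have int: "integrable lborel ?f"
  proof (rule Bochner_Integration.integrable_bound[OF kernel_dominator_integrable[OF g] meas], rule AE_I2)
    fix y :: real
    show "norm (?f y) \<le> norm (indicator {0<..} y * min 1 (36 / (y powr (1 / g))\<^sup>2))"
      using sinc_square_le_dominator[of "y powr (1 / g)"] by (auto simp: indicator_def)
  qed
  have low: "(1 / (2 * pi))\<^sup>2 * indicator {0<..c} y \<le> ?f y" for y
  proof (cases "y \<in> {0<..c}")
    case True
    define x where "x = y powr (1 / g)"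
    have "x \<le> c powr (1 / g)" unfolding x_def using True g by (intro powr_mono2) auto
    also have "\<dots> = 1 / 2" using g by (simp add: c_def powr_powr)
    finally have x: "0 < x" "x \<le> 1 / 2" using True by (auto simp: x_def)
    have "1 / (2 * pi) \<le> sin (pi * x) / (pi * x)"
      using sin_pi_ge[of x] x by (simp add: field_simps)
    then have "(1 / (2 * pi))\<^sup>2 \<le> (sin (pi * x) / (pi * x))\<^sup>2" by (intro power_mono) auto
    then show ?thesis using True by (simp add: x_def)
  qed (auto simp: indicator_def)
  have "0 < (1 / (2 * pi))\<^sup>2 * c" using c by simp
  also have "\<dots> = (LINT y|lborel. (1 / (2 * pi))\<^sup>2 * indicator {0<..c} y)" using c by simp
  also have "\<dots> \<le> limit_variance g"
    unfolding limit_variance_def using int low c by (intro integral_mono) auto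
  finally show ?thesis .
qed

lemma mesh_piece_unique:
  assumes N: "0 < N" and g: "0 < g"
    and i: "y \<in> {(real N * mesh (Suc i)) powr g <.. (real N * mesh i) powr g}"
    and j: "y \<in> {(real N * mesh (Suc j)) powr g <.. (real N * mesh j) powr g}"
  shows "i = j"
proof -
  have *: "\<not> i < j" if i: "y \<in> {(real N * mesh (Suc i)) powr g <.. (real N * mesh i) powr g}"
    and j: "y \<in> {(real N * mesh (Suc j)) powr g <.. (real N * mesh j) powr g}" for i j
  proof
    assume "i < j"
    then have "mesh j \<le> mesh (Suc i)" by (intro mesh_antimono) simp
    then have "(real N * mesh j) powr g \<le> (real N * mesh (Suc i)) powr g"
      using N g mesh_pos[of j] by (intro powr_mono2 mult_left_mono) auto
    then show False using i j by auto
  qed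
  show ?thesis using *[OF i j] *[OF j i] by simp
qed

text \<open>After the substitution \<open>y = x\<^sup>g\<close> the variance is the integral of a step function of \<open>y\<close>,
  whose tags \<open>N \<delta>\<^sub>j\<close> converge to \<open>x\<close> because consecutive mesh points have ratio tending to 1.\<close>

lemma variance_tendsto:
  fixes A :: "nat \<Rightarrow> nat set" and \<delta> :: "nat \<Rightarrow> real"
  assumes g: "0 < g" "g < 2"
    and \<delta>: "\<And>j. mesh (Suc j) \<le> \<delta> j" "\<And>j. \<delta> j \<le> mesh j"
    and fin: "\<And>N. finite (A N)" and A1: "\<And>N j. j \<in> A N \<Longrightarrow> 1 \<le> j"
    and cover: "\<And>x. 0 < x \<Longrightarrow> eventually (\<lambda>N. mesh_index x N \<in> A N) sequentially"
  shows "(\<lambda>N. \<Sum>j\<in>A N. (dirichlet_kernel N (\<delta> j) / real N)\<^sup>2 *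
       ((real N * mesh j) powr g - (real N * mesh (Suc j)) powr g)) \<longlonglongrightarrow> limit_variance g"
proof -
  define v where "v N j = (dirichlet_kernel N (\<delta> j) / real N)\<^sup>2" for N j
  define I where "I N j = {(real N * mesh (Suc j)) powr g <.. (real N * mesh j) powr g}" for N j
  \<comment> \<open>The sum in question is the integral of this step function; for
    \<open>0 < N\<close> each \<open>y\<close> lies in at most one piece.\<close>
  define H where "H N y = (\<Sum>j\<in>A N. v N j * indicator (I N j) y)" for N y
  have H_eq: "H N y = v N j" if "j \<in> A N" "y \<in> I N j" "0 < N" for N j y
  proof -
    have "H N y = (\<Sum>i\<in>A N. if i = j then v N j else 0)"
      unfolding H_def using mesh_piece_unique[OF that(3) g(1)] that(2)
      by (intro sum.cong refl) (auto simp: indicator_def I_def)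
    then show ?thesis using fin that by simp
  qed
  have H_bound: "norm (H N y) \<le> indicator {0<..} y * min 1 (36 / (y powr (1 / g))\<^sup>2)" if N: "0 < N" for N y
  proof (cases "\<exists>j\<in>A N. y \<in> I N j")
    case True
    then obtain j where j: "j \<in> A N" "y \<in> I N j" by blast
    have s: "0 < real N * mesh j" using N mesh_pos by simp
    have "(real N * mesh (Suc j)) powr g < y" "y \<le> (real N * mesh j) powr g" using j by (auto simp: I_def)
    then have y: "0 < y" "y \<le> (real N * mesh j) powr g"
      by (auto intro: le_less_trans[OF powr_ge_zero])
    have "y powr (1 / g) \<le> ((real N * mesh j) powr g) powr (1 / g)"
      using y g by (intro powr_mono2) auto
    also have "\<dots> = real N * mesh j" using s g by (simp add: powr_powr)
    finally have "36 / (real N * mesh j)\<^sup>2 \<le> 36 / (y powr (1 / g))\<^sup>2"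
      using y s N mesh_pos[of j] by (intro divide_left_mono power_mono mult_pos_pos zero_less_power) auto
    moreover have "v N j \<le> min 1 (36 / (real N * mesh j)\<^sup>2)"
      unfolding v_def using A1[OF j(1)] by (intro scaled_kernel_bound N \<delta>)
    ultimately have "v N j \<le> min 1 (36 / (y powr (1 / g))\<^sup>2)" by linarith
    moreover have "0 \<le> v N j" by (simp add: v_def)
    ultimately show ?thesis using H_eq[OF j N] y by simp
  next
    case False
    then have "H N y = 0" unfolding H_def by (intro sum.neutral) (auto simp: indicator_def)
    then show ?thesis by (simp add: indicator_def)
  qed
  have H_lim: "(\<lambda>N. H N y) \<longlonglongrightarrow> indicator {0<..} y * (sin (pi * y powr (1 / g)) / (pi * y powr (1 / g)))\<^sup>2" for y
  proof (cases "0 < y")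
    case False
    have "H N y = 0" for N
    proof -
      have "y \<notin> I N j" for j
        using False powr_ge_zero[of "real N * mesh (Suc j)" g] by (auto simp: I_def simp del: powr_ge_zero)
      then show ?thesis by (simp add: H_def)
    qed
    then show ?thesis using False by simp
  next
    case True
    define x where "x = y powr (1 / g)"
    have x: "0 < x" using True by (simp add: x_def)
    have yx: "y = x powr g" using True g by (simp add: x_def powr_powr)
    define j where "j = mesh_index x"
    have big: "eventually (\<lambda>N. x \<le> real N \<and> 0 < N) sequentially"
      using eventually_ge_at_top[of "nat \<lceil>x\<rceil>"] eventually_gt_at_top[of 0]
      by eventually_elim linarith
    have ratio: "(\<lambda>N. mesh (Suc (j N)) / mesh (j N)) \<longlonglongrightarrow> 1"
      unfolding j_def by (rule filterlim_compose[OF mesh_ratio_tendsto mesh_index_at_top])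
    \<comment> \<open>Both \<open>x\<close> and \<open>N * \<delta> (j N)\<close> lie between
      \<open>N * mesh (Suc (j N))\<close> and \<open>N * mesh (j N)\<close>, whose ratio tends to
      1.\<close>
    have tag: "(\<lambda>N. real N * \<delta> (j N)) \<longlonglongrightarrow> x"
    proof (rule tendsto_sandwich)
      show "(\<lambda>N. mesh (Suc (j N)) / mesh (j N) * x) \<longlonglongrightarrow> x"
        using tendsto_mult[OF ratio tendsto_const[of x]] by simp
      show "(\<lambda>N. x / (mesh (Suc (j N)) / mesh (j N))) \<longlonglongrightarrow> x"
        using tendsto_divide[OF tendsto_const[of x] ratio] by simp
      show "eventually (\<lambda>N. mesh (Suc (j N)) / mesh (j N) * x \<le> real N * \<delta> (j N)) sequentially"
        using big
      proof eventually_elim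
        case (elim N)
        have "x \<le> real N * mesh (j N)"
          using mesh_index_bounds(2)[OF x, of N] elim by (simp add: j_def field_simps)
        then have "mesh (Suc (j N)) / mesh (j N) * x \<le> mesh (Suc (j N)) / mesh (j N) * (real N * mesh (j N))"
          using mesh_pos[of "j N"] mesh_pos[of "Suc (j N)"] by (intro mult_left_mono) auto
        also have "\<dots> = real N * mesh (Suc (j N))" using mesh_pos[of "j N"] by simp
        also have "\<dots> \<le> real N * \<delta> (j N)" using \<delta>(1) by (intro mult_left_mono) auto
        finally show ?case .
      qed
      show "eventually (\<lambda>N. real N * \<delta> (j N) \<le> x / (mesh (Suc (j N)) / mesh (j N))) sequentially"
        using big
      proof eventually_elim
        case (elim N)
        have "real N * mesh (Suc (j N)) \<le> x"
          using mesh_index_bounds(1)[OF x, of N] elim by (simp add: j_def field_simps)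
        then have "real N * mesh (j N) \<le> x / (mesh (Suc (j N)) / mesh (j N))"
          using mesh_pos[of "j N"] mesh_pos[of "Suc (j N)"] by (simp add: field_simps)
        moreover have "real N * \<delta> (j N) \<le> real N * mesh (j N)" using \<delta>(2) by (intro mult_left_mono) auto
        ultimately show ?case by linarith
      qed
    qed
    have "(\<lambda>N. v N (j N)) \<longlonglongrightarrow> (sin (pi * x) / (pi * x))\<^sup>2"
      unfolding v_def using \<delta>(1) mesh_pos
      by (intro tendsto_power dirichlet_kernel_tendsto[OF _ tag x]) (meson less_le_trans)
    moreover have "eventually (\<lambda>N. v N (j N) = H N y) sequentially"
      using cover[OF x] big
    proof eventually_elim
      case (elim N)
      have N0: "0 < real N" using elim by simp
      have a: "real N * mesh (Suc (j N)) < x" "x \<le> real N * mesh (j N)"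
        using mesh_index_bounds[OF x, of N] elim N0 by (simp_all add: j_def field_simps)
      have "y \<in> I N (j N)"
        unfolding I_def yx using a x N0 g mesh_pos[of "Suc (j N)"]
        by (auto intro!: powr_less_mono2 powr_mono2)
      then show ?case using H_eq[of "j N" N y] elim by (simp add: j_def)
    qed
    ultimately show ?thesis using True by (simp add: x_def tendsto_cong)
  qed
  have [measurable]: "I N j \<in> sets borel" for N j by (simp add: I_def)
  have [measurable]: "H N \<in> borel_measurable lborel" for N unfolding H_def by measurable
  have int: "integral\<^sup>L lborel (H N) = (\<Sum>j\<in>A N. v N j * ((real N * mesh j) powr g - (real N * mesh (Suc j)) powr g))" for N
  proof -
    have le: "(real N * mesh (Suc j)) powr g \<le> (real N * mesh j) powr g" for j
      using g mesh_pos[of "Suc j"] mesh_antimono[of j "Suc j"] by (intro powr_mono2 mult_left_mono) auto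
    have "integrable lborel (\<lambda>y. v N j * indicator (I N j) y)" for j
      using le[of j] by (intro integrable_mult_right) (simp add: I_def)
    then have "integral\<^sup>L lborel (H N) = (\<Sum>j\<in>A N. LINT y|lborel. v N j * indicator (I N j) y)"
      unfolding H_def by (intro Bochner_Integration.integral_sum) auto
    also have "\<dots> = (\<Sum>j\<in>A N. v N j * ((real N * mesh j) powr g - (real N * mesh (Suc j)) powr g))"
      using le by (intro sum.cong refl) (simp add: I_def)
    finally show ?thesis .
  qed
  \<comment> \<open>The shift to \<open>Suc N\<close> skips \<open>N = 0\<close>, as the dominating
    bound was shown for positive \<open>N\<close>.\<close>
  have "(\<lambda>N. integral\<^sup>L lborel (H (Suc N))) \<longlonglongrightarrow> limit_variance g"
    unfolding limit_variance_def
    by (rule integral_dominated_convergence[OF _ _ kernel_dominator_integrable[OF g]])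
       (use H_lim H_bound in \<open>auto intro!: AE_I2 LIMSEQ_Suc\<close>)
  then have "(\<lambda>N. integral\<^sup>L lborel (H N)) \<longlonglongrightarrow> limit_variance g"
    by (rule LIMSEQ_imp_Suc)
  then show ?thesis unfolding int v_def .
qed

text \<open>With \<open>x = N * mesh j\<close> the squared kernel times \<open>x powr g\<close> is
  at most 36 because \<open>g < 2\<close>. The remaining factor does not involve \<open>N\<close>
  and tends to 0 with \<open>j\<close>, so no single term matters.\<close>

lemma variance_term_le:
  assumes g: "0 < g" "g < 2" and N: "0 < N" and j: "1 \<le> j"
    and \<delta>: "mesh (Suc j) \<le> \<delta>" "\<delta> \<le> mesh j"
  shows "(dirichlet_kernel N \<delta> / real N)\<^sup>2 * ((real N * mesh j) powr g - (real N * mesh (Suc j)) powr g)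
     \<le> 36 * (1 - (mesh (Suc j) / mesh j) powr g)"
proof -
  define x where "x = real N * mesh j"
  have x: "0 < x" using N mesh_pos by (simp add: x_def)
  have r: "0 \<le> 1 - (mesh (Suc j) / mesh j) powr g"
    using powr_mono2[of g "mesh (Suc j) / mesh j" 1] g mesh_pos[of j] mesh_pos[of "Suc j"] mesh_antimono[of j "Suc j"]
    by simp
  have "(real N * mesh (Suc j)) powr g = (x * (mesh (Suc j) / mesh j)) powr g"
    using mesh_pos[of j] by (simp add: x_def)
  also have "\<dots> = x powr g * (mesh (Suc j) / mesh j) powr g"
    using x mesh_pos[of j] mesh_pos[of "Suc j"] by (intro powr_mult)
  finally have eq: "(real N * mesh j) powr g - (real N * mesh (Suc j)) powr g = x powr g * (1 - (mesh (Suc j) / mesh j) powr g)"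
    by (simp add: x_def algebra_simps)
  have "min 1 (36 / x\<^sup>2) * x powr g \<le> 36"
  proof (cases "x \<le> 1")
    case True
    have "x powr g \<le> 1" using True x g powr_mono2[of g x 1] by simp
    then have "min 1 (36 / x\<^sup>2) * x powr g \<le> 1 * 1" by (intro mult_mono) auto
    then show ?thesis by simp
  next
    case False
    have "x powr g \<le> x powr 2" using False g by (intro powr_mono) auto
    also have "\<dots> = x\<^sup>2" using x by (simp add: powr_numeral)
    finally have "min 1 (36 / x\<^sup>2) * x powr g \<le> 36 / x\<^sup>2 * x\<^sup>2" by (intro mult_mono) auto
    then show ?thesis using x by simp
  qed
  moreover have "(dirichlet_kernel N \<delta> / real N)\<^sup>2 * x powr g \<le> min 1 (36 / x\<^sup>2) * x powr g"
    unfolding x_def by (intro mult_right_mono scaled_kernel_bound N j \<delta>) simp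
  ultimately have "(dirichlet_kernel N \<delta> / real N)\<^sup>2 * x powr g \<le> 36" by linarith
  from mult_right_mono[OF this r] show ?thesis unfolding eq by (simp add: mult.assoc)
qed

section \<open>Convergence of characteristic functions\<close>

text \<open>A compromise: at most \<open>sqrt j\<close> indices, so that only about
  \<open>3 powr sqrt j\<close> values are forbidden, yet enough to reach back over a whole window
  once \<open>N\<close> is large.\<close>

definition predecessors :: "nat \<Rightarrow> nat set" where
  "predecessors j = {i. i < j \<and> (j - i)\<^sup>2 \<le> j}"

text \<open>The index \<open>(ln N)\<^sup>4\<^sup>/\<^sup>3\<close> is the one at which the mesh equals \<open>1 / N\<close>.\<close>

definition window :: "nat \<Rightarrow> nat set" where
  "window N = {j. \<bar>real j - ln (real N) powr (4 / 3)\<bar> \<le> sqrt (ln (real N))}"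

lemma finite_window: "finite (window N)"
proof (rule finite_subset)
  show "window N \<subseteq> {..nat \<lceil>ln (real N) powr (4 / 3) + sqrt (ln (real N))\<rceil>}"
    unfolding window_def by (auto simp: le_nat_iff) linarith
qed simp

lemma window_ge_eventually: "eventually (\<lambda>N. \<forall>j\<in>window N. k \<le> j) sequentially"
proof -
  have "eventually (\<lambda>N. real k \<le> ln (real N) powr (4 / 3) - sqrt (ln (real N))) sequentially"
    by real_asymp
  then show ?thesis
    by eventually_elim (auto simp: window_def)
qed

text \<open>Indices of one window differ by at most \<open>2 * sqrt (ln N)\<close>. The square of
  this, \<open>4 * ln N\<close>, is of smaller order than the indices themselves, which are close to
  \<open>ln N powr (4 / 3)\<close>.\<close>

lemma window_predecessors:
  "eventually (\<lambda>N. \<forall>i\<in>window N. \<forall>j\<in>window N. i < j \<longrightarrow> i \<in> predecessors j) sequentially"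
proof -
  have "eventually (\<lambda>N. 4 * ln (real N) \<le> ln (real N) powr (4 / 3) - sqrt (ln (real N))) sequentially"
    by real_asymp
  moreover have "eventually (\<lambda>N. 0 \<le> ln (real N)) sequentially" by real_asymp
  ultimately show ?thesis
  proof eventually_elim
    case (elim N)
    show ?case
    proof (intro ballI impI)
      fix i j assume ij: "i \<in> window N" "j \<in> window N" "i < j"
      have "real (j - i) \<le> 2 * sqrt (ln (real N))"
        using ij by (auto simp: window_def of_nat_diff abs_le_iff)
      then have "(real (j - i))\<^sup>2 \<le> (2 * sqrt (ln (real N)))\<^sup>2" by (intro power_mono) auto
      also have "\<dots> = 4 * ln (real N)" using elim by (simp add: power_mult_distrib)
      also have "\<dots> \<le> real j" using elim ij by (auto simp: window_def abs_le_iff)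
      finally have "real ((j - i)\<^sup>2) \<le> real j" by simp
      then show "i \<in> predecessors j" using ij by (simp only: predecessors_def mem_Collect_eq of_nat_le_iff)
    qed
  qed
qed

text \<open>Passing from \<open>ln N\<close> to \<open>ln N - ln x\<close> moves the 4/3 power only
  by the order \<open>ln N powr (1 / 3)\<close>, which is below the half-width
  \<open>sqrt (ln N)\<close> of the window. The summand 1 accounts for rounding down.\<close>

lemma mesh_index_in_window: "eventually (\<lambda>N. mesh_index x N \<in> window N) sequentially"
proof -
  define c where "c = ln x"
  have "eventually (\<lambda>N::nat. (ln (real N) - c) powr (4 / 3) - ln (real N) powr (4 / 3) \<le> sqrt (ln (real N))) sequentially"
    by real_asymp
  moreover have "eventually (\<lambda>N::nat. 1 - sqrt (ln (real N)) \<le> (ln (real N) - c) powr (4 / 3) - ln (real N) powr (4 / 3)) sequentially"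
    by real_asymp
  ultimately show ?thesis
  proof eventually_elim
    case (elim N)
    have "real (mesh_index x N) \<le> (ln (real N) - c) powr (4 / 3)" "(ln (real N) - c) powr (4 / 3) - 1 \<le> real (mesh_index x N)"
      unfolding mesh_index_def c_def by simp_all
    then show ?case using elim unfolding window_def by (simp add: abs_le_iff)
  qed
qed

lemma mesh_index_less_eventually: "eventually (\<lambda>N. mesh_index x N < N) sequentially"
proof -
  define c where "c = ln x"
  have "eventually (\<lambda>N::nat. (ln (real N) - c) powr (4 / 3) < real N) sequentially"
    by real_asymp
  then show ?thesis
  proof eventually_elim
    case (elim N)
    have "real (mesh_index x N) \<le> (ln (real N) - c) powr (4 / 3)"
      unfolding mesh_index_def c_def by simp
    then show ?case using elim by simp
  qed
qed

lemma cmod_iexp_diff_le: "cmod (exp (\<i> * of_real a) - exp (\<i> * of_real b)) \<le> \<bar>a - b\<bar>"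
proof -
  have "exp (\<i> * of_real a) - exp (\<i> * of_real b) = exp (\<i> * of_real b) * (exp (\<i> * of_real (a - b)) - 1)"
    by (simp add: algebra_simps flip: exp_add)
  then have "cmod (exp (\<i> * of_real a) - exp (\<i> * of_real b)) = cmod (exp (\<i> * of_real (a - b)) - 1)"
    by (simp add: norm_mult)
  also have "\<dots> \<le> \<bar>a - b\<bar>" using iexp_approx1[of "a - b" 0] by simp
  finally show ?thesis .
qed

text \<open>The variance has the same limit over the window \<open>W N\<close> and over the longer
  range \<open>T N\<close>, so what lies between them vanishes in mean square. Dissociation is
  therefore required only on the window. Dropping the indices below \<open>J0\<close> is harmless
  since windows move to infinity.\<close>

lemma char_cos_series_tendsto:
  fixes m :: "nat \<Rightarrow> int" and b \<phi> :: "nat \<Rightarrow> nat \<Rightarrow> real" and \<delta> :: "nat \<Rightarrow> real"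
    and Z :: "nat \<Rightarrow> real \<Rightarrow> real"
  assumes pos: "\<And>j. 0 < m j" and inj: "inj m"
    and avoid: "\<And>j. m j \<notin> signed_sums m (predecessors j)"
    and g: "0 < g" "g < 2" and \<kappa>: "0 \<le> \<kappa>" "\<kappa> * limit_variance g = 2"
    and \<delta>: "\<And>j. mesh (Suc j) \<le> \<delta> j" "\<And>j. \<delta> j \<le> mesh j"
    and J0: "1 \<le> J0"
    and b0: "\<And>N j. j < J0 \<Longrightarrow> b N j = 0"
    and b2: "\<And>N j. 0 < N \<Longrightarrow> J0 \<le> j \<Longrightarrow> (b N j)\<^sup>2 =
        \<kappa> * ((dirichlet_kernel N (\<delta> j) / real N)\<^sup>2 * ((real N * mesh j) powr g - (real N * mesh (Suc j)) powr g))"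
    and sm: "\<And>N. summable (\<lambda>j. \<bar>b N j\<bar>)"
    and Zm: "\<And>N. Z N \<in> borel_measurable borel"
    and Z: "\<And>N x. 0 < N \<Longrightarrow> \<bar>Z N x - (\<Sum>j. b N j * cos (2 * pi * of_int (m j) * x + \<phi> N j))\<bar> \<le> e N"
    and e: "e \<longlonglongrightarrow> 0"
  shows "(\<lambda>N. \<integral>x. exp (\<i> * of_real (t * Z N x)) \<partial>unit_interval_measure) \<longlonglongrightarrow> of_real (exp (- t\<^sup>2 / 2))"
proof -
  let ?M = unit_interval_measure
  interpret prob_space ?M by (rule prob_space_unit_interval_measure)
  define X where "X N j x = b N j * cos (2 * pi * of_int (m j) * x + \<phi> N j)" for N j x
  define q where "q N j = (dirichlet_kernel N (\<delta> j) / real N)\<^sup>2 * ((real N * mesh j) powr g - (real N * mesh (Suc j)) powr g)" for N j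
  define W where "W N = window N \<inter> {J0..}" for N
  have finW: "finite (W N)" for N by (simp add: W_def finite_window)
  \<comment> \<open>The truncation level exceeds \<open>N\<close> and the window, and leaves a tail
    of at most \<open>1 / (N + 1)\<close> uniformly in \<open>x\<close>.\<close>
  have "\<exists>J. N \<le> J \<and> W N \<subseteq> {..<J} \<and> (\<Sum>j. \<bar>b N (j + J)\<bar>) \<le> inverse (real (Suc N))" for N
  proof -
    obtain J1 where J1: "\<And>n. J1 \<le> n \<Longrightarrow> norm (\<Sum>i. \<bar>b N (i + n)\<bar>) < inverse (real (Suc N))"
      using suminf_exist_split[OF _ sm, of "inverse (real (Suc N))" N] by auto
    define J where "J = Max (insert N (insert J1 (Suc ` W N)))"
    have fin: "finite (insert N (insert J1 (Suc ` W N)))" using finW by simp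
    have "N \<le> J" "J1 \<le> J" unfolding J_def by (rule Max_ge[OF fin], simp)+
    moreover have "j < J" if "j \<in> W N" for j
      using Max_ge[OF fin, of "Suc j"] that unfolding J_def by simp
    ultimately show ?thesis using J1[of J] by (intro exI[of _ J]) auto
  qed
  then obtain J where J: "\<And>N. N \<le> J N" "\<And>N. W N \<subseteq> {..<J N}" "\<And>N. (\<Sum>j. \<bar>b N (j + J N)\<bar>) \<le> inverse (real (Suc N))"
    by metis
  define T where "T N = {J0..<J N}" for N
  have WT: "W N \<subseteq> T N" for N using J(2)[of N] by (auto simp: T_def W_def)
  have "(\<lambda>N. \<Sum>j\<in>W N. q N j) \<longlonglongrightarrow> limit_variance g"
    unfolding q_def
  proof (rule variance_tendsto[OF g \<delta> finW])
    show "1 \<le> j" if "j \<in> W N" for N j using that J0 by (auto simp: W_def)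
    show "eventually (\<lambda>N. mesh_index x N \<in> W N) sequentially" for x
      using mesh_index_in_window[of x] filterlim_at_top[THEN iffD1, OF mesh_index_at_top[of x], rule_format, of J0]
      by eventually_elim (auto simp: W_def)
  qed
  \<comment> \<open>The sum of squared amplitudes tends to 2 because a squared cosine has mean
    1/2.\<close>
  then have limW: "(\<lambda>N. \<kappa> * (\<Sum>j\<in>W N. q N j)) \<longlonglongrightarrow> 2"
    using tendsto_mult_left[of _ _ _ \<kappa>] \<kappa> by metis
  have "(\<lambda>N. \<Sum>j\<in>T N. q N j) \<longlonglongrightarrow> limit_variance g"
    unfolding q_def
  proof (rule variance_tendsto[OF g \<delta>])
    show "1 \<le> j" if "j \<in> T N" for N j using that J0 by (auto simp: T_def)
    show "eventually (\<lambda>N. mesh_index x N \<in> T N) sequentially" for x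
      using mesh_index_less_eventually[of x] filterlim_at_top[THEN iffD1, OF mesh_index_at_top[of x], rule_format, of J0]
    proof eventually_elim
      case (elim N)
      then show ?case using J(1)[of N] by (auto simp: T_def)
    qed
  qed (simp add: T_def)
  then have limT: "(\<lambda>N. \<kappa> * (\<Sum>j\<in>T N. q N j)) \<longlonglongrightarrow> 2"
    using tendsto_mult_left[of _ _ _ \<kappa>] \<kappa> by metis
  define V where "V N = (\<Sum>j\<in>W N. (b N j)\<^sup>2)" for N
  define R where "R N = (\<Sum>j\<in>T N - W N. (b N j)\<^sup>2)" for N
  have N0: "eventually (\<lambda>N::nat. 0 < N) sequentially" by (rule eventually_gt_at_top)
  have Veq: "V N = \<kappa> * (\<Sum>j\<in>W N. q N j)" if "0 < N" for N
    unfolding V_def sum_distrib_left using b2[OF that] by (intro sum.cong) (auto simp: W_def q_def)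
  have Req: "R N = \<kappa> * (\<Sum>j\<in>T N. q N j) - V N" if "0 < N" for N
  proof -
    have "\<kappa> * (\<Sum>j\<in>T N. q N j) = (\<Sum>j\<in>T N. (b N j)\<^sup>2)"
      unfolding sum_distrib_left using b2[OF that] by (intro sum.cong) (auto simp: T_def q_def)
    then show ?thesis unfolding R_def V_def using sum.subset_diff[OF WT[of N], of "\<lambda>j. (b N j)\<^sup>2"] by (simp add: T_def)
  qed
  have limV: "V \<longlonglongrightarrow> 2"
    using limW by (rule Lim_transform_eventually) (use N0 in \<open>eventually_elim, simp add: Veq\<close>)
  have "(\<lambda>N. \<kappa> * (\<Sum>j\<in>T N. q N j) - V N) \<longlonglongrightarrow> 0"
    using tendsto_diff[OF limT limV] by simp
  then have limR: "R \<longlonglongrightarrow> 0"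
    by (rule Lim_transform_eventually) (use N0 in \<open>eventually_elim, simp add: Req\<close>)
  \<comment> \<open>Inserting 0 gives the maximum a meaning for an empty window.\<close>
  define \<eta> where "\<eta> N = Max (insert 0 ((\<lambda>j. \<bar>b N j\<bar>) ` W N))" for N
  have eta: "\<bar>b N j\<bar> \<le> \<eta> N" if "j \<in> W N" for N j
    unfolding \<eta>_def using finW that by (intro Max_ge) auto
  have lim\<eta>: "\<eta> \<longlonglongrightarrow> 0"
  proof (rule LIMSEQ_I)
    fix r :: real assume r: "0 < r"
    have "(\<lambda>j. \<kappa> * (36 * (1 - (mesh (Suc j) / mesh j) powr g))) \<longlonglongrightarrow> \<kappa> * (36 * (1 - 1 powr g))"
      by (intro tendsto_intros mesh_ratio_tendsto) auto
    then have "eventually (\<lambda>j. \<kappa> * (36 * (1 - (mesh (Suc j) / mesh j) powr g)) < r\<^sup>2) sequentially"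
      using r by (intro order_tendstoD(2)) auto
    then obtain k where k: "\<And>j. k \<le> j \<Longrightarrow> \<kappa> * (36 * (1 - (mesh (Suc j) / mesh j) powr g)) < r\<^sup>2"
      by (auto simp: eventually_sequentially)
    have "eventually (\<lambda>N. norm (\<eta> N - 0) < r) sequentially"
      using window_ge_eventually[of k] N0
    proof eventually_elim
      case (elim N)
      have "\<bar>b N j\<bar> < r" if j: "j \<in> W N" for j
      proof -
        have jJ: "J0 \<le> j" "k \<le> j" using j elim by (auto simp: W_def)
        have "(b N j)\<^sup>2 = \<kappa> * q N j" using b2[OF elim(2) jJ(1)] by (simp add: q_def)
        also have "\<dots> \<le> \<kappa> * (36 * (1 - (mesh (Suc j) / mesh j) powr g))"
          unfolding q_def using \<kappa> jJ J0 elim by (intro mult_left_mono variance_term_le g \<delta>) auto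
        also have "\<dots> < r\<^sup>2" by (rule k[OF jJ(2)])
        finally show ?thesis using r by (intro power2_less_imp_less[of "\<bar>b N j\<bar>" r]) auto
      qed
      moreover have "\<eta> N \<in> insert 0 ((\<lambda>j. \<bar>b N j\<bar>) ` W N)"
        unfolding \<eta>_def using finW by (intro Max_in) auto
      ultimately show ?case using r by auto
    qed
    then show "\<exists>no. \<forall>n\<ge>no. norm (\<eta> n - 0) < r" by (simp add: eventually_sequentially)
  qed
  have [measurable]: "X N j \<in> borel_measurable borel" for N j
    unfolding X_def by (intro borel_measurable_continuous_onI continuous_intros)
  have Xb: "\<bar>X N j x\<bar> \<le> \<bar>b N j\<bar>" for N j x by (simp add: X_def abs_mult mult_left_le)
  have sumX: "summable (\<lambda>j. X N j x)" for N x
    by (rule summable_comparison_test[OF _ sm[of N]]) (use Xb in auto)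
  have trunc: "\<bar>(\<Sum>j. X N j x) - (\<Sum>j\<in>T N. X N j x)\<bar> \<le> inverse (real (Suc N))" for N x
  proof -
    have "(\<Sum>j<J N. X N j x) = (\<Sum>j\<in>T N. X N j x)"
      unfolding T_def using b0 by (intro sum.mono_neutral_right) (auto simp: X_def)
    then have "(\<Sum>j. X N j x) - (\<Sum>j\<in>T N. X N j x) = (\<Sum>j. X N (j + J N) x)"
      using suminf_minus_initial_segment[OF sumX[of N x], of "J N"] by simp
    also have "\<bar>\<dots>\<bar> \<le> (\<Sum>j. \<bar>b N (j + J N)\<bar>)"
    proof -
      have s: "summable (\<lambda>j. \<bar>b N (j + J N)\<bar>)" by (rule summable_ignore_initial_segment[OF sm])
      then have s2: "summable (\<lambda>j. \<bar>X N (j + J N) x\<bar>)"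
        by (rule summable_rabs_comparison_test[rotated]) (use Xb in auto)
      show ?thesis
        by (rule order_trans[OF summable_rabs[OF s2] suminf_le[OF Xb s2 s]])
    qed
    also have "\<dots> \<le> inverse (real (Suc N))" by (rule J)
    finally show ?thesis .
  qed
  define E where "E N = \<bar>t\<bar> * (e N + inverse (real (Suc N)) + sqrt (R N))
     + \<eta> N * (2 * \<bar>t\<bar> ^ 3 * V N + exp (t\<^sup>2 * V N / 2) * t\<^sup>2 * sqrt (V N))" for N
  have limE: "E \<longlonglongrightarrow> 0"
  proof -
    have "E \<longlonglongrightarrow> \<bar>t\<bar> * (0 + 0 + sqrt 0) + 0 * (2 * \<bar>t\<bar> ^ 3 * 2 + exp (t\<^sup>2 * 2 / 2) * t\<^sup>2 * sqrt 2)"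
      unfolding E_def by (intro tendsto_intros e limR limV lim\<eta> LIMSEQ_inverse_real_of_nat) auto
    then show ?thesis by simp
  qed
  have main: "eventually (\<lambda>N. cmod ((\<integral>x. exp (\<i> * of_real (t * Z N x)) \<partial>?M) - of_real (exp (- t\<^sup>2 * V N / 4))) \<le> E N) sequentially"
    using window_predecessors N0
  proof eventually_elim
    case (elim N)
    have dis: "dissociated m (W N)"
      by (rule dissociated_greedy[where P = predecessors])
         (use elim finW avoid in \<open>auto simp: W_def predecessors_def intro: finite_subset[of _ "{..<j}" for j]\<close>)
    let ?Y = "\<lambda>x. \<Sum>j\<in>W N. X N j x"
    let ?R = "\<lambda>x. \<Sum>j\<in>T N - W N. X N j x"
    have Rint: "integrable ?M (\<lambda>x. \<bar>?R x\<bar>)"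
    proof (rule integrable_unit_interval_measure[where B = "\<Sum>j\<in>T N - W N. \<bar>b N j\<bar>"])
      show "norm \<bar>?R x\<bar> \<le> (\<Sum>j\<in>T N - W N. \<bar>b N j\<bar>)" for x
        using order_trans[OF sum_abs sum_mono[OF Xb]] by simp
    qed measurable
    have Rb: "(\<integral>x. \<bar>?R x\<bar> \<partial>?M) \<le> sqrt (R N)"
      unfolding R_def X_def using pos inj by (intro first_moment_cos_sum) (auto simp: T_def intro: inj_on_subset)
    have iZ: "integrable ?M (\<lambda>x. exp (\<i> * of_real (t * Z N x)))"
      by (rule integrable_unit_interval_measure[where B = 1]) (use Zm in auto)
    have iY: "integrable ?M (\<lambda>x. exp (\<i> * of_real (t * ?Y x)))"
      by (rule integrable_unit_interval_measure[where B = 1]) auto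
    have ptw: "cmod (exp (\<i> * of_real (t * Z N x)) - exp (\<i> * of_real (t * ?Y x)))
        \<le> \<bar>t\<bar> * (e N + inverse (real (Suc N))) + \<bar>t\<bar> * \<bar>?R x\<bar>" for x
    proof -
      have "(\<Sum>j\<in>T N. X N j x) = ?Y x + ?R x"
        using sum.subset_diff[OF WT[of N], of "\<lambda>j. X N j x"] by (simp add: T_def)
      then have "\<bar>Z N x - ?Y x\<bar> \<le> e N + inverse (real (Suc N)) + \<bar>?R x\<bar>"
        using Z[OF elim(2), of x] trunc[of N x] unfolding X_def[symmetric] by linarith
      then have "\<bar>t\<bar> * \<bar>Z N x - ?Y x\<bar> \<le> \<bar>t\<bar> * (e N + inverse (real (Suc N)) + \<bar>?R x\<bar>)"
        by (intro mult_left_mono) auto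
      moreover have "\<bar>t * Z N x - t * ?Y x\<bar> = \<bar>t\<bar> * \<bar>Z N x - ?Y x\<bar>"
        by (simp add: right_diff_distrib[symmetric] abs_mult)
      ultimately show ?thesis using cmod_iexp_diff_le[of "t * Z N x" "t * ?Y x"] by (simp add: distrib_left)
    qed
    have "cmod ((\<integral>x. exp (\<i> * of_real (t * Z N x)) \<partial>?M) - (\<integral>x. exp (\<i> * of_real (t * ?Y x)) \<partial>?M))
       = cmod (\<integral>x. exp (\<i> * of_real (t * Z N x)) - exp (\<i> * of_real (t * ?Y x)) \<partial>?M)"
      using iZ iY by (subst Bochner_Integration.integral_diff) auto
    also have "\<dots> \<le> (\<integral>x. \<bar>t\<bar> * (e N + inverse (real (Suc N))) + \<bar>t\<bar> * \<bar>?R x\<bar> \<partial>?M)"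
      using iZ iY Rint ptw
      by (intro Bochner_Integration.integral_norm_bound_integral Bochner_Integration.integrable_diff
            Bochner_Integration.integrable_add integrable_mult_right) auto
    also have "\<dots> = \<bar>t\<bar> * (e N + inverse (real (Suc N))) + \<bar>t\<bar> * (\<integral>x. \<bar>?R x\<bar> \<partial>?M)"
      using Rint by (subst Bochner_Integration.integral_add) (auto simp: prob_space)
    also have "\<dots> \<le> \<bar>t\<bar> * (e N + inverse (real (Suc N))) + \<bar>t\<bar> * sqrt (R N)"
      using Rb by (intro add_left_mono mult_left_mono) auto
    finally have 1: "cmod ((\<integral>x. exp (\<i> * of_real (t * Z N x)) \<partial>?M) - (\<integral>x. exp (\<i> * of_real (t * ?Y x)) \<partial>?M))
       \<le> \<bar>t\<bar> * (e N + inverse (real (Suc N)) + sqrt (R N))" by (simp add: distrib_left)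
    have 2: "cmod ((\<integral>x. exp (\<i> * of_real (t * ?Y x)) \<partial>?M) - of_real (exp (- t\<^sup>2 * V N / 4)))
       \<le> \<eta> N * (2 * \<bar>t\<bar> ^ 3 * V N + exp (t\<^sup>2 * V N / 2) * t\<^sup>2 * sqrt (V N))"
      unfolding V_def X_def by (rule char_dissociated_cos_sum[OF finW dis pos eta])
    from norm_triangle_mono[OF 1 2] show ?case by (simp add: E_def)
  qed
  have "(\<lambda>N. (\<integral>x. exp (\<i> * of_real (t * Z N x)) \<partial>?M) - of_real (exp (- t\<^sup>2 * V N / 4))) \<longlonglongrightarrow> 0"
    by (rule Lim_null_comparison[OF main limE])
  moreover have "(\<lambda>N. complex_of_real (exp (- t\<^sup>2 * V N / 4))) \<longlonglongrightarrow> of_real (exp (- t\<^sup>2 * 2 / 4))"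
    by (intro tendsto_intros limV) auto
  ultimately have "(\<lambda>N. ((\<integral>x. exp (\<i> * of_real (t * Z N x)) \<partial>?M) - of_real (exp (- t\<^sup>2 * V N / 4)))
      + complex_of_real (exp (- t\<^sup>2 * V N / 4))) \<longlonglongrightarrow> 0 + of_real (exp (- t\<^sup>2 * 2 / 4))"
    by (rule tendsto_add)
  then show ?thesis by simp
qed

section \<open>Cosine series on the circle\<close>

lemma int_iterate_rotation: "int_iterate (rotation \<alpha>) n x = x + to_circle (of_int n * \<alpha>)"
proof -
  have add: "x + to_circle s + to_circle t = x + to_circle (s + t)" for x s t
    by (simp add: add.assoc plus_circle.abs_eq)
  have zero: "x + to_circle 0 = x" for x
    by (simp add: zero_circle_def[symmetric])
  have pow: "((\<lambda>x. x + to_circle t) ^^ k) x = x + to_circle (real k * t)" for t k x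
    by (induction k) (simp_all add: add zero distrib_right add.commute[of t])
  have inv: "inv (rotation \<alpha>) = (\<lambda>x. x + to_circle (- \<alpha>))"
    by (rule inv_equality) (simp_all add: rotation_def add zero)
  have rot: "rotation \<alpha> = (\<lambda>x. x + to_circle \<alpha>)" by (simp add: rotation_def fun_eq_iff)
  show ?thesis
  proof (cases "0 \<le> n")
    case True
    then show ?thesis unfolding int_iterate_def rot by (simp add: pow)
  next
    case False
    then show ?thesis unfolding int_iterate_def inv by (simp add: pow)
  qed
qed

lemma circle_exhaust: obtains x where "c = to_circle x"
  by (metis Quotient_abs_rep[OF Quotient_circle])

lemma integral_circle_measure:
  fixes h :: "circle \<Rightarrow> 'b :: {banach, second_countable_topology}"
  assumes [measurable]: "h \<in> borel_measurable borel"
  shows "integral\<^sup>L circle_measure h = (\<integral>x. h (to_circle x) \<partial>unit_interval_measure)"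
  unfolding circle_measure_def by (rule integral_distr) auto

section \<open>From characteristic functions to convergence in law\<close>

lemma std_normal_upper_tail:
  "measure std_normal_distribution {..- t} = 1 / sqrt (2 * pi) * (LINT v:{t..}|lborel. exp (- v\<^sup>2 / 2))"
proof -
  have "measure std_normal_distribution {..- t} = (LINT v|lborel. std_normal_density v * indicator {..- t} v)"
  proof -
    have "measure std_normal_distribution {..- t} = integral\<^sup>L std_normal_distribution (indicator {..- t})"
      by simp
    also have "\<dots> = (LINT v|lborel. std_normal_density v * indicator {..- t} v)"
      by (subst integral_density) auto
    finally show ?thesis .
  qed
  also have "\<dots> = (LINT v|lborel. std_normal_density (- v) * indicator {..- t} (- v))"
    using lborel_integral_real_affine[of "-1" "\<lambda>v. std_normal_density v * indicator {..- t} v" 0] by simp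
  also have "\<dots> = (LINT v|lborel. (1 / sqrt (2 * pi)) * (indicator {t..} v *\<^sub>R exp (- v\<^sup>2 / 2)))"
    by (intro Bochner_Integration.integral_cong refl) (auto simp: std_normal_density_def indicator_def)
  finally show ?thesis by (simp add: set_lebesgue_integral_def)
qed

text \<open>Levy's continuity theorem is applied to \<open>- Z n\<close>, so that the event
  \<open>Z n x \<ge> t\<close> becomes a value of a distribution function at \<open>- t\<close>. The
  normal law has no atoms, hence convergence holds at every such point.\<close>

lemma converges_in_law_std_normal_of_char:
  fixes Z :: "nat \<Rightarrow> 'a \<Rightarrow> real"
  assumes M: "prob_space M" and Zm: "\<And>n. Z n \<in> borel_measurable M"
    and char: "\<And>t. (\<lambda>n. \<integral>x. exp (\<i> * of_real (t * Z n x)) \<partial>M) \<longlonglongrightarrow> of_real (exp (- t\<^sup>2 / 2))"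
  shows "converges_in_law_std_normal M Z"
  unfolding converges_in_law_std_normal_def
proof (intro conjI allI)
  interpret prob_space M by fact
  show "Z n \<in> borel_measurable M" for n by (rule Zm)
  fix t :: real
  define D where "D n = distr M borel (\<lambda>x. - Z n x)" for n
  have [measurable]: "Z n \<in> borel_measurable M" for n by (rule Zm)
  have "weak_conv_m D std_normal_distribution"
  proof (rule levy_continuity[OF _ real_dist_normal_dist])
    show "real_distribution (D n)" for n
      unfolding D_def by (rule real_distribution_distr) measurable
    fix s
    have "char (D n) s = (\<integral>x. exp (\<i> * of_real ((- s) * Z n x)) \<partial>M)" for n
      unfolding D_def char_def by (subst integral_distr) auto
    then show "(\<lambda>n. char (D n) s) \<longlonglongrightarrow> char std_normal_distribution s"
      using char[of "- s"] by (simp add: char_std_normal_distribution)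
  qed
  moreover have "isCont (cdf std_normal_distribution) (- t)"
  proof -
    interpret N: real_distribution std_normal_distribution by (rule real_dist_normal_dist)
    have "emeasure std_normal_distribution {- t} = 0"
      by (subst emeasure_density) (auto simp: nn_integral_0_iff_AE intro!: AE_I'[of "{- t}"] simp: indicator_def)
    then show ?thesis by (subst N.isCont_cdf) (simp add: measure_def)
  qed
  ultimately have "(\<lambda>n. cdf (D n) (- t)) \<longlonglongrightarrow> cdf std_normal_distribution (- t)"
    unfolding weak_conv_m_def weak_conv_def by blast
  moreover have "cdf (D n) (- t) = measure M {x \<in> space M. Z n x \<ge> t}" for n
    unfolding cdf_def D_def by (subst measure_distr) (auto intro!: arg_cong[where f = "measure M"])
  ultimately show "(\<lambda>n. measure M {x \<in> space M. Z n x \<ge> t}) \<longlonglongrightarrow> 1 / sqrt (2 * pi) * (LINT v:{t..}|lborel. exp (- v\<^sup>2 / 2))"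
    by (simp add: cdf_def std_normal_upper_tail)
qed

text \<open>\<open>rep_circle\<close> picks an arbitrary representative, which is harmless because
  the frequencies are integers.\<close>

definition cos_series :: "(nat \<Rightarrow> real) \<Rightarrow> (nat \<Rightarrow> int) \<Rightarrow> circle \<Rightarrow> real" where
  "cos_series a m c = (\<Sum>j. a j * cos (2 * pi * of_int (m j) * rep_circle c))"

lemma cos_periodic:
  assumes "x - y \<in> \<int>"
  shows "cos (2 * pi * of_int (n::int) * x) = cos (2 * pi * of_int n * y)"
proof -
  obtain z where z: "x - y = of_int z" using assms by (auto elim: Ints_cases)
  then have "2 * pi * of_int n * x = 2 * pi * of_int n * y + 2 * pi * of_int (n * z)"
    by (simp add: algebra_simps)
  then show ?thesis using cos_add[of "2 * pi * of_int n * y" "2 * pi * of_int (n * z)"]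
    by (simp add: cos_integer_2pi sin_integer_2pi del: of_int_mult)
qed

lemma cos_series_to_circle: "cos_series a m (to_circle x) = (\<Sum>j. a j * cos (2 * pi * of_int (m j) * x))"
proof -
  have "to_circle (rep_circle (to_circle x)) = to_circle x" by (simp add: Quotient_abs_rep[OF Quotient_circle])
  then have "rep_circle (to_circle x) - x \<in> \<int>" by (simp add: circle.abs_eq_iff)
  then show ?thesis unfolding cos_series_def by (simp add: cos_periodic)
qed

lemma circle_lift_close:
  obtains x y where "c = to_circle x" "c' = to_circle y" "dist c c' = \<bar>x - y\<bar>"
proof -
  obtain x where x: "c = to_circle x" by (rule circle_exhaust)
  obtain y where y: "c' = to_circle y" by (rule circle_exhaust)
  define y' where "y' = y + of_int (round (x - y))"
  have "c' = to_circle y'" unfolding y y'_def by (simp add: circle.abs_eq_iff)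
  moreover have "dist c c' = \<bar>x - y'\<bar>"
    unfolding x y dist_circle.abs_eq nint_dist_def y'_def by (simp add: algebra_simps)
  ultimately show thesis using that x by blast
qed

lemma summable_mult_cos:
  fixes a y :: "nat \<Rightarrow> real"
  assumes "summable (\<lambda>j. \<bar>a j\<bar>)"
  shows "summable (\<lambda>j. a j * cos (y j))" "summable (\<lambda>j. \<bar>a j * cos (y j)\<bar>)"
proof -
  show "summable (\<lambda>j. \<bar>a j * cos (y j)\<bar>)"
    by (rule summable_comparison_test[OF _ assms]) (auto simp: abs_mult mult_left_le)
  then show "summable (\<lambda>j. a j * cos (y j))" by (rule summable_rabs_cancel)
qed

lemma abs_cos_series_le:
  assumes "summable (\<lambda>j. \<bar>a j\<bar>)"
  shows "\<bar>cos_series a m c\<bar> \<le> (\<Sum>j. \<bar>a j\<bar>)"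
  unfolding cos_series_def
  by (rule order_trans[OF summable_rabs[OF summable_mult_cos(2)[OF assms]] suminf_le[OF _ summable_mult_cos(2)[OF assms] assms]])
     (simp add: abs_mult mult_left_le)

lemma continuous_cos_series:
  assumes sm: "summable (\<lambda>j. \<bar>a j\<bar>)"
  shows "continuous_on UNIV (cos_series a m)"
proof -
  define F where "F x = (\<Sum>j. a j * cos (2 * pi * of_int (m j) * x))" for x
  have "uniform_limit UNIV (\<lambda>n x. \<Sum>j<n. a j * cos (2 * pi * of_int (m j) * x)) F sequentially"
    unfolding F_def by (rule Weierstrass_m_test[OF _ sm]) (simp add: abs_mult mult_left_le)
  then have "continuous_on UNIV F"
    by (rule uniform_limit_theorem[rotated]) (auto intro!: always_eventually continuous_intros)
  show ?thesis
  proof (rule continuous_on_iff[THEN iffD2], safe)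
    fix c :: circle and e :: real assume e: "0 < e"
    obtain x where x: "c = to_circle x" by (rule circle_exhaust)
    obtain d where d: "0 < d" "\<And>y. dist y x < d \<Longrightarrow> dist (F y) (F x) < e"
      using \<open>continuous_on UNIV F\<close> e unfolding continuous_on_iff by (meson UNIV_I)
    have "dist (cos_series a m c') (cos_series a m c) < e" if "dist c' c < d" for c'
    proof -
      obtain y x' where y: "c' = to_circle y" "c = to_circle x'" "dist c' c = \<bar>y - x'\<bar>" by (rule circle_lift_close)
      have "to_circle x = to_circle x'" using x y(2) by simp
      then have "x - x' \<in> \<int>" by (simp add: circle.abs_eq_iff)
      then have "c' = to_circle (y + (x - x'))" using y Ints_minus[of "x - x'"] by (simp add: circle.abs_eq_iff)
      moreover have "dist (y + (x - x')) x < d" using that y by (simp add: dist_real_def)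
      ultimately show ?thesis using d(2) x by (simp add: cos_series_to_circle F_def)
    qed
    then show "\<exists>d>0. \<forall>c'\<in>UNIV. dist c' c < d \<longrightarrow> dist (cos_series a m c') (cos_series a m c) < e"
      using d(1) by blast
  qed
qed

text \<open>Interpolates between the bounds \<open>\<bar>A - B\<bar>\<close> and 2: a number in the
  unit interval is at most its power with exponent \<open>a \<le> 1\<close>.\<close>

lemma cos_diff_hoelder:
  fixes A B a :: real
  assumes a: "0 < a" "a \<le> 1"
  shows "\<bar>cos A - cos B\<bar> \<le> 2 * (\<bar>A - B\<bar> / 2) powr a"
proof (cases "\<bar>A - B\<bar> / 2 \<le> 1")
  case True
  have "cmod (exp (\<i> * of_real A) - exp (\<i> * of_real B)) \<le> \<bar>A - B\<bar>" by (rule cmod_iexp_diff_le)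
  moreover have "\<bar>cos A - cos B\<bar> \<le> cmod (exp (\<i> * of_real A) - exp (\<i> * of_real B))"
    using abs_Re_le_cmod[of "exp (\<i> * of_real A) - exp (\<i> * of_real B)"] by (simp add: Re_exp)
  ultimately have "\<bar>cos A - cos B\<bar> \<le> 2 * (\<bar>A - B\<bar> / 2)" by simp
  also have "\<bar>A - B\<bar> / 2 \<le> (\<bar>A - B\<bar> / 2) powr a"
    using True a powr_mono'[of a 1 "\<bar>A - B\<bar> / 2"] by simp
  finally show ?thesis by simp
next
  case False
  then have "1 \<le> (\<bar>A - B\<bar> / 2) powr a" using a by (intro ge_one_powr_ge_zero) auto
  moreover have "\<bar>cos A - cos B\<bar> \<le> 2"
    using abs_triangle_ineq4[of "cos A" "cos B"] abs_cos_le_one[of A] abs_cos_le_one[of B] by linarith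
  ultimately show ?thesis by linarith
qed

text \<open>Half of the phase difference of term \<open>j\<close> is
  \<open>pi * m j * \<bar>x - y\<bar>\<close>, which explains the weights. Their sum is a Hoelder
  constant, so the last hypothesis makes it at most 1.\<close>

lemma cos_series_lip:
  fixes a :: "nat \<Rightarrow> real" and \<gamma> :: real
  assumes a: "0 < \<gamma>" "\<gamma> \<le> 1" and sm: "summable (\<lambda>j. \<bar>a j\<bar>)" and pos: "\<And>j. 0 < m j"
    and sm2: "summable (\<lambda>j. \<bar>a j\<bar> * (2 * (pi * of_int (m j)) powr \<gamma>))"
    and le: "(\<Sum>j. \<bar>a j\<bar> * (2 * (pi * of_int (m j)) powr \<gamma>)) \<le> 1"
  shows "cos_series a m \<in> lip \<gamma>"
proof -
  have meas: "cos_series a m \<in> borel_measurable borel"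
    by (rule borel_measurable_continuous_onI[OF continuous_cos_series[OF sm]])
  interpret prob_space circle_measure by (rule prob_space_circle_measure)
  have "integrable circle_measure (\<lambda>x. (cos_series a m x)\<^sup>2)"
  proof (rule integrable_const_bound[where B = "(\<Sum>j. \<bar>a j\<bar>)\<^sup>2"])
    show "AE x in circle_measure. norm ((cos_series a m x)\<^sup>2) \<le> (\<Sum>j. \<bar>a j\<bar>)\<^sup>2"
      using power_mono[OF abs_cos_series_le[OF sm], where n = 2] by simp
    show "(\<lambda>x. (cos_series a m x)\<^sup>2) \<in> borel_measurable circle_measure"
      using meas by (simp cong: measurable_cong_sets add: sets_circle_measure)
  qed
  moreover have "\<bar>cos_series a m c - cos_series a m c'\<bar> \<le> dist c c' powr \<gamma>" for c c'
  proof -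
    obtain x y where xy: "c = to_circle x" "c' = to_circle y" "dist c c' = \<bar>x - y\<bar>" by (rule circle_lift_close)
    let ?T = "\<lambda>j. a j * cos (2 * pi * of_int (m j) * x) - a j * cos (2 * pi * of_int (m j) * y)"
    let ?S = "\<lambda>j. \<bar>a j\<bar> * (2 * (pi * of_int (m j)) powr \<gamma>) * \<bar>x - y\<bar> powr \<gamma>"
    have s: "summable ?S" using sm2 by (rule summable_mult2)
    have T: "\<bar>?T j\<bar> \<le> ?S j" for j
    proof -
      have "\<bar>?T j\<bar> = \<bar>a j\<bar> * \<bar>cos (2 * pi * of_int (m j) * x) - cos (2 * pi * of_int (m j) * y)\<bar>"
        by (simp add: right_diff_distrib[symmetric] abs_mult)
      also have "\<dots> \<le> \<bar>a j\<bar> * (2 * (\<bar>2 * pi * of_int (m j) * x - 2 * pi * of_int (m j) * y\<bar> / 2) powr \<gamma>)"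
        by (intro mult_left_mono cos_diff_hoelder a) auto
      also have "\<bar>2 * pi * of_int (m j) * x - 2 * pi * of_int (m j) * y\<bar> / 2 = (pi * of_int (m j)) * \<bar>x - y\<bar>"
        using pos[of j] by (simp add: right_diff_distrib[symmetric] abs_mult)
      also have "((pi * of_int (m j)) * \<bar>x - y\<bar>) powr \<gamma> = (pi * of_int (m j)) powr \<gamma> * \<bar>x - y\<bar> powr \<gamma>"
        by (rule powr_mult)
      finally show ?thesis by (simp add: mult.assoc)
    qed
    have s1: "summable (\<lambda>j. \<bar>?T j\<bar>)" by (rule summable_comparison_test[OF _ s]) (use T in auto)
    have "cos_series a m c - cos_series a m c' = (\<Sum>j. ?T j)"
      unfolding xy cos_series_to_circle by (intro suminf_diff summable_mult_cos sm)
    then have "\<bar>cos_series a m c - cos_series a m c'\<bar> \<le> (\<Sum>j. \<bar>?T j\<bar>)"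
      using summable_rabs[OF s1] by simp
    also have "\<dots> \<le> (\<Sum>j. ?S j)" by (rule suminf_le[OF T s1 s])
    also have "\<dots> = (\<Sum>j. \<bar>a j\<bar> * (2 * (pi * of_int (m j)) powr \<gamma>)) * \<bar>x - y\<bar> powr \<gamma>"
      by (rule suminf_mult2[OF sm2, symmetric])
    also have "\<dots> \<le> 1 * \<bar>x - y\<bar> powr \<gamma>" using le by (intro mult_right_mono) auto
    finally show ?thesis using xy by simp
  qed
  ultimately show ?thesis
    using meas unfolding lip_def by (simp cong: measurable_cong_sets add: sets_circle_measure)
qed

section \<open>Sums along the sequence\<close>

text \<open>Telescoping by product-to-sum formulas. The form multiplied by
  \<open>sin (pi * t)\<close> lets the induction run without division.\<close>

lemma sin_times_cos_progression:
  "sin (pi * t) * (\<Sum>k<N. cos (y + 2 * pi * (real k * t))) = sin (pi * real N * t) * cos (y + pi * (real N - 1) * t)"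
proof (induction N)
  case (Suc N)
  define A where "A = pi * t"
  have shift: "pi * real n * t = real n * A" "y + 2 * pi * (real n * t) = y + 2 * real n * A"
    "y + pi * (real n - 1) * t = y + (real n - 1) * A" for n
    by (simp_all add: A_def algebra_simps)
  have "sin A * (\<Sum>k<Suc N. cos (y + 2 * pi * (real k * t)))
    = sin (real N * A) * cos (y + (real N - 1) * A) + sin A * cos (y + 2 * real N * A)"
    using Suc by (simp add: distrib_left A_def[symmetric] shift)
  also have "\<dots> = (sin (y + (2 * real N + 1) * A) + sin (A - y)) / 2"
    unfolding sin_times_cos
  proof -
    have e: "real N * A + (y + (real N - 1) * A) = y + (2 * real N - 1) * A"
      "real N * A - (y + (real N - 1) * A) = A - y" "A + (y + 2 * real N * A) = y + (2 * real N + 1) * A"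
      "A - (y + 2 * real N * A) = - (y + (2 * real N - 1) * A)"
      by (simp_all add: algebra_simps)
    show "(sin (real N * A + (y + (real N - 1) * A)) + sin (real N * A - (y + (real N - 1) * A))) / 2 +
      (sin (A + (y + 2 * real N * A)) + sin (A - (y + 2 * real N * A))) / 2
      = (sin (y + (2 * real N + 1) * A) + sin (A - y)) / 2"
      unfolding e sin_minus by (simp add: add_divide_distrib diff_divide_distrib)
  qed
  also have "\<dots> = sin (real (Suc N) * A) * cos (y + (real (Suc N) - 1) * A)"
    unfolding sin_times_cos by (simp add: algebra_simps)
  finally show ?case by (simp add: A_def[symmetric] shift del: of_nat_Suc)
qed simp

lemma sum_cos_progression:
  assumes "sin (pi * t) \<noteq> 0"
  shows "(\<Sum>k<N. cos (y + 2 * pi * (real k * t))) = dirichlet_kernel N t * cos (y + pi * (real N - 1) * t)"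
  using sin_times_cos_progression[of t y N] assms by (simp add: dirichlet_kernel_def field_simps)

lemma sin_square_add_pi: "(sin (x + pi * of_int z))\<^sup>2 = (sin x)\<^sup>2"
proof -
  have eq: "2 * (x + pi * of_int z) = 2 * x + 2 * pi * of_int z" by simp
  have "cos (2 * x + 2 * pi * of_int z) = cos (2 * x)"
    unfolding cos_add by (simp add: cos_integer_2pi sin_integer_2pi)
  then have "cos (2 * (x + pi * of_int z)) = cos (2 * x)" by (simp only: eq)
  then show ?thesis using cos_double_sin[of "x + pi * of_int z"] cos_double_sin[of x] by linarith
qed

text \<open>An integer shift multiplies numerator and denominator by signs that may differ, so
  periodicity is stated for the square.\<close>

lemma dirichlet_kernel_add_int: "(dirichlet_kernel N (t + of_int z))\<^sup>2 = (dirichlet_kernel N t)\<^sup>2"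
  using sin_square_add_pi[of "pi * t" z] sin_square_add_pi[of "pi * real N * t" "int N * z"]
  by (simp add: dirichlet_kernel_def power_divide algebra_simps)

section \<open>Comparing the sequence with an interval of integers\<close>

lemma strict_mono_int_ge:
  fixes u :: "nat \<Rightarrow> int"
  assumes "strict_mono u"
  shows "u 0 + int k \<le> u k"
proof (induction k)
  case (Suc k)
  then show ?case using assms[THEN strict_monoD, of k "Suc k"] by simp
qed simp

text \<open>Both index sets consist of \<open>N\<close> integers in \<open>{u 0..<u N}\<close>, so
  each omits exactly \<open>u N - u 0 - N\<close> of them, and the two omitted parts bound the
  difference.\<close>

lemma sum_strict_mono_vs_interval:
  fixes u :: "nat \<Rightarrow> int" and h :: "int \<Rightarrow> real"
  assumes u: "strict_mono u" and h: "\<And>n. \<bar>h n\<bar> \<le> B"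
  shows "\<bar>(\<Sum>k<N. h (u k)) - (\<Sum>k<N. h (u 0 + int k))\<bar> \<le> 2 * B * of_int (u N - u 0 - int N)"
proof -
  have um: "u i < u j" if "i < j" for i j using u that by (simp add: strict_mono_def)
  note grow = strict_mono_int_ge[OF u]
  define I where "I = {u 0..<u N}"
  define A where "A = u ` {..<N}"
  define A' where "A' = (\<lambda>k. u 0 + int k) ` {..<N}"
  have injA: "inj_on u {..<N}" using strict_mono_imp_inj_on[OF u] inj_on_subset by blast
  have injA': "inj_on (\<lambda>k. u 0 + int k) {..<N}" by (auto simp: inj_on_def)
  have AI: "A \<subseteq> I"
  proof
    fix n assume "n \<in> A"
    then obtain k where k: "k < N" "n = u k" by (auto simp: A_def)
    have "u 0 \<le> u k" using grow[of k] by linarith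
    then show "n \<in> I" using k um[of k N] by (simp add: I_def)
  qed
  have A'I: "A' \<subseteq> I" using grow[of N] by (auto simp: A'_def I_def)
  have card: "real (card (I - S)) = of_int (u N - u 0 - int N)" if "S \<subseteq> I" "card S = N" for S
  proof -
    have "finite S" using that(1) finite_subset by (auto simp: I_def)
    then have "card (I - S) = card I - N" using that by (simp add: card_Diff_subset)
    then show ?thesis using grow[of N] by (simp add: I_def of_nat_diff)
  qed
  have bd: "\<bar>\<Sum>n\<in>I - S. h n\<bar> \<le> B * of_int (u N - u 0 - int N)" if "S \<subseteq> I" "card S = N" for S
  proof -
    have "\<bar>\<Sum>n\<in>I - S. h n\<bar> \<le> (\<Sum>n\<in>I - S. B)" by (rule order_trans[OF sum_abs sum_mono]) (rule h)
    also have "\<dots> = B * real (card (I - S))" by simp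
    finally show ?thesis unfolding card[OF that] .
  qed
  have split: "(\<Sum>n\<in>I. h n) = (\<Sum>n\<in>I - S. h n) + (\<Sum>n\<in>S. h n)" if "S \<subseteq> I" for S
    by (rule sum.subset_diff[OF that]) (simp add: I_def)
  have "(\<Sum>k<N. h (u k)) = (\<Sum>n\<in>A. h n)" "(\<Sum>k<N. h (u 0 + int k)) = (\<Sum>n\<in>A'. h n)"
    unfolding A_def A'_def using injA injA' by (simp_all add: sum.reindex)
  moreover have "card A = N" "card A' = N" unfolding A_def A'_def using injA injA' by (simp_all add: card_image)
  ultimately show ?thesis
    using split[OF AI] split[OF A'I] bd[OF AI] bd[OF A'I] by linarith
qed

text \<open>Since \<open>u N \<ge> u 0 + N\<close>, the density \<zeta> is at least 1, hence equal
  to 1. The hypothesis then reads \<open>u N - N = O(N powr (1 - \<sigma>))\<close>, and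
  \<open>1 - \<sigma> < \<beta>\<close>.\<close>

lemma omitted_integers_negligible:
  fixes u :: "nat \<Rightarrow> int" and \<beta> \<sigma> \<zeta> :: real
  assumes u: "strict_mono u" and beta: "0 < \<beta>" "\<beta> < 1" and sigma: "\<sigma> > 1 - \<beta>" and zeta: "\<zeta> \<le> 1"
    and u_asymp: "(\<lambda>N. \<bar>real_of_int (u N) / real N - \<zeta>\<bar>) \<in> O(\<lambda>N. real N powr (- \<sigma>))"
  shows "(\<lambda>N. of_int (u N - u 0 - int N) / real N powr \<beta>) \<longlonglongrightarrow> 0"
proof -
  note grow = strict_mono_int_ge[OF u]
  have p0: "(\<lambda>N. real N powr (- \<sigma>)) \<longlonglongrightarrow> 0"
    using sigma beta by (intro tendsto_neg_powr filterlim_real_sequentially) auto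
  obtain K where K: "eventually (\<lambda>N. norm \<bar>real_of_int (u N) / real N - \<zeta>\<bar> \<le> K * norm (real N powr (- \<sigma>))) sequentially"
    using u_asymp by (elim landau_o.bigE)
  have "(\<lambda>N. \<bar>real_of_int (u N) / real N - \<zeta>\<bar>) \<longlonglongrightarrow> 0"
    by (rule Lim_null_comparison[OF _ tendsto_mult_right_zero[OF p0, of K]]) (use K in simp)
  then have lim: "(\<lambda>N. real_of_int (u N) / real N) \<longlonglongrightarrow> \<zeta>"
    using LIM_zero_cancel tendsto_rabs_zero_iff by blast
  have "(\<lambda>N. real_of_int (u 0) / real N + 1) \<longlonglongrightarrow> 0 + 1"
    by (intro tendsto_intros lim_const_over_n)
  then have "0 + 1 \<le> \<zeta>"
  proof (rule tendsto_le[OF sequentially_bot lim])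
    show "eventually (\<lambda>N. real_of_int (u 0) / real N + 1 \<le> real_of_int (u N) / real N) sequentially"
      using eventually_gt_at_top[of 0]
    proof eventually_elim
      case (elim N)
      have "real_of_int (u 0) + real N \<le> real_of_int (u N)" using grow[of N] by linarith
      then have "(real_of_int (u 0) + real N) / real N \<le> real_of_int (u N) / real N" by (intro divide_right_mono) auto
      then show ?case using elim by (simp add: add_divide_distrib)
    qed
  qed
  then have z: "\<zeta> = 1" using zeta by simp
  have dom: "eventually (\<lambda>N. norm (of_int (u N - u 0 - int N) / real N powr \<beta>) \<le>
      K * real N powr (1 - \<sigma> - \<beta>) + \<bar>of_int (u 0)\<bar> * real N powr (- \<beta>)) sequentially"
    using K eventually_gt_at_top[of 0]
  proof eventually_elim
    case (elim N)
    have N: "0 < real N" using elim by simp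
    have "\<bar>of_int (u N) - real N\<bar> = real N * \<bar>of_int (u N) / real N - 1\<bar>"
    proof -
      have "of_int (u N) - real N = real N * (of_int (u N) / real N - 1)" using N by (simp add: field_simps)
      then show ?thesis using N by (simp add: abs_mult)
    qed
    also have "\<dots> \<le> real N * (K * real N powr (- \<sigma>))"
      using elim(1) z by (intro mult_left_mono) auto
    also have "\<dots> = K * real N powr (1 - \<sigma>)"
      using N by (simp add: powr_diff powr_minus_divide)
    finally have a: "\<bar>of_int (u N) - real N\<bar> \<le> K * real N powr (1 - \<sigma>)" .
    have "\<bar>of_int (u N - u 0 - int N)\<bar> \<le> K * real N powr (1 - \<sigma>) + \<bar>real_of_int (u 0)\<bar>"
      using a by simp
    then have "\<bar>of_int (u N - u 0 - int N)\<bar> * real N powr (- \<beta>) \<le> (K * real N powr (1 - \<sigma>) + \<bar>of_int (u 0)\<bar>) * real N powr (- \<beta>)"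
      by (intro mult_right_mono) auto
    also have "\<dots> = K * (real N powr (1 - \<sigma>) * real N powr (- \<beta>)) + \<bar>of_int (u 0)\<bar> * real N powr (- \<beta>)"
      by (simp add: algebra_simps)
    also have "real N powr (1 - \<sigma>) * real N powr (- \<beta>) = real N powr (1 - \<sigma> - \<beta>)"
      by (simp flip: powr_add)
    finally show ?case by (simp add: powr_minus_divide)
  qed
  have "(\<lambda>N. K * real N powr (1 - \<sigma> - \<beta>) + \<bar>of_int (u 0)\<bar> * real N powr (- \<beta>)) \<longlonglongrightarrow> K * 0 + \<bar>of_int (u 0)\<bar> * 0"
    using sigma beta by (intro tendsto_intros tendsto_neg_powr filterlim_real_sequentially) auto
  then show ?thesis by (intro Lim_null_comparison[OF dom]) simp
qed

text \<open>A real supremum dominates its members only if the range is bounded above, which the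
  triangle inequality supplies.\<close>

lemma exponential_sum_le:
  fixes \<theta> :: "nat \<Rightarrow> real" and u :: "nat \<Rightarrow> int"
  assumes "(SUP \<alpha>'::real. cmod (\<Sum>k<N. of_real (\<theta> k) * exp (2 * \<i> * of_real pi * of_real \<alpha>' * of_int (u k)))) \<le> B"
  shows "cmod (\<Sum>k<N. of_real (\<theta> k) * cis (2 * pi * t * of_int (u k))) \<le> B"
proof -
  let ?S = "\<lambda>\<alpha>'::real. cmod (\<Sum>k<N. of_real (\<theta> k) * exp (2 * \<i> * of_real pi * of_real \<alpha>' * of_int (u k)))"
  have e: "exp (2 * \<i> * of_real pi * of_real s * of_int (u k)) = cis (2 * pi * s * of_int (u k))" for s k
    by (simp add: cis_conv_exp algebra_simps)
  have "?S s \<le> (\<Sum>k<N. \<bar>\<theta> k\<bar>)" for s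
    unfolding e by (rule order_trans[OF norm_sum]) (simp add: norm_mult)
  then have "bdd_above (range ?S)" by (auto intro!: bdd_aboveI)
  then have "?S t \<le> (SUP s. ?S s)" by (intro cSUP_upper) auto
  then show ?thesis using assms unfolding e by linarith
qed

text \<open>Consecutive partial sums differ by a term of modulus 1, so they cannot both tend to 0.
  This yields positivity of \<beta> in the theorem.\<close>

lemma exponential_sum_exponent_nonneg:
  fixes \<theta> :: "nat \<Rightarrow> real" and u :: "nat \<Rightarrow> int"
  assumes theta: "\<And>n. \<theta> n \<in> {-1, 1}"
    and bound: "\<And>N. N \<ge> 1 \<Longrightarrow> cmod (\<Sum>k<N. of_real (\<theta> k) * cis (2 * pi * t * of_int (u k))) \<le> C * real N powr \<delta>"
  shows "0 \<le> \<delta>"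
proof (rule ccontr)
  assume "\<not> 0 \<le> \<delta>"
  then have "(\<lambda>N. C * real N powr \<delta>) \<longlonglongrightarrow> C * 0"
    by (intro tendsto_intros tendsto_neg_powr filterlim_real_sequentially) auto
  then have ev: "eventually (\<lambda>N. C * real N powr \<delta> < 1 / 2) sequentially"
    by (intro order_tendstoD(2)) auto
  then obtain N where N: "\<And>n. N \<le> n \<Longrightarrow> C * real n powr \<delta> < 1 / 2" by (auto simp: eventually_sequentially)
  define n where "n = Suc N"
  let ?S = "\<lambda>n. \<Sum>k<n. of_real (\<theta> k) * cis (2 * pi * t * of_int (u k))"
  have "cmod (?S n) < 1 / 2" "cmod (?S (Suc n)) < 1 / 2"
    using bound[of n] bound[of "Suc n"] N[of n] N[of "Suc n"] by (simp_all add: n_def)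
  then have "cmod (?S (Suc n) - ?S n) < 1"
    using norm_triangle_ineq4[of "?S (Suc n)" "?S n"] by linarith
  moreover have "cmod (?S (Suc n) - ?S n) = 1" using theta[of n] by (auto simp: norm_mult)
  ultimately show False by simp
qed

section \<open>The central limit theorem for the cosine series\<close>

text \<open>The factor 8 makes up for the mean \<open>1 / 2\<close> of a squared cosine and for the factor \<open>1 / 2\<close> in
  \<open>(1 \<plusminus> \<theta>) / 2\<close>.\<close>

definition amplitude :: "real \<Rightarrow> nat \<Rightarrow> nat \<Rightarrow> real" where
  "amplitude g J0 j = (if j < J0 then 0 else sqrt (8 / limit_variance g * (mesh j powr g - mesh (Suc j) powr g)))"

lemma mesh_powr_diff_nonneg: "0 < g \<Longrightarrow> 0 \<le> mesh j powr g - mesh (Suc j) powr g"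
  using powr_mono2[of g "mesh (Suc j)" "mesh j"] mesh_antimono[of j "Suc j"] mesh_pos[of "Suc j"] by simp

lemma amplitude_nonneg: "0 < g \<Longrightarrow> g < 2 \<Longrightarrow> 0 \<le> amplitude g J0 j"
  using limit_variance_pos[of g] mesh_powr_diff_nonneg[of g j] by (auto simp: amplitude_def)

lemma amplitude_square:
  assumes "0 < g" "g < 2" "J0 \<le> j"
  shows "(amplitude g J0 j)\<^sup>2 = 8 / limit_variance g * (mesh j powr g - mesh (Suc j) powr g)"
  using assms limit_variance_pos[of g] mesh_powr_diff_nonneg[of g j] by (simp add: amplitude_def)

lemma amplitude_le:
  assumes g: "0 < g" "g < 2"
  shows "amplitude g J0 j \<le> sqrt (8 / limit_variance g) * exp (- (g / 2) * real j powr (3 / 4))"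
proof -
  have I: "0 < limit_variance g" by (rule limit_variance_pos[OF g])
  have "mesh j powr g - mesh (Suc j) powr g \<le> mesh j powr g" by simp
  also have "\<dots> = (exp (- (g / 2) * real j powr (3 / 4)))\<^sup>2"
    by (simp add: mesh_def powr_def exp_double[symmetric])
  finally have "sqrt (8 / limit_variance g * (mesh j powr g - mesh (Suc j) powr g))
      \<le> sqrt (8 / limit_variance g * (exp (- (g / 2) * real j powr (3 / 4)))\<^sup>2)"
    using I by (intro real_sqrt_le_mono mult_left_mono) auto
  also have "\<dots> = sqrt (8 / limit_variance g) * exp (- (g / 2) * real j powr (3 / 4))"
    unfolding real_sqrt_mult by simp
  finally show ?thesis using I by (auto simp: amplitude_def)
qed

lemma summable_inverse_square: "summable (\<lambda>j. norm (1 / real j ^ 2))"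
  using inverse_power_summable[of 2, where 'a = real] by (simp add: inverse_eq_divide)

lemma summable_amplitude:
  assumes g: "0 < g" "g < 2"
  shows "summable (\<lambda>j. \<bar>amplitude g J0 j\<bar>)"
proof -
  have "(\<lambda>j. sqrt (8 / limit_variance g) * exp (- (g / 2) * real j powr (3 / 4))) \<in> O(\<lambda>j. 1 / real j ^ 2)"
  proof -
    define p where "p = g / 2"
    have "0 < p" using g by (simp add: p_def)
    then have "(\<lambda>j::nat. exp (- p * real j powr (3 / 4))) \<in> O(\<lambda>j. 1 / real j ^ 2)" by real_asymp
    then show ?thesis unfolding p_def by simp
  qed
  then have "summable (\<lambda>j. sqrt (8 / limit_variance g) * exp (- (g / 2) * real j powr (3 / 4)))"
    by (rule summable_comparison_test_bigo[OF summable_inverse_square])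
  then show ?thesis
    by (rule summable_comparison_test[rotated]) (use amplitude_le[OF g] amplitude_nonneg[OF g] in auto)
qed

lemma continuous_translate_circle: "continuous_on UNIV (\<lambda>x::circle. x + c)"
proof -
  have "dist (x + c) (y + c) = dist x y" for x y :: circle
    by transfer simp
  then show ?thesis unfolding continuous_on_iff by auto
qed

lemma measurable_normalized_sum:
  assumes f: "continuous_on UNIV f"
  shows "normalized_sum w u \<alpha> \<beta> f N \<in> borel_measurable borel"
proof -
  have "continuous_on UNIV (\<lambda>x. f (x + c))" for c
    using continuous_on_compose2[OF f continuous_translate_circle] by simp
  then have [measurable]: "(\<lambda>x. f (x + c)) \<in> borel_measurable borel" for c
    by (rule borel_measurable_continuous_onI)
  show ?thesis unfolding normalized_sum_def int_iterate_rotation by measurable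
qed

text \<open>The bound on exponential sums is uniform in the frequency, so it holds at every
  \<open>m j * \<alpha>\<close> and can be summed against \<open>\<bar>a j\<bar>\<close>.\<close>

lemma sum_theta_cos_series_le:
  fixes \<theta> :: "nat \<Rightarrow> real" and u :: "nat \<Rightarrow> int"
  assumes sm: "summable (\<lambda>j. \<bar>a j\<bar>)"
    and bound: "\<And>t. cmod (\<Sum>k<N. of_real (\<theta> k) * cis (2 * pi * t * of_int (u k))) \<le> K"
  shows "\<bar>\<Sum>k<N. \<theta> k * cos_series a m (to_circle (x + of_int (u k) * \<alpha>))\<bar> \<le> (\<Sum>j. \<bar>a j\<bar>) * K"
proof -
  let ?c = "\<lambda>j k. cos (2 * pi * of_int (m j) * (x + of_int (u k) * \<alpha>))"
  have cs: "summable (\<lambda>j. \<theta> k * (a j * ?c j k))" for k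
    by (intro summable_mult summable_mult_cos sm)
  have "(\<Sum>k<N. \<theta> k * cos_series a m (to_circle (x + of_int (u k) * \<alpha>))) = (\<Sum>k<N. \<Sum>j. \<theta> k * (a j * ?c j k))"
    unfolding cos_series_to_circle by (intro sum.cong refl suminf_mult[symmetric] summable_mult_cos sm)
  also have "\<dots> = (\<Sum>j. \<Sum>k<N. \<theta> k * (a j * ?c j k))"
    by (rule suminf_sum[symmetric]) (rule cs)
  finally have eq: "(\<Sum>k<N. \<theta> k * cos_series a m (to_circle (x + of_int (u k) * \<alpha>))) = (\<Sum>j. \<Sum>k<N. \<theta> k * (a j * ?c j k))" .
  have summand: "\<bar>\<Sum>k<N. \<theta> k * (a j * ?c j k)\<bar> \<le> \<bar>a j\<bar> * K" for j
  proof -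
    let ?z = "cis (2 * pi * of_int (m j) * x) * (\<Sum>k<N. of_real (\<theta> k) * cis (2 * pi * (of_int (m j) * \<alpha>) * of_int (u k)))"
    have "?z = (\<Sum>k<N. of_real (\<theta> k) * cis (2 * pi * of_int (m j) * (x + of_int (u k) * \<alpha>)))"
      unfolding sum_distrib_left by (intro sum.cong refl) (simp add: cis_mult algebra_simps)
    then have "Re ?z = (\<Sum>k<N. \<theta> k * ?c j k)" by simp
    moreover have "\<bar>Re ?z\<bar> \<le> K"
      using abs_Re_le_cmod[of ?z] bound[of "of_int (m j) * \<alpha>"] by (simp only: norm_mult norm_cis mult_1)
    moreover have "(\<Sum>k<N. \<theta> k * (a j * ?c j k)) = a j * (\<Sum>k<N. \<theta> k * ?c j k)"
      by (simp add: sum_distrib_left mult_ac)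
    ultimately show ?thesis by (simp only: abs_mult) (intro mult_left_mono, auto)
  qed
  have s1: "summable (\<lambda>j. \<bar>a j\<bar> * K)" using sm by (rule summable_mult2)
  have s2: "summable (\<lambda>j. \<bar>\<Sum>k<N. \<theta> k * (a j * ?c j k)\<bar>)"
    by (rule summable_comparison_test[OF _ s1]) (use summand in auto)
  have "\<bar>\<Sum>j. \<Sum>k<N. \<theta> k * (a j * ?c j k)\<bar> \<le> (\<Sum>j. \<bar>\<Sum>k<N. \<theta> k * (a j * ?c j k)\<bar>)" by (rule summable_rabs[OF s2])
  also have "\<dots> \<le> (\<Sum>j. \<bar>a j\<bar> * K)" by (rule suminf_le[OF summand s2 s1])
  also have "\<dots> = (\<Sum>j. \<bar>a j\<bar>) * K" by (rule suminf_mult2[OF sm, symmetric])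
  finally show ?thesis unfolding eq .
qed

lemma birkhoff_sum_cos_series:
  assumes sm: "summable (\<lambda>j. \<bar>a j\<bar>)"
    and nz: "\<And>j. a j \<noteq> 0 \<Longrightarrow> sin (pi * (of_int (m j) * \<alpha>)) \<noteq> 0"
  shows "(\<Sum>k<N. cos_series a m (to_circle (x + of_int (n + int k) * \<alpha>))) =
    (\<Sum>j. a j * dirichlet_kernel N (of_int (m j) * \<alpha>) *
       cos (2 * pi * of_int (m j) * x + (2 * pi * of_int (m j) * of_int n * \<alpha> + pi * (real N - 1) * (of_int (m j) * \<alpha>))))"
proof -
  have "(\<Sum>k<N. cos_series a m (to_circle (x + of_int (n + int k) * \<alpha>)))
     = (\<Sum>j. \<Sum>k<N. a j * cos (2 * pi * of_int (m j) * (x + of_int (n + int k) * \<alpha>)))"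
    unfolding cos_series_to_circle by (rule suminf_sum[symmetric]) (intro summable_mult_cos sm)
  also have "\<dots> = (\<Sum>j. a j * dirichlet_kernel N (of_int (m j) * \<alpha>) *
       cos (2 * pi * of_int (m j) * x + (2 * pi * of_int (m j) * of_int n * \<alpha> + pi * (real N - 1) * (of_int (m j) * \<alpha>))))"
  proof (intro suminf_cong)
    fix j
    define y where "y = 2 * pi * of_int (m j) * x + 2 * pi * of_int (m j) * of_int n * \<alpha>"
    have "(\<Sum>k<N. a j * cos (2 * pi * of_int (m j) * (x + of_int (n + int k) * \<alpha>)))
       = a j * (\<Sum>k<N. cos (y + 2 * pi * (real k * (of_int (m j) * \<alpha>))))"
      unfolding sum_distrib_left by (intro sum.cong refl arg_cong[where f = "\<lambda>z. a j * cos z"]) (simp add: y_def algebra_simps)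
    also have "\<dots> = a j * (dirichlet_kernel N (of_int (m j) * \<alpha>) * cos (y + pi * (real N - 1) * (of_int (m j) * \<alpha>)))"
      by (cases "a j = 0") (auto simp: sum_cos_progression nz)
    finally show "(\<Sum>k<N. a j * cos (2 * pi * of_int (m j) * (x + of_int (n + int k) * \<alpha>))) =
       a j * dirichlet_kernel N (of_int (m j) * \<alpha>) *
       cos (2 * pi * of_int (m j) * x + (2 * pi * of_int (m j) * of_int n * \<alpha> + pi * (real N - 1) * (of_int (m j) * \<alpha>)))"
      by (simp add: y_def add.assoc mult.assoc)
  qed
  finally show ?thesis .
qed

text \<open>The constant part 1/2 of the weight carries the limit. The part with \<theta> and the
  integers omitted by the sequence go into the error \<open>e N\<close>, uniformly in the
  point.\<close>

lemma clt_cos_series: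
  fixes \<theta> :: "nat \<Rightarrow> real" and u m z :: "nat \<Rightarrow> int" and \<delta> C \<alpha> \<beta> s :: real and \<tau> :: "nat \<Rightarrow> real"
  assumes u: "strict_mono u"
    and bound: "\<And>N t. N \<ge> 1 \<Longrightarrow> cmod (\<Sum>k<N. of_real (\<theta> k) * cis (2 * pi * t * of_int (u k))) \<le> C * real N powr \<delta>"
    and beta: "\<delta> < \<beta>" "0 < \<beta>" "\<beta> < 1"
    and omit: "(\<lambda>N. of_int (u N - u 0 - int N) / real N powr \<beta>) \<longlonglongrightarrow> 0"
    and s: "\<bar>s\<bar> \<le> 1"
    and pos: "\<And>j. 0 < m j" and inj: "inj m" and avoid: "\<And>j. m j \<notin> signed_sums m (predecessors j)"
    and tau: "\<And>j. mesh (Suc j) \<le> \<tau> j" "\<And>j. \<tau> j \<le> mesh j" "\<And>j. of_int (m j) * \<alpha> = \<tau> j + of_int (z j)"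
    and J0: "1 \<le> J0"
  shows "converges_in_law_std_normal circle_measure
     (normalized_sum (\<lambda>k. (1 + s * \<theta> k) / 2) u \<alpha> \<beta> (cos_series (amplitude (2 - 2 * \<beta>) J0) m))"
proof -
  define g where "g = 2 - 2 * \<beta>"
  have g: "0 < g" "g < 2" using beta by (auto simp: g_def)
  define a where "a = amplitude g J0"
  define f where "f = cos_series a m"
  define B where "B = (\<Sum>j. \<bar>a j\<bar>)"
  have sm: "summable (\<lambda>j. \<bar>a j\<bar>)" unfolding a_def by (rule summable_amplitude[OF g])
  have cf: "continuous_on UNIV f" unfolding f_def by (rule continuous_cos_series[OF sm])
  have B0: "0 \<le> B" unfolding B_def by (rule suminf_nonneg[OF sm]) simp
  have fB: "\<bar>f c\<bar> \<le> B" for c unfolding f_def B_def by (rule abs_cos_series_le[OF sm])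
  define w where "w k = (1 + s * \<theta> k) / 2" for k
  define S where "S = normalized_sum w u \<alpha> \<beta> f"
  define Z where "Z N x = S N (to_circle x)" for N x
  have Sm: "S N \<in> borel_measurable borel" for N
    unfolding S_def by (rule measurable_normalized_sum[OF cf])
  have Zm: "Z N \<in> borel_measurable borel" for N
    unfolding Z_def using measurable_compose[OF measurable_to_circle Sm] by simp
  define b where "b N j = 1 / real N powr \<beta> / 2 * (a j * dirichlet_kernel N (of_int (m j) * \<alpha>))" for N j
  define \<phi> where "\<phi> N j = 2 * pi * of_int (m j) * of_int (u 0) * \<alpha> + pi * (real N - 1) * (of_int (m j) * \<alpha>)" for N j
  define e where "e N = B * (of_int (u N - u 0 - int N) / real N powr \<beta>) + B * C / 2 * real N powr (\<delta> - \<beta>)" for N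
  have nz: "sin (pi * (of_int (m j) * \<alpha>)) \<noteq> 0" if "a j \<noteq> 0" for j
  proof -
    \<comment> \<open>\<open>mesh 0 = 1\<close> exceeds 1/2, so the lower bound for the sine starts
      at index 1; hence \<open>1 \<le> J0\<close>.\<close>
    have j: "1 \<le> j" using that J0 by (auto simp: a_def amplitude_def split: if_splits)
    have t: "0 < \<tau> j" "\<tau> j \<le> 1 / 2" using tau(1,2)[of j] mesh_pos[of "Suc j"] mesh_le_half[OF j] by linarith+
    then have "0 < sin (pi * \<tau> j)" using sin_pi_ge[of "\<tau> j"] by linarith
    moreover have "(sin (pi * (of_int (m j) * \<alpha>)))\<^sup>2 = (sin (pi * \<tau> j))\<^sup>2"
      unfolding tau(3) using sin_square_add_pi[of "pi * \<tau> j" "z j"] by (simp add: distrib_left)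
    ultimately show ?thesis by auto
  qed
  have sb: "summable (\<lambda>j. \<bar>b N j\<bar>)" for N
  proof (rule summable_comparison_test[OF _ summable_mult[OF sm, of "1 / real N powr \<beta> / 2 * real N"]], intro exI allI impI)
    fix j
    have "\<bar>a j * dirichlet_kernel N (of_int (m j) * \<alpha>)\<bar> \<le> real N * \<bar>a j\<bar>"
      unfolding abs_mult mult.commute[of "real N"] by (intro mult_left_mono dirichlet_kernel_le) auto
    then have "1 / real N powr \<beta> / 2 * \<bar>a j * dirichlet_kernel N (of_int (m j) * \<alpha>)\<bar> \<le> 1 / real N powr \<beta> / 2 * (real N * \<bar>a j\<bar>)"
      by (intro mult_left_mono) auto
    then show "norm \<bar>b N j\<bar> \<le> 1 / real N powr \<beta> / 2 * real N * \<bar>a j\<bar>"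
      unfolding b_def by (simp add: abs_mult mult.assoc)
  qed
  have Zapprox: "\<bar>Z N x - (\<Sum>j. b N j * cos (2 * pi * of_int (m j) * x + \<phi> N j))\<bar> \<le> e N" if N: "0 < N" for N x
  proof -
    define h where "h n = f (to_circle (x + of_int n * \<alpha>))" for n :: int
    define P where "P = 1 / real N powr \<beta>"
    have P: "0 < P" using N by (simp add: P_def)
    have Zh: "Z N x = P * (\<Sum>k<N. w k * h (u k))"
      by (simp add: Z_def S_def normalized_sum_def int_iterate_rotation h_def P_def plus_circle.abs_eq)
    have wh: "(\<Sum>k<N. w k * h (u k)) = (\<Sum>k<N. h (u k)) / 2 + s / 2 * (\<Sum>k<N. \<theta> k * h (u k))"
      by (simp add: w_def sum_divide_distrib sum_distrib_left sum.distrib[symmetric] add_divide_distrib distrib_right mult.assoc)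
    let ?t = "\<lambda>j. a j * dirichlet_kernel N (of_int (m j) * \<alpha>) * cos (2 * pi * of_int (m j) * x + \<phi> N j)"
    have main: "(\<Sum>j. b N j * cos (2 * pi * of_int (m j) * x + \<phi> N j)) = P / 2 * (\<Sum>k<N. h (u 0 + int k))"
    proof -
      have "(\<Sum>k<N. h (u 0 + int k)) = (\<Sum>j. ?t j)"
        unfolding h_def f_def \<phi>_def by (rule birkhoff_sum_cos_series[OF sm nz])
      moreover have "(\<Sum>j. b N j * cos (2 * pi * of_int (m j) * x + \<phi> N j)) = P / 2 * (\<Sum>j. ?t j)"
      proof -
        have bt: "b N j * cos (2 * pi * of_int (m j) * x + \<phi> N j) = P / 2 * ?t j" for j
          by (simp add: b_def P_def)
        have "summable (\<lambda>j. b N j * cos (2 * pi * of_int (m j) * x + \<phi> N j))" by (rule summable_mult_cos(1)[OF sb])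
        then have "summable (\<lambda>j. P / 2 * ?t j)" by (simp only: bt)
        then have "summable ?t" using P by (subst (asm) summable_cmult_iff) auto
        from suminf_mult[OF this, of "P / 2"] show ?thesis by (simp only: bt)
      qed
      ultimately show ?thesis by simp
    qed
    have "\<bar>(\<Sum>k<N. h (u k)) - (\<Sum>k<N. h (u 0 + int k))\<bar> \<le> 2 * B * of_int (u N - u 0 - int N)"
      by (rule sum_strict_mono_vs_interval[OF u]) (simp add: h_def fB)
    then have 1: "\<bar>((\<Sum>k<N. h (u k)) - (\<Sum>k<N. h (u 0 + int k))) / 2\<bar> \<le> B * of_int (u N - u 0 - int N)"
      by simp
    have 2: "\<bar>\<Sum>k<N. \<theta> k * h (u k)\<bar> \<le> B * (C * real N powr \<delta>)"
      unfolding h_def f_def B_def using N by (intro sum_theta_cos_series_le sm bound) auto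
    have 3: "\<bar>s / 2 * (\<Sum>k<N. \<theta> k * h (u k))\<bar> \<le> B * (C * real N powr \<delta>) / 2"
    proof -
      have "\<bar>s\<bar> * \<bar>\<Sum>k<N. \<theta> k * h (u k)\<bar> \<le> 1 * (B * (C * real N powr \<delta>))"
        using s 2 by (intro mult_mono) auto
      then show ?thesis by (simp add: abs_mult)
    qed
    have "Z N x - (\<Sum>j. b N j * cos (2 * pi * of_int (m j) * x + \<phi> N j)) =
       P * (((\<Sum>k<N. h (u k)) - (\<Sum>k<N. h (u 0 + int k))) / 2 + s / 2 * (\<Sum>k<N. \<theta> k * h (u k)))"
      unfolding Zh main wh by (simp add: algebra_simps add_divide_distrib diff_divide_distrib)
    also have "\<bar>\<dots>\<bar> = P * \<bar>((\<Sum>k<N. h (u k)) - (\<Sum>k<N. h (u 0 + int k))) / 2 + s / 2 * (\<Sum>k<N. \<theta> k * h (u k))\<bar>"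
      using P by (simp add: abs_mult)
    also have "\<dots> \<le> P * (B * of_int (u N - u 0 - int N) + B * (C * real N powr \<delta>) / 2)"
      using P by (intro mult_left_mono order_trans[OF abs_triangle_ineq add_mono[OF 1 3]]) auto
    also have "\<dots> = e N"
      unfolding e_def P_def using N by (simp add: powr_diff field_simps)
    finally show ?thesis .
  qed
  have elim0: "e \<longlonglongrightarrow> 0"
  proof -
    have "e \<longlonglongrightarrow> B * 0 + B * C / 2 * 0"
      unfolding e_def using beta by (intro tendsto_intros omit tendsto_neg_powr filterlim_real_sequentially) auto
    then show ?thesis by simp
  qed
  have b2: "(b N j)\<^sup>2 = 2 / limit_variance g * ((dirichlet_kernel N (\<tau> j) / real N)\<^sup>2 * ((real N * mesh j) powr g - (real N * mesh (Suc j)) powr g))"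
    if N: "0 < N" and j: "J0 \<le> j" for N j
  proof -
    have D: "(dirichlet_kernel N (of_int (m j) * \<alpha>))\<^sup>2 = (dirichlet_kernel N (\<tau> j))\<^sup>2"
      unfolding tau(3) by (rule dirichlet_kernel_add_int)
    \<comment> \<open>The choice \<open>g = 2 - 2 * \<beta>\<close> turns the squared normalisation
      into \<open>N powr g / N\<^sup>2\<close>: one factor rescales the mesh, the other the
      kernel.\<close>
    have "real N powr g = (real N)\<^sup>2 * (1 / real N powr \<beta>)\<^sup>2"
      using N by (simp add: g_def powr_diff power_divide powr_power powr_numeral mult.commute)
    then have Ng: "(1 / real N powr \<beta>)\<^sup>2 = real N powr g / (real N)\<^sup>2" using N by simp
    have sq: "(amplitude g J0 j)\<^sup>2 = 8 / limit_variance g * (mesh j powr g - mesh (Suc j) powr g)"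
      by (rule amplitude_square[OF g j])
    have pm: "(real N * mesh j) powr g - (real N * mesh (Suc j)) powr g = real N powr g * (mesh j powr g - mesh (Suc j) powr g)"
      by (simp add: powr_mult right_diff_distrib)
    have "(b N j)\<^sup>2 = (1 / real N powr \<beta>)\<^sup>2 / 4 * ((a j)\<^sup>2 * (dirichlet_kernel N (\<tau> j))\<^sup>2)"
      unfolding b_def power_mult_distrib D by (simp add: power_divide)
    also have "\<dots> = 2 / limit_variance g * ((dirichlet_kernel N (\<tau> j) / real N)\<^sup>2 * ((real N * mesh j) powr g - (real N * mesh (Suc j)) powr g))"
    proof -
      have "A / n / 4 * (8 / I * q * d) = 2 / I * (d / n * (A * q))" for A n I q d :: real by (simp add: mult_ac)
      then show ?thesis unfolding pm power_divide[of "dirichlet_kernel N (\<tau> j)"] Ng a_def sq .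
    qed
    finally show ?thesis .
  qed
  have char: "(\<lambda>N. \<integral>x. exp (\<i> * of_real (t * Z N x)) \<partial>unit_interval_measure) \<longlonglongrightarrow> of_real (exp (- t\<^sup>2 / 2))" for t
  proof (rule char_cos_series_tendsto[OF pos inj avoid g _ _ tau(1,2) J0 _ b2 sb Zm Zapprox elim0])
    show "0 \<le> 2 / limit_variance g" "2 / limit_variance g * limit_variance g = 2"
      using limit_variance_pos[OF g] by auto
    show "b N j = 0" if "j < J0" for N j using that by (simp add: b_def a_def amplitude_def)
  qed
  have "converges_in_law_std_normal circle_measure S"
  proof (rule converges_in_law_std_normal_of_char[OF prob_space_circle_measure])
    show "S N \<in> borel_measurable circle_measure" for N
      using Sm by (simp cong: measurable_cong_sets add: sets_circle_measure)
    fix t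
    have "(\<integral>c. exp (\<i> * of_real (t * S N c)) \<partial>circle_measure) = (\<integral>x. exp (\<i> * of_real (t * Z N x)) \<partial>unit_interval_measure)" for N
      unfolding Z_def using Sm[of N] by (intro integral_circle_measure) auto
    then show "(\<lambda>N. \<integral>c. exp (\<i> * of_real (t * S N c)) \<partial>circle_measure) \<longlonglongrightarrow> of_real (exp (- t\<^sup>2 / 2))"
      using char[of t] by simp
  qed
  then show ?thesis by (simp add: S_def f_def a_def g_def w_def[abs_def])
qed

section \<open>Hoelder regularity and the theorem\<close>

lemma card_predecessors_le: "real (card (predecessors j)) \<le> sqrt (real j)"
proof -
  have "(\<lambda>i. j - i) ` predecessors j \<subseteq> {1..nat \<lfloor>sqrt (real j)\<rfloor>}"
  proof
    fix n assume "n \<in> (\<lambda>i. j - i) ` predecessors j"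
    then have n: "1 \<le> n" "n\<^sup>2 \<le> j" by (auto simp: predecessors_def)
    have "(real n)\<^sup>2 \<le> real j" using n(2) by (metis of_nat_le_iff of_nat_power)
    then have "real n \<le> sqrt (real j)" by (rule real_le_rsqrt)
    then show "n \<in> {1..nat \<lfloor>sqrt (real j)\<rfloor>}" using n by (simp add: le_nat_floor)
  qed
  then have "card ((\<lambda>i. j - i) ` predecessors j) \<le> card {1..nat \<lfloor>sqrt (real j)\<rfloor>}"
    by (intro card_mono) auto
  moreover have "inj_on (\<lambda>i. j - i) (predecessors j)"
    by (auto simp: inj_on_def predecessors_def)
  ultimately have "card (predecessors j) \<le> nat \<lfloor>sqrt (real j)\<rfloor>" by (simp add: card_image)
  then show ?thesis by (simp add: le_nat_iff le_floor_iff)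
qed

lemma frequencies_of_hits:
  assumes "\<And>j. hits \<alpha> (mesh j - mesh (Suc j)) (G j)"
  obtains m z :: "nat \<Rightarrow> int" and \<tau> :: "nat \<Rightarrow> real" where
    "\<And>j. 0 < m j" "inj m" "\<And>j. m j \<notin> signed_sums m (predecessors j)"
    "\<And>j. mesh (Suc j) \<le> \<tau> j" "\<And>j. \<tau> j \<le> mesh j" "\<And>j. of_int (m j) * \<alpha> = \<tau> j + of_int (z j)"
    "\<And>j. m j \<le> (3 ^ card (predecessors j) + int j + 1) * int (G j)"
proof -
  have "predecessors j \<subseteq> {..<j}" for j by (auto simp: predecessors_def)
  then obtain m :: "nat \<Rightarrow> int" where m: "\<And>j. 0 < m j"
      "\<And>j. m j \<le> (3 ^ card (predecessors j) + int j + 1) * int (G j)" "inj m"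
      "\<And>j. m j \<notin> signed_sums m (predecessors j)"
      "\<And>j. \<exists>z::int. mesh (Suc j) \<le> of_int (m j) * \<alpha> - of_int z \<and>
          of_int (m j) * \<alpha> - of_int z \<le> mesh (Suc j) + (mesh j - mesh (Suc j))"
    by (rule greedy_frequencies[where L = "\<lambda>j. mesh j - mesh (Suc j)" and G = G and P = predecessors
           and s = "\<lambda>j. mesh (Suc j)", OF assms]) blast
  from m(5) obtain z :: "nat \<Rightarrow> int" where z: "\<And>j. mesh (Suc j) \<le> of_int (m j) * \<alpha> - of_int (z j)"
     "\<And>j. of_int (m j) * \<alpha> - of_int (z j) \<le> mesh (Suc j) + (mesh j - mesh (Suc j))" by metis
  show thesis
    by (rule that[of m "\<lambda>j. of_int (m j) * \<alpha> - of_int (z j)" z]) (use m(1-4) z in \<open>auto simp: algebra_simps\<close>)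
qed

text \<open>Up to factors \<open>exp (c1 * sqrt j)\<close> and powers of \<open>j\<close>, the
  frequency is at most of order \<open>mesh j powr (- D)\<close>, while the amplitude is at most of
  order \<open>mesh j powr (g / 2)\<close>. So \<open>\<gamma> * D < g / 2\<close> leaves the decay
  \<open>exp (- \<rho> * j powr (3 / 4))\<close>.\<close>

lemma summable_hoelder_weights:
  fixes m :: "nat \<Rightarrow> int" and g \<gamma> D K :: real
  assumes g: "0 < g" "g < 2" and \<gamma>: "0 < \<gamma>" and D: "0 < D" "\<gamma> * D < g / 2" and K: "0 < K"
    and G: "\<And>j. real (G j) \<le> K * (mesh j - mesh (Suc j)) powr (- D)"
    and pos: "\<And>j. 0 < m j" and m: "\<And>j. m j \<le> (3 ^ card (predecessors j) + int j + 1) * int (G j)"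
  shows "summable (\<lambda>j. \<bar>amplitude g J0 j\<bar> * (2 * (pi * of_int (m j)) powr \<gamma>))"
proof -
  define \<rho> where "\<rho> = g / 2 - \<gamma> * D"
  define c1 where "c1 = 2 * \<gamma>"
  define c2 where "c2 = \<gamma> * (D + 1)"
  define A where "A = sqrt (8 / limit_variance g) * (2 * (4 * K) powr \<gamma>)"
  have pars: "0 < \<rho>" "0 < c1" "0 < c2" using D \<gamma> by (auto simp: \<rho>_def c1_def c2_def)
  have "(\<lambda>j::nat. exp (- \<rho> * real j powr (3 / 4) + c1 * sqrt (real j)) * (real j + 2) powr c2) \<in> O(\<lambda>j. 1 / real j ^ 2)"
    using pars by real_asymp
  then have "summable (\<lambda>j::nat. exp (- \<rho> * real j powr (3 / 4) + c1 * sqrt (real j)) * (real j + 2) powr c2)"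
    by (rule summable_comparison_test_bigo[OF summable_inverse_square])
  then have dom: "summable (\<lambda>j::nat. A * (exp (- \<rho> * real j powr (3 / 4) + c1 * sqrt (real j)) * (real j + 2) powr c2))"
    by (rule summable_mult)
  \<comment> \<open>The relative gap has order \<open>j powr (- (1 / 4))\<close>; the weaker bound
    \<open>1 / (j + 2)\<close> costs only a power of \<open>j\<close>.\<close>
  have gap: "eventually (\<lambda>j. mesh j / (real j + 2) \<le> mesh j - mesh (Suc j)) sequentially"
  proof -
    have "eventually (\<lambda>j::nat. 1 / (real j + 2) \<le> 1 - exp (real j powr (3 / 4) - real (Suc j) powr (3 / 4))) sequentially"
      by real_asymp
    then show ?thesis
    proof eventually_elim
      case (elim j)
      have "mesh (Suc j) = mesh j * exp (real j powr (3 / 4) - real (Suc j) powr (3 / 4))"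
        by (simp add: mesh_def flip: exp_add)
      then have "mesh j - mesh (Suc j) = mesh j * (1 - exp (real j powr (3 / 4) - real (Suc j) powr (3 / 4)))"
        by (simp add: right_diff_distrib)
      then show ?case using mult_left_mono[OF elim, of "mesh j"] mesh_pos[of j] by simp
    qed
  qed
  have "eventually (\<lambda>j. norm (\<bar>amplitude g J0 j\<bar> * (2 * (pi * of_int (m j)) powr \<gamma>)) \<le>
     A * (exp (- \<rho> * real j powr (3 / 4) + c1 * sqrt (real j)) * (real j + 2) powr c2)) sequentially"
    using gap
  proof eventually_elim
    case (elim j)
    define x where "x = real j powr (3 / 4)"
    define y where "y = real j + 2"
    have y: "0 < y" by (simp add: y_def)
    have mp: "0 < mesh j / y" using mesh_pos y by simp
    have "real (G j) \<le> K * (mesh j - mesh (Suc j)) powr (- D)" by (rule G)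
    also have "\<dots> \<le> K * (mesh j / y) powr (- D)"
      using K D mp elim by (intro mult_left_mono powr_mono2') (auto simp: y_def)
    also have "(mesh j / y) powr (- D) = exp (D * x) * y powr D"
    proof -
      have eq: "mesh j powr (- D) = exp (D * x)" by (simp add: mesh_def powr_def x_def)
      show ?thesis unfolding powr_divide eq by (simp add: powr_minus_divide)
    qed
    finally have Gj: "real (G j) \<le> K * (exp (D * x) * y powr D)" .
    have "(3::real) \<le> exp 2" using exp_ge_add_one_self[of "2::real"] by (simp del: exp_ge_add_one_self)
    then have "(3::real) ^ card (predecessors j) \<le> exp 2 ^ card (predecessors j)" by (rule power_mono) simp
    also have "\<dots> = exp (2 * real (card (predecessors j)))" by (metis exp_of_nat_mult mult.commute)
    also have "\<dots> \<le> exp (2 * sqrt (real j))" using card_predecessors_le[of j] by simp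
    finally have 3: "(3::real) ^ card (predecessors j) \<le> exp (2 * sqrt (real j))" .
    have "(3::real) ^ card (predecessors j) + real j + 1 \<le> exp (2 * sqrt (real j)) + (real j + 1) * exp (2 * sqrt (real j))"
    proof -
      have "(real j + 1) * 1 \<le> (real j + 1) * exp (2 * sqrt (real j))" by (intro mult_left_mono) auto
      from add_mono[OF 3 this] show ?thesis by (simp add: add.assoc)
    qed
    also have "\<dots> = exp (2 * sqrt (real j)) * y" by (simp add: y_def algebra_simps)
    finally have fac: "(3::real) ^ card (predecessors j) + real j + 1 \<le> exp (2 * sqrt (real j)) * y" .
    have "real_of_int (m j) \<le> real_of_int ((3 ^ card (predecessors j) + int j + 1) * int (G j))"
      using m[of j] by (simp only: of_int_le_iff)
    also have "\<dots> = ((3::real) ^ card (predecessors j) + real j + 1) * real (G j)" by simp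
    also have "\<dots> \<le> (exp (2 * sqrt (real j)) * y) * (K * (exp (D * x) * y powr D))"
      using fac Gj y by (intro mult_mono) auto
    finally have "pi * of_int (m j) \<le> 4 * ((exp (2 * sqrt (real j)) * y) * (K * (exp (D * x) * y powr D)))"
      using pos[of j] pi_less_4 by (intro mult_mono) auto
    also have "\<dots> = (4 * K) * (exp (2 * sqrt (real j) + D * x) * y powr (D + 1))"
      using y by (simp add: exp_add powr_add mult_ac)
    finally have "(pi * of_int (m j)) powr \<gamma> \<le> ((4 * K) * (exp (2 * sqrt (real j) + D * x) * y powr (D + 1))) powr \<gamma>"
      using pos[of j] \<gamma> by (intro powr_mono2) (simp_all add: less_imp_le)
    also have "\<dots> = (4 * K) powr \<gamma> * (exp (\<gamma> * (2 * sqrt (real j) + D * x)) * y powr c2)"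
      by (simp add: powr_mult powr_powr exp_powr_real c2_def mult.commute)
    finally have P: "(pi * of_int (m j)) powr \<gamma> \<le> (4 * K) powr \<gamma> * (exp (\<gamma> * (2 * sqrt (real j) + D * x)) * y powr c2)" .
    have "\<bar>amplitude g J0 j\<bar> * (2 * (pi * of_int (m j)) powr \<gamma>) \<le>
       (sqrt (8 / limit_variance g) * exp (- (g / 2) * x)) * (2 * ((4 * K) powr \<gamma> * (exp (\<gamma> * (2 * sqrt (real j) + D * x)) * y powr c2)))"
      using P amplitude_le[OF g, of J0 j] amplitude_nonneg[OF g, of J0 j] limit_variance_pos[OF g]
      unfolding x_def by (intro mult_mono) auto
    also have "\<dots> = A * ((exp (- (g / 2) * x) * exp (\<gamma> * (2 * sqrt (real j) + D * x))) * y powr c2)"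
      by (simp add: A_def)
    also have "exp (- (g / 2) * x) * exp (\<gamma> * (2 * sqrt (real j) + D * x)) = exp (- \<rho> * x + c1 * sqrt (real j))"
      by (simp add: \<rho>_def c1_def algebra_simps flip: exp_add)
    finally show ?case by (simp add: x_def y_def)
  qed
  then show ?thesis by (rule summable_comparison_test_ev[OF _ dom])
qed

text \<open>Any \<open>D\<close> strictly between the type and \<open>p / a\<close> works: it is not
  among the exponents with vanishing \<open>liminf\<close>, so the lower bound holds for large
  \<open>n\<close>, and a minimum over the finitely many remaining \<open>n\<close> adjusts the
  constant.\<close>

lemma diophantine_type_lower_bound:
  assumes irr: "\<alpha> \<notin> \<rat>" and a: "0 < a" and lt: "ereal a < ereal p / diophantine_type \<alpha>"
  obtains c D where "0 < c" "0 < D" "a * D < p" "\<And>n. n \<ge> 1 \<Longrightarrow> c * real n powr (- D) \<le> nint_dist (real n * \<alpha>)"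
proof -
  define S where "S = {ereal \<eta> | \<eta>. \<eta> > 0 \<and> liminf (\<lambda>n. ereal (real n powr \<eta> * nint_dist (real n * \<alpha>))) = 0}"
  have dS: "diophantine_type \<alpha> = Sup S" by (simp add: diophantine_type_def S_def)
  \<comment> \<open>An infinite type would make the quotient 0, contrary to
    \<open>0 < a\<close>.\<close>
  obtain r where r: "diophantine_type \<alpha> = ereal r"
    using lt a by (cases "diophantine_type \<alpha>") auto
  have "S \<noteq> {}" using r dS by (auto simp: bot_ereal_def)
  then obtain \<eta> where eta: "ereal \<eta> \<in> S" "\<eta> > 0" by (auto simp: S_def)
  have "ereal \<eta> \<le> ereal r" using Sup_upper[OF eta(1)] unfolding dS[symmetric] r .
  then have r0: "0 < r" using eta by simp
  have ap: "a < p / r" using lt r r0 by simp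
  define q where "q = p / a"
  have rq: "r < q" using ap a r0 by (simp add: q_def field_simps)
  define D where "D = (r + q) / 2"
  have D: "r < D" using rq by (simp add: D_def)
  have D0: "0 < D" using D r0 by simp
  have "D < q" using rq by (simp add: D_def)
  then have aD: "a * D < p" using a by (simp add: q_def field_simps)
  let ?x = "\<lambda>n. real n powr D * nint_dist (real n * \<alpha>)"
  have "ereal D \<notin> S"
  proof
    assume "ereal D \<in> S"
    from Sup_upper[OF this] have "ereal D \<le> ereal r" unfolding dS[symmetric] r .
    then show False using D by simp
  qed
  then have "liminf (\<lambda>n. ereal (?x n)) \<noteq> 0" using D0 by (auto simp: S_def)
  moreover have "0 \<le> liminf (\<lambda>n. ereal (?x n))"
    by (rule Liminf_bounded) (simp add: nint_dist_nonneg)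
  ultimately have "0 < liminf (\<lambda>n. ereal (?x n))" by simp
  then obtain c0 where c0: "0 < ereal c0" "ereal c0 < liminf (\<lambda>n. ereal (?x n))"
    using ereal_dense2[of 0] by auto
  have "eventually (\<lambda>n. ereal c0 < ereal (?x n)) sequentially"
    using c0(2) by (rule less_LiminfD)
  then obtain n0 where n0: "\<And>n. n0 \<le> n \<Longrightarrow> c0 < ?x n" by (auto simp: eventually_sequentially)
  define c where "c = Min (insert c0 (?x ` {1..n0}))"
  have "c \<in> insert c0 (?x ` {1..n0})" unfolding c_def by (rule Min_in) auto
  then have c: "0 < c" using c0 nint_dist_irrational_pos[OF irr] by auto
  have "c \<le> ?x n" if "n \<ge> 1" for n
  proof (cases "n \<le> n0")
    case True
    then show ?thesis unfolding c_def using that by (intro Min_le) auto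
  next
    case False
    have "c \<le> c0" unfolding c_def by (intro Min_le) auto
    then show ?thesis using n0[of n] False by simp
  qed
  then have "c * real n powr (- D) \<le> nint_dist (real n * \<alpha>)" if "n \<ge> 1" for n
    using that mult_right_mono[of c "?x n" "real n powr (- D)"] by (simp add: powr_minus field_simps)
  then show thesis using that c D0 aD by blast
qed

theorem theorem3:
  fixes \<theta> :: "nat \<Rightarrow> real" and u :: "nat \<Rightarrow> int"
    and \<delta> C \<alpha> \<beta> \<sigma> \<zeta> :: real
  assumes theta: "\<And>n. \<theta> n \<in> {-1, 1}"
    and u: "strict_mono u"
    and delta: "\<delta> < 1"
    and exp_sum: "\<And>N. N \<ge> 1 \<Longrightarrow>
      (SUP \<alpha>'::real. cmod (\<Sum>k<N. of_real (\<theta> k) * exp (2 * \<i> * of_real pi * of_real \<alpha>' * of_int (u k))))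
        \<le> C * real N powr \<delta>"
    and alpha: "\<alpha> \<notin> \<rat>"
    and beta: "\<delta> < \<beta>" "\<beta> < 1"
    and sigma: "\<sigma> > 1 - \<beta>"
    and zeta: "0 < \<zeta>" "\<zeta> \<le> 1"
    and u_asymp: "(\<lambda>N. \<bar>real_of_int (u N) / real N - \<zeta>\<bar>) \<in> O(\<lambda>N. real N powr (- \<sigma>))"
  shows "(\<exists>f :: circle \<Rightarrow> real. continuous_on UNIV f \<and>
             converges_in_law_std_normal circle_measure (normalized_sum (theta_plus \<theta>) u \<alpha> \<beta> f)) \<and>
         (\<forall>a::real. 0 < a \<and> ereal a < ereal (1 - \<beta>) / diophantine_type \<alpha> \<longrightarrow>
           (\<exists>f :: circle \<Rightarrow> real. continuous_on UNIV f \<and> f \<in> lip a \<and>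
             converges_in_law_std_normal circle_measure (normalized_sum (theta_plus \<theta>) u \<alpha> \<beta> f))) \<and>
         (\<exists>f :: circle \<Rightarrow> real. continuous_on UNIV f \<and>
             converges_in_law_std_normal circle_measure (normalized_sum (theta_minus \<theta>) u \<alpha> \<beta> f)) \<and>
         (\<forall>a::real. 0 < a \<and> ereal a < ereal (1 - \<beta>) / diophantine_type \<alpha> \<longrightarrow>
           (\<exists>f :: circle \<Rightarrow> real. continuous_on UNIV f \<and> f \<in> lip a \<and>
             converges_in_law_std_normal circle_measure (normalized_sum (theta_minus \<theta>) u \<alpha> \<beta> f)))"
proof -
  have bound: "cmod (\<Sum>k<N. of_real (\<theta> k) * cis (2 * pi * t * of_int (u k))) \<le> C * real N powr \<delta>" if "N \<ge> 1" for N t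
    using exp_sum[OF that] by (rule exponential_sum_le)
  have "0 \<le> \<delta>" using exponential_sum_exponent_nonneg[OF theta bound] .
  then have beta0: "0 < \<beta>" using beta by simp
  have omit: "(\<lambda>N. of_int (u N - u 0 - int N) / real N powr \<beta>) \<longlonglongrightarrow> 0"
    by (rule omitted_integers_negligible[OF u beta0 beta(2) sigma zeta(2) u_asymp])
  define g where "g = 2 - 2 * \<beta>"
  have g: "0 < g" "g < 2" using beta beta0 by (auto simp: g_def)
  have gap_pos: "0 < mesh j - mesh (Suc j)" for j using mesh_strict_antimono[of j "Suc j"] by simp
  \<comment> \<open>Both weights are the cases \<open>s = 1\<close> and \<open>s = -1\<close> of one
    family, and the functions below serve all \<open>\<bar>s\<bar> \<le> 1\<close> at once.\<close>
  have weights: "theta_plus \<theta> = (\<lambda>k. (1 + 1 * \<theta> k) / 2)" "theta_minus \<theta> = (\<lambda>k. (1 + (- 1) * \<theta> k) / 2)"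
    by (auto simp: fun_eq_iff theta_plus_def theta_minus_def)
  have ex: "\<exists>f :: circle \<Rightarrow> real. continuous_on UNIV f \<and>
      (\<forall>s. \<bar>s\<bar> \<le> 1 \<longrightarrow> converges_in_law_std_normal circle_measure (normalized_sum (\<lambda>k. (1 + s * \<theta> k) / 2) u \<alpha> \<beta> f))"
  proof -
    have "\<forall>j. \<exists>G. hits \<alpha> (mesh j - mesh (Suc j)) G" using hits_exists[OF alpha gap_pos] by blast
    then obtain G where G: "\<And>j. hits \<alpha> (mesh j - mesh (Suc j)) (G j)" by metis
    obtain m z \<tau> where m: "\<And>j. 0 < m j" "inj m" "\<And>j. m j \<notin> signed_sums m (predecessors j)"
      "\<And>j. mesh (Suc j) \<le> \<tau> j" "\<And>j. \<tau> j \<le> mesh j" "\<And>j. of_int (m j) * \<alpha> = \<tau> j + of_int (z j)"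
      by (rule frequencies_of_hits[OF G]) blast
    show ?thesis
      using continuous_cos_series[OF summable_amplitude[OF g], of 1 m]
        clt_cos_series[OF u bound beta(1) beta0 beta(2) omit _ m order_refl]
      unfolding g_def by blast
  qed
  have ex_lip: "\<exists>f :: circle \<Rightarrow> real. continuous_on UNIV f \<and> f \<in> lip a \<and>
      (\<forall>s. \<bar>s\<bar> \<le> 1 \<longrightarrow> converges_in_law_std_normal circle_measure (normalized_sum (\<lambda>k. (1 + s * \<theta> k) / 2) u \<alpha> \<beta> f))"
    if a: "0 < a" "ereal a < ereal (1 - \<beta>) / diophantine_type \<alpha>" for a :: real
  proof -
    obtain c D where cD: "0 < c" "0 < D" "a * D < 1 - \<beta>" "\<And>n. n \<ge> 1 \<Longrightarrow> c * real n powr (- D) \<le> nint_dist (real n * \<alpha>)"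
      by (rule diophantine_type_lower_bound[OF alpha a]) blast
    have "1 \<le> D" by (rule diophantine_exponent_ge_1[OF cD(1,2,4)])
    then have "a * 1 \<le> a * D" using a by (intro mult_left_mono) auto
    \<comment> \<open>\<open>D \<ge> 1\<close> enters here, to bring \<open>a\<close> into the range
      of the Hoelder estimate for cosines.\<close>
    then have a1: "a \<le> 1" using cD beta0 by linarith
    define K where "K = 3 powr D / c + 2"
    have K: "0 < K" using cD by (simp add: K_def add_pos_pos)
    have "\<forall>j. \<exists>G. hits \<alpha> (mesh j - mesh (Suc j)) G \<and> real G \<le> K * (mesh j - mesh (Suc j)) powr (- D)"
    proof
      fix j
      have "mesh j - mesh (Suc j) \<le> 1" using mesh_le_1[of j] mesh_pos[of "Suc j"] by linarith
      then show "\<exists>G. hits \<alpha> (mesh j - mesh (Suc j)) G \<and> real G \<le> K * (mesh j - mesh (Suc j)) powr (- D)"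
        unfolding K_def by (intro hits_diophantine[OF cD(1,2,4) gap_pos])
    qed
    then obtain G where G: "\<And>j. hits \<alpha> (mesh j - mesh (Suc j)) (G j)"
      "\<And>j. real (G j) \<le> K * (mesh j - mesh (Suc j)) powr (- D)" by metis
    obtain m z \<tau> where m: "\<And>j. 0 < m j" "inj m" "\<And>j. m j \<notin> signed_sums m (predecessors j)"
      "\<And>j. mesh (Suc j) \<le> \<tau> j" "\<And>j. \<tau> j \<le> mesh j" "\<And>j. of_int (m j) * \<alpha> = \<tau> j + of_int (z j)"
      and mG: "\<And>j. m j \<le> (3 ^ card (predecessors j) + int j + 1) * int (G j)"
      by (rule frequencies_of_hits[OF G(1)]) blast
    have aD: "a * D < g / 2" using cD by (simp add: g_def)
    let ?w = "\<lambda>J j. \<bar>amplitude g J j\<bar> * (2 * (pi * of_int (m j)) powr a)"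
    have sm: "summable (?w J)" for J
      by (rule summable_hoelder_weights[OF g a(1) cD(2) aD K G(2) m(1) mG])
    \<comment> \<open>Discarding the terms below \<open>J\<close> brings the sum of the weights, and
      with it the Hoelder constant, below 1.\<close>
    obtain J where J: "\<And>n. J \<le> n \<Longrightarrow> norm (\<Sum>i. ?w 1 (i + n)) < 1"
      using suminf_exist_split[OF _ sm[of 1], of 1] by auto
    define J0 where "J0 = max 1 J"
    have J0: "1 \<le> J0" "J \<le> J0" by (auto simp: J0_def)
    have "(\<Sum>j. ?w J0 j) = (\<Sum>j. ?w J0 (j + J0)) + (\<Sum>j<J0. ?w J0 j)"
      by (rule suminf_split_initial_segment[OF sm])
    also have "(\<Sum>j<J0. ?w J0 j) = 0" by (intro sum.neutral) (auto simp: amplitude_def)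
    \<comment> \<open>From index \<open>J0\<close> on, the amplitudes do not depend on the
      cut-off.\<close>
    also have "(\<lambda>j. ?w J0 (j + J0)) = (\<lambda>j. ?w 1 (j + J0))" using J0 by (auto simp: amplitude_def fun_eq_iff)
    finally have le: "(\<Sum>j. ?w J0 j) \<le> 1" using J[OF J0(2)] by simp
    have "cos_series (amplitude g J0) m \<in> lip a"
      by (rule cos_series_lip[OF a(1) a1 summable_amplitude[OF g] m(1) sm le])
    then show ?thesis
      using continuous_cos_series[OF summable_amplitude[OF g], of J0 m]
        clt_cos_series[OF u bound beta(1) beta0 beta(2) omit _ m J0(1)]
      unfolding g_def by blast
  qed
  have one: "\<bar>1::real\<bar> \<le> 1" "\<bar>- 1::real\<bar> \<le> 1" by simp_all
  show ?thesis unfolding weights using ex ex_lip one by blast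
qed

end
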